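(* Let $A$ be a unital algebra of Jordan brackets over a field of characteristic zero. If $A$ satisfies a polynomial identity $g_0$ (nonzero as an element of a free unital algebra of Jordan brackets), then: (a) $A$ satisfies, for some $m\ge 1$, a nontrivial polynomial identity of the form $$\sum_{i=0}^{[m/2]}\sum_{\sigma\in S_m}c_{\sigma,i}\,\langle x_{\sigma(1)},x_{\sigma(2)}\rangle\cdots\langle x_{\sigma(2i-1)},x_{\sigma(2i)}\rangle\, D(x_{\sigma(2i+1)})\cdots D(x_{\sigma(m)})=0,$$ where the $c_{\sigma,i}$ are scalars, $D(x)=\{x,1\}$ and $\langle x,y\rangle=\{x,y\}-(D(x)y-xD(y))$; (b) $A$ satisfies, for some $m\ge1$, a nontrivial polynomial identity in variables $x_1,\dots,x_m,z_1,\dots,z_{2m}$ of the form $$\sum_{i=0}^{[m/2]}\sum_{\sigma\in S_m}c_{\sigma,i}\prod_{k=1}^{i}[x_{\sigma(2k-1)};x_{\sigma(2k)};z_{2k-1};z_{2k}]\cdot\prod_{k=1}^{m-2i}\{x_{\sigma(2i+k)};z_{2i+2k-1};z_{2i+2k}\}\cdot\prod_{k=1}^{2i}z_{2m-2i+k}=0,$$ where the $c_{\sigma,i}$ are scalars, $$[u_1;u_2;w_1;w_2]=\{u_1,u_2\}w_1w_2+\{u_1,w_1w_2\}u_2+u_1\{w_1w_2,u_2\}-\sum_{\sigma_1,\sigma_2\in S_2}\operatorname{sgn}(\sigma_1)\{u_{\sigma_1(1)},w_{\sigma_2(1)}\}u_{\sigma_1(2)}w_{\sigma_2(2)},$$ 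$$\{t_1;t_2;t_3\}=\{t_2t_3,t_1\}-\{t_2,t_1\}t_3-\{t_3,t_1\}t_2.$$
   Context: A unital algebra of Jordan brackets is a vector space $A$ with an associative commutative product $\cdot$ with unit $1$ and an anticommutative bracket $\{,\}$ such that, with $D(a)=\{a,1\}$, $$\{a,bc\}=\{a,b\}c+b\{a,c\}-D(a)bc,$$ $$\{a,\{b,c\}\}=\{\{a,b\},c\}+\{b,\{a,c\}\}+D(a)\{b,c\}+D(b)\{c,a\}+D(c)\{a,b\}$$ for all $a,b,c\in A$. A polynomial identity of $A$ is an element $f(x_1,\dots,x_n)$ of the free unital algebra of Jordan brackets generated by $x_1,\dots,x_n$ and the unit $1$ such that $f(a_1,\dots,a_n)=0$ for all $a_1,\dots,a_n\in A$. It is nontrivial if $f\ne 0$ in the free algebra. *)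

theory Defs
  imports Complex_Main "HOL-Combinatorics.Permutations"
begin

section \<open>Unital algebras of Jordan brackets\<close>

text \<open>The sort \<open>{comm_ring, comm_monoid_mult}\<close> is that of associative commutative rings with unit
  in which \<open>0 = 1\<close> is not excluded, unlike in \<open>comm_ring_1\<close>; so the zero algebra is allowed.
  (Bi)linearity of product and bracket in the other argument follows from (anti)commutativity.\<close>

locale jordan_bracket_algebra = vector_space scale
  for scale :: "'k::field \<Rightarrow> 'a::{comm_ring, comm_monoid_mult} \<Rightarrow> 'a" +
  fixes bracket :: "'a \<Rightarrow> 'a \<Rightarrow> 'a" ("(\<lbrace>_,/ _\<rbrace>)")
  assumes scale_mult_left: "scale r a * b = scale r (a * b)"
    and bracket_add_left: "\<lbrace>a + b, c\<rbrace> = \<lbrace>a, c\<rbrace> + \<lbrace>b, c\<rbrace>"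
    and bracket_scale_left: "\<lbrace>scale r a, b\<rbrace> = scale r \<lbrace>a, b\<rbrace>"
    and bracket_anticomm: "\<lbrace>a, b\<rbrace> = - \<lbrace>b, a\<rbrace>"
    and bracket_mult: "\<lbrace>a, b * c\<rbrace> = \<lbrace>a, b\<rbrace> * c + b * \<lbrace>a, c\<rbrace> - \<lbrace>a, 1\<rbrace> * b * c"
    and bracket_bracket: "\<lbrace>a, \<lbrace>b, c\<rbrace>\<rbrace> = \<lbrace>\<lbrace>a, b\<rbrace>, c\<rbrace> + \<lbrace>b, \<lbrace>a, c\<rbrace>\<rbrace>
      + \<lbrace>a, 1\<rbrace> * \<lbrace>b, c\<rbrace> + \<lbrace>b, 1\<rbrace> * \<lbrace>c, a\<rbrace> + \<lbrace>c, 1\<rbrace> * \<lbrace>a, b\<rbrace>"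
begin

definition D :: "'a \<Rightarrow> 'a" where
  "D a = \<lbrace>a, 1\<rbrace>"

definition angle :: "'a \<Rightarrow> 'a \<Rightarrow> 'a" where
  "angle a b = \<lbrace>a, b\<rbrace> - (D a * b - a * D b)"

text \<open>The elements \<open>[u1; u2; w1; w2]\<close> and \<open>{t1; t2; t3}\<close>.\<close>

definition quad :: "'a \<Rightarrow> 'a \<Rightarrow> 'a \<Rightarrow> 'a \<Rightarrow> 'a" where
  "quad u1 u2 w1 w2 =
     (let u = (\<lambda>j::nat. if j = 1 then u1 else u2); w = (\<lambda>j::nat. if j = 1 then w1 else w2) in
      \<lbrace>u1, u2\<rbrace> * w1 * w2 + \<lbrace>u1, w1 * w2\<rbrace> * u2 + u1 * \<lbrace>w1 * w2, u2\<rbrace>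
      - (\<Sum>\<sigma>1 | \<sigma>1 permutes {1, 2}. \<Sum>\<sigma>2 | \<sigma>2 permutes {1, 2}.
           scale (of_int (sign \<sigma>1)) (\<lbrace>u (\<sigma>1 1), w (\<sigma>2 1)\<rbrace> * u (\<sigma>1 2) * w (\<sigma>2 2))))"

definition triple :: "'a \<Rightarrow> 'a \<Rightarrow> 'a \<Rightarrow> 'a" where
  "triple t1 t2 t3 = \<lbrace>t2 * t3, t1\<rbrace> - \<lbrace>t2, t1\<rbrace> * t3 - \<lbrace>t3, t1\<rbrace> * t2"

lemma bracket_add_right: "\<lbrace>c, a + b\<rbrace> = \<lbrace>c, a\<rbrace> + \<lbrace>c, b\<rbrace>"
  using bracket_anticomm[of c "a + b"] bracket_anticomm[of c a] bracket_anticomm[of c b]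
  by (simp add: bracket_add_left)

lemma bracket_scale_right: "\<lbrace>a, scale r b\<rbrace> = scale r \<lbrace>a, b\<rbrace>"
  using bracket_anticomm[of a "scale r b"] bracket_anticomm[of a b]
  by (simp add: bracket_scale_left)

end


section \<open>The free unital algebra of Jordan brackets\<close>

text \<open>Formal expressions in variables from \<open>'v\<close>, modulo the least congruence that contains all
  instances of the axioms.\<close>

datatype ('k, 'v) jb_term =
    JVar 'v | JZero | JOne
  | JAdd "('k, 'v) jb_term" "('k, 'v) jb_term"
  | JNeg "('k, 'v) jb_term"
  | JScale 'k "('k, 'v) jb_term"
  | JMul "('k, 'v) jb_term" "('k, 'v) jb_term"
  | JBr "('k, 'v) jb_term" "('k, 'v) jb_term"

inductive jb_eq :: "('k::field, 'v) jb_term \<Rightarrow> ('k, 'v) jb_term \<Rightarrow> bool" where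
  refl: "jb_eq s s"
| sym: "jb_eq s t \<Longrightarrow> jb_eq t s"
| trans: "jb_eq s t \<Longrightarrow> jb_eq t u \<Longrightarrow> jb_eq s u"
| cong_add: "jb_eq s s' \<Longrightarrow> jb_eq t t' \<Longrightarrow> jb_eq (JAdd s t) (JAdd s' t')"
| cong_neg: "jb_eq s s' \<Longrightarrow> jb_eq (JNeg s) (JNeg s')"
| cong_scale: "jb_eq s s' \<Longrightarrow> jb_eq (JScale r s) (JScale r s')"
| cong_mul: "jb_eq s s' \<Longrightarrow> jb_eq t t' \<Longrightarrow> jb_eq (JMul s t) (JMul s' t')"
| cong_br: "jb_eq s s' \<Longrightarrow> jb_eq t t' \<Longrightarrow> jb_eq (JBr s t) (JBr s' t')"
| add_assoc: "jb_eq (JAdd (JAdd s t) u) (JAdd s (JAdd t u))"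
| add_commute: "jb_eq (JAdd s t) (JAdd t s)"
| add_zero: "jb_eq (JAdd JZero s) s"
| add_neg: "jb_eq (JAdd (JNeg s) s) JZero"
| scale_add_right: "jb_eq (JScale r (JAdd s t)) (JAdd (JScale r s) (JScale r t))"
| scale_add_left: "jb_eq (JScale (r + q) s) (JAdd (JScale r s) (JScale q s))"
| scale_scale: "jb_eq (JScale r (JScale q s)) (JScale (r * q) s)"
| scale_one: "jb_eq (JScale 1 s) s"
| mul_assoc: "jb_eq (JMul (JMul s t) u) (JMul s (JMul t u))"
| mul_commute: "jb_eq (JMul s t) (JMul t s)"
| mul_one: "jb_eq (JMul JOne s) s"
| mul_add: "jb_eq (JMul (JAdd s t) u) (JAdd (JMul s u) (JMul t u))"
| mul_scale: "jb_eq (JMul (JScale r s) t) (JScale r (JMul s t))"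
| br_add: "jb_eq (JBr (JAdd s t) u) (JAdd (JBr s u) (JBr t u))"
| br_scale: "jb_eq (JBr (JScale r s) t) (JScale r (JBr s t))"
| br_anticomm: "jb_eq (JBr s t) (JNeg (JBr t s))"
| br_mul: "jb_eq (JBr s (JMul t u))
    (JAdd (JAdd (JMul (JBr s t) u) (JMul t (JBr s u))) (JNeg (JMul (JMul (JBr s JOne) t) u)))"
| br_br: "jb_eq (JBr s (JBr t u))
    (JAdd (JAdd (JAdd (JAdd (JBr (JBr s t) u) (JBr t (JBr s u)))
      (JMul (JBr s JOne) (JBr t u))) (JMul (JBr t JOne) (JBr u s))) (JMul (JBr u JOne) (JBr s t)))"

quotient_type (overloaded) ('k, 'v) free_jb = "('k::field, 'v) jb_term" / jb_eq
  by (intro equivpI reflpI sympI transpI) (fact jb_eq.refl, erule jb_eq.sym, erule (1) jb_eq.trans)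

lift_definition free_var :: "'v \<Rightarrow> ('k::field, 'v) free_jb" is JVar .
lift_definition free_scale :: "'k::field \<Rightarrow> ('k, 'v) free_jb \<Rightarrow> ('k, 'v) free_jb" is JScale
  by (rule jb_eq.cong_scale)
lift_definition free_bracket :: "('k::field, 'v) free_jb \<Rightarrow> ('k, 'v) free_jb \<Rightarrow> ('k, 'v) free_jb" is JBr
  by (rule jb_eq.cong_br)

instantiation free_jb :: (field, type) "{comm_ring, comm_monoid_mult}"
begin

lift_definition zero_free_jb :: "('a, 'b) free_jb" is JZero .
lift_definition one_free_jb :: "('a, 'b) free_jb" is JOne .
lift_definition plus_free_jb :: "('a, 'b) free_jb \<Rightarrow> ('a, 'b) free_jb \<Rightarrow> ('a, 'b) free_jb" is JAdd
  by (rule jb_eq.cong_add)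
lift_definition uminus_free_jb :: "('a, 'b) free_jb \<Rightarrow> ('a, 'b) free_jb" is JNeg
  by (rule jb_eq.cong_neg)
lift_definition minus_free_jb :: "('a, 'b) free_jb \<Rightarrow> ('a, 'b) free_jb \<Rightarrow> ('a, 'b) free_jb"
  is "\<lambda>s t. JAdd s (JNeg t)"
  by (intro jb_eq.cong_add jb_eq.cong_neg)
lift_definition times_free_jb :: "('a, 'b) free_jb \<Rightarrow> ('a, 'b) free_jb \<Rightarrow> ('a, 'b) free_jb" is JMul
  by (rule jb_eq.cong_mul)

instance
proof
  fix a b c :: "('a, 'b) free_jb"
  show "a + b + c = a + (b + c)" by transfer (rule jb_eq.add_assoc)
  show "a + b = b + a" by transfer (rule jb_eq.add_commute)
  show "0 + a = a" by transfer (rule jb_eq.add_zero)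
  show "- a + a = 0" by transfer (rule jb_eq.add_neg)
  show "a - b = a + - b" by transfer (rule jb_eq.refl)
  show "a * b * c = a * (b * c)" by transfer (rule jb_eq.mul_assoc)
  show "a * b = b * a" by transfer (rule jb_eq.mul_commute)
  show "1 * a = a" by transfer (rule jb_eq.mul_one)
  show "(a + b) * c = a * c + b * c" by transfer (rule jb_eq.mul_add)
qed

end

global_interpretation free: jordan_bracket_algebra free_scale free_bracket
proof
  fix r q :: "'k::field" and a b c :: "('k, 'v) free_jb"
  show "free_scale r (a + b) = free_scale r a + free_scale r b"
    by transfer (rule jb_eq.scale_add_right)
  show "free_scale (r + q) a = free_scale r a + free_scale q a"
    by transfer (rule jb_eq.scale_add_left)
  show "free_scale r (free_scale q a) = free_scale (r * q) a"
    by transfer (rule jb_eq.scale_scale)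
  show "free_scale 1 a = a" by transfer (rule jb_eq.scale_one)
  show "free_scale r a * b = free_scale r (a * b)" by transfer (rule jb_eq.mul_scale)
  show "free_bracket (a + b) c = free_bracket a c + free_bracket b c"
    by transfer (rule jb_eq.br_add)
  show "free_bracket (free_scale r a) b = free_scale r (free_bracket a b)"
    by transfer (rule jb_eq.br_scale)
  show "free_bracket a b = - free_bracket b a" by transfer (rule jb_eq.br_anticomm)
  show "free_bracket a (b * c)
      = free_bracket a b * c + b * free_bracket a c - free_bracket a 1 * b * c"
    by transfer (rule jb_eq.br_mul)
  show "free_bracket a (free_bracket b c)
      = free_bracket (free_bracket a b) c + free_bracket b (free_bracket a c)
        + free_bracket a 1 * free_bracket b c + free_bracket b 1 * free_bracket c a
        + free_bracket c 1 * free_bracket a b"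
    by transfer (rule jb_eq.br_br)
qed


section \<open>Evaluation and polynomial identities\<close>

context
  fixes scale :: "'k::field \<Rightarrow> 'a::{comm_ring, comm_monoid_mult} \<Rightarrow> 'a"
    and bracket :: "'a \<Rightarrow> 'a \<Rightarrow> 'a"
    and \<rho> :: "'v \<Rightarrow> 'a"
begin

primrec jb_term_eval :: "('k, 'v) jb_term \<Rightarrow> 'a" where
  "jb_term_eval (JVar v) = \<rho> v"
| "jb_term_eval JZero = 0"
| "jb_term_eval JOne = 1"
| "jb_term_eval (JAdd s t) = jb_term_eval s + jb_term_eval t"
| "jb_term_eval (JNeg s) = - jb_term_eval s"
| "jb_term_eval (JScale r s) = scale r (jb_term_eval s)"
| "jb_term_eval (JMul s t) = jb_term_eval s * jb_term_eval t"
| "jb_term_eval (JBr s t) = bracket (jb_term_eval s) (jb_term_eval t)"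

end

context jordan_bracket_algebra
begin

text \<open>The value \<open>f(\<rho>)\<close>. By \<open>eval_abs\<close> below it does not depend on the chosen representative.\<close>

definition eval :: "('v \<Rightarrow> 'a) \<Rightarrow> ('k, 'v) free_jb \<Rightarrow> 'a" where
  "eval \<rho> f = jb_term_eval scale bracket \<rho> (rep_free_jb f)"

definition polynomial_identity :: "('k, 'v) free_jb \<Rightarrow> bool" where
  "polynomial_identity f \<longleftrightarrow> (\<forall>\<rho>. eval \<rho> f = 0)"

lemma jb_term_eval_cong:
  "jb_eq s t \<Longrightarrow> jb_term_eval scale bracket \<rho> s = jb_term_eval scale bracket \<rho> t"
proof (induction rule: jb_eq.induct)
  case (br_anticomm s t)
  show ?case by (simp only: jb_term_eval.simps) (rule bracket_anticomm)
next
  case (br_mul s t u)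
  show ?case by (simp add: bracket_mult)
next
  case (br_br s t u)
  show ?case
    using bracket_bracket[of "jb_term_eval scale bracket \<rho> s" "jb_term_eval scale bracket \<rho> t"
        "jb_term_eval scale bracket \<rho> u"] by simp
next
  case (mul_scale r s t)
  show ?case by (simp add: scale_mult_left)
qed (auto simp: algebra_simps bracket_add_left bracket_scale_left
      scale_right_distrib scale_left_distrib)

lemma eval_abs: "eval \<rho> (abs_free_jb t) = jb_term_eval scale bracket \<rho> t"
  unfolding eval_def
  by (rule jb_term_eval_cong) (rule rep_abs_rsp_left[OF Quotient3_free_jb], rule jb_eq.refl)

lemma eval_hom [simp]:
  "eval \<rho> (free_var v) = \<rho> v"
  "eval \<rho> 0 = 0"
  "eval \<rho> 1 = 1"
  "eval \<rho> (f + g) = eval \<rho> f + eval \<rho> g"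
  "eval \<rho> (- f) = - eval \<rho> f"
  "eval \<rho> (f - g) = eval \<rho> f - eval \<rho> g"
  "eval \<rho> (free_scale r f) = scale r (eval \<rho> f)"
  "eval \<rho> (f * g) = eval \<rho> f * eval \<rho> g"
  "eval \<rho> (free_bracket f g) = \<lbrace>eval \<rho> f, eval \<rho> g\<rbrace>"
proof -
  obtain s t where st: "f = abs_free_jb s" "g = abs_free_jb t"
    by (metis Quotient_abs_rep[OF Quotient_free_jb])
  show "eval \<rho> (free_var v) = \<rho> v" "eval \<rho> 0 = 0" "eval \<rho> 1 = 1"
    "eval \<rho> (f + g) = eval \<rho> f + eval \<rho> g"
    "eval \<rho> (- f) = - eval \<rho> f"
    "eval \<rho> (f - g) = eval \<rho> f - eval \<rho> g"
    "eval \<rho> (free_scale r f) = scale r (eval \<rho> f)"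
    "eval \<rho> (f * g) = eval \<rho> f * eval \<rho> g"
    "eval \<rho> (free_bracket f g) = \<lbrace>eval \<rho> f, eval \<rho> g\<rbrace>"
    by (simp_all add: st eval_abs free_var.abs_eq zero_free_jb.abs_eq one_free_jb.abs_eq
        plus_free_jb.abs_eq uminus_free_jb.abs_eq minus_free_jb.abs_eq free_scale.abs_eq
        times_free_jb.abs_eq free_bracket.abs_eq)
qed

text \<open>Together with \<open>eval_hom\<close>, the universal property of \<open>free_jb\<close>.\<close>

lemma eval_unique:
  assumes "\<And>v. h (free_var v) = \<rho> v" "h 1 = 1"
    and "\<And>f g. h (f + g) = h f + h g"
    and "\<And>r f. h (free_scale r f) = scale r (h f)"
    and "\<And>f g. h (f * g) = h f * h g"
    and "\<And>f g. h (free_bracket f g) = \<lbrace>h f, h g\<rbrace>"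
  shows "h f = eval \<rho> f"
proof -
  have zero: "h 0 = 0"
    using assms(3)[of 0 0] by simp
  have neg: "h (- f) = - h f" for f
    using assms(3)[of "- f" f] zero by (simp add: eq_neg_iff_add_eq_0)
  have "h (abs_free_jb t) = eval \<rho> (abs_free_jb t)" for t
    unfolding eval_abs
    by (induction t) (simp_all add: assms zero neg free_var.abs_eq[symmetric]
        zero_free_jb.abs_eq[symmetric] one_free_jb.abs_eq[symmetric]
        plus_free_jb.abs_eq[symmetric] uminus_free_jb.abs_eq[symmetric]
        free_scale.abs_eq[symmetric] times_free_jb.abs_eq[symmetric]
        free_bracket.abs_eq[symmetric])
  then show ?thesis
    by (metis Quotient_abs_rep[OF Quotient_free_jb])
qed

end

lemma trivial_bracket_algebra:
  "jordan_bracket_algebra (*) (\<lambda>_ _. 0 :: 'k::field)"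
  by standard (simp_all add: algebra_simps)

instance free_jb :: (field, type) comm_ring_1
proof
  interpret triv: jordan_bracket_algebra "(*)" "\<lambda>_ _. 0 :: 'a"
    by (rule trivial_bracket_algebra)
  show "(0 :: ('a, 'b) free_jb) \<noteq> 1"
    by (metis triv.eval_hom(2,3) zero_neq_one)
qed

text \<open>Enlarging the set of variables embeds free algebras into each other. Hence whether an element
  of the free algebra on \<open>x\<^sub>1, \<dots>, x\<^sub>n\<close> is nonzero may be decided in the free algebra on any set of
  variables containing \<open>x\<^sub>1, \<dots>, x\<^sub>n\<close>.\<close>

lemma inj_rename:
  fixes h :: "'v \<Rightarrow> 'w"
  assumes "inj h"
  shows "inj (free.eval (\<lambda>v. free_var (h v)) :: ('k::field, 'v) free_jb \<Rightarrow> ('k, 'w) free_jb)"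
proof (rule inj_on_inverseI)
  fix f :: "('k, 'v) free_jb"
  let ?back = "free.eval (\<lambda>w. free_var (inv h w)) :: ('k, 'w) free_jb \<Rightarrow> ('k, 'v) free_jb"
  have "?back (free.eval (\<lambda>v. free_var (h v)) f) = free.eval free_var f"
    by (rule free.eval_unique) (simp_all add: assms)
  also have "\<dots> = f"
    by (rule free.eval_unique[where h = "\<lambda>f. f", symmetric]) simp_all
  finally show "?back (free.eval (\<lambda>v. free_var (h v)) f) = f" .
qed


section \<open>The two families of multilinear polynomials\<close>

text \<open>The permutations \<open>\<sigma> \<in> S\<^sub>m\<close> are those of the index set \<open>{1..m}\<close>; \<open>m div 2\<close> is the integral part
  of \<open>m/2\<close>.\<close>

definition angle_D_poly :: "nat \<Rightarrow> ((nat \<Rightarrow> nat) \<Rightarrow> nat \<Rightarrow> 'k::field) \<Rightarrow> ('k, nat) free_jb" where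
  "angle_D_poly m c =
     (\<Sum>i = 0..m div 2. \<Sum>\<sigma> | \<sigma> permutes {1..m}.
        free_scale (c \<sigma> i)
          ((\<Prod>k = 1..i. free.angle (free_var (\<sigma> (2 * k - 1))) (free_var (\<sigma> (2 * k))))
           * (\<Prod>k = 2 * i + 1..m. free.D (free_var (\<sigma> k)))))"

datatype xz_var = X nat | Z nat

definition quad_triple_poly :: "nat \<Rightarrow> ((nat \<Rightarrow> nat) \<Rightarrow> nat \<Rightarrow> 'k::field) \<Rightarrow> ('k, xz_var) free_jb" where
  "quad_triple_poly m c =
     (let x = (\<lambda>j. free_var (X j)); z = (\<lambda>j. free_var (Z j)) in
      \<Sum>i = 0..m div 2. \<Sum>\<sigma> | \<sigma> permutes {1..m}.
        free_scale (c \<sigma> i)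
          ((\<Prod>k = 1..i. free.quad (x (\<sigma> (2 * k - 1))) (x (\<sigma> (2 * k))) (z (2 * k - 1)) (z (2 * k)))
           * (\<Prod>k = 1..m - 2 * i. free.triple (x (\<sigma> (2 * i + k)))
                (z (2 * i + 2 * k - 1)) (z (2 * i + 2 * k)))
           * (\<Prod>k = 1..2 * i. z (2 * m - 2 * i + k))))"

end

(*
  With D a = {a, 1}, both D and <_, _> are derivations, and
  <a, <b, c>> = <<a, b>, c> + <b, <a, c>> + 2 (D a <b, c> + D b <c, a> + D c <a, b>).
  Hence an element of the free algebra that is linear in x is a sum of a multiple of x, an element
  with D x substituted for x, and elements with <x, a> substituted for x.  The free algebra is compared
  with the algebra spanned by exponentials e^u (u in a lattice with a skew form), in which
  D e^u = w(u, e) e^(u+e) and <e^u, e^v> = 2 w(u, v) e^(u+v+e) for a fixed weight e.  A multilinear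
  element with K brackets takes the value p(w) e^(...) on exponentials, where p is a polynomial in the
  entries of w, and the decomposition shows by induction that p = 0 only for the zero element.

  Given an identity f, linearize it, and then replace f(.., x, ..) by f(.., xz, ..) - z f(.., x, ..) -
  x f(.., z, ..), with z a new variable, as long as possible.  This terminates because every monomial of p
  involves at most 2K of the variables.  At the end p is additive in every variable, and this forces f to
  be a combination of products of elements <x, y> and D x.  Part (b) follows from part (a), because
  [u1; u2; w1; w2] = <u1, u2> w1 w2 and {t1; t2; t3} = D(t1) t2 t3.
*)

theory Submission
  imports Defs "HOL-Library.Multiset" "HOL-Library.Poly_Mapping" "HOL-Library.Product_Plus"
    "HOL-Computational_Algebra.Polynomial"
begin

section \<open>The derivations \<open>D\<close> and \<open>angle\<close>\<close>

text \<open>The free algebra is a quotient of terms without a normal form, so nonvanishing in it has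
  to be certified from outside; the exponentials serve this purpose. The factor 2 in
  \<open><e^u, e^v>\<close> is forced: with a factor l in its place, the Jacobi identity on
  exponentials compares l^2 with 2 l times the same cyclic sum.

  An identity need not be homogeneous in the number of brackets, and substitutions that scale
  variables separate multidegrees only. The reduction therefore carries one component for each
  bracket number K, of which only the sum is known to be an identity, and acts on all components at
  once.

  The bound 2K on the number of variables holds for elements whose coefficient vanishes as soon as
  the form is made zero on one variable; these are the elements that vanish under x := 1 for each x.
  To arrange this, variables are set to 1 as long as something nonzero remains, before any defect is
  formed, and the property passes on to the defects.\<close>

context jordan_bracket_algebra
begin

lemma scale_mult_right: "a * scale r b = scale r (a * b)"
  by (metis mult.commute scale_mult_left)

lemma bracket_zero_left [simp]: "\<lbrace>0, a\<rbrace> = 0"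
  using bracket_add_left[of 0 0 a] by simp

lemma bracket_zero_right [simp]: "\<lbrace>a, 0\<rbrace> = 0"
  using bracket_add_right[of a 0 0] by simp

lemma bracket_minus_left: "\<lbrace>- a, b\<rbrace> = - \<lbrace>a, b\<rbrace>"
  using bracket_add_left[of a "- a" b] by (simp add: eq_neg_iff_add_eq_0 add.commute)

lemma bracket_diff_left: "\<lbrace>a - b, c\<rbrace> = \<lbrace>a, c\<rbrace> - \<lbrace>b, c\<rbrace>"
  using bracket_add_left[of a "- b" c] by (simp add: bracket_minus_left)

lemma bracket_one_left: "\<lbrace>1, a\<rbrace> = - D a"
  unfolding D_def by (rule bracket_anticomm)

lemma bracket_eq_angle: "\<lbrace>a, b\<rbrace> = angle a b + (D a * b - a * D b)"
  by (simp add: angle_def)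

lemma D_add: "D (a + b) = D a + D b"
  by (simp add: D_def bracket_add_left)

lemma D_scale: "D (scale r a) = scale r (D a)"
  by (simp add: D_def bracket_scale_left)

lemma D_zero [simp]: "D 0 = 0"
  by (simp add: D_def)

lemma D_diff: "D (a - b) = D a - D b"
  by (simp add: D_def bracket_diff_left)

lemma angle_add_left: "angle (a + b) c = angle a c + angle b c"
  by (simp add: angle_def bracket_add_left D_add algebra_simps)

lemma angle_scale_left: "angle (scale r a) b = scale r (angle a b)"
  by (simp add: angle_def bracket_scale_left D_scale scale_mult_left scale_right_diff_distrib)

lemma angle_anticomm: "angle a b = - angle b a"
  using bracket_anticomm[of a b] by (simp add: angle_def algebra_simps)

lemma angle_add_right: "angle c (a + b) = angle c a + angle c b"
  by (metis angle_add_left angle_anticomm minus_add_distrib)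

lemma angle_scale_right: "angle a (scale r b) = scale r (angle a b)"
  by (metis angle_anticomm angle_scale_left scale_minus_right)

lemma angle_zero_left [simp]: "angle 0 a = 0"
  by (simp add: angle_def)

lemma angle_zero_right [simp]: "angle a 0 = 0"
  by (simp add: angle_def)

end

text \<open>Anticommutativity gives only \<open>2 * D 1 = 0\<close>. Dividing by 2 yields
  \<open>D 1 = 0\<close>, on which the derivation rules rest.\<close>

locale jordan_bracket_algebra_char_0 = jordan_bracket_algebra scale bracket
  for scale :: "'k::field_char_0 \<Rightarrow> 'a::{comm_ring, comm_monoid_mult} \<Rightarrow> 'a" and bracket ("(\<lbrace>_,/ _\<rbrace>)")
begin

lemma D_one [simp]: "D 1 = 0"
proof -
  have "scale 2 (D 1) = D 1 + D 1"
    using scale_left_distrib[of 1 1 "D 1"] by simp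
  also have "\<dots> = 0"
    using bracket_anticomm[of 1 1] by (metis D_def add.right_inverse)
  finally show ?thesis
    by simp
qed

lemma D_mult: "D (a * b) = D a * b + a * D b"
proof -
  have "- D (a * b) = - D a * b + a * (- D b) - D 1 * a * b"
    using bracket_mult[of 1 a b] unfolding bracket_one_left D_def[symmetric] .
  then show ?thesis
    by (metis (no_types, lifting) D_one diff_zero minus_add_distrib minus_minus minus_mult_left
        minus_mult_right mult_zero_left)
qed

lemma angle_one_right [simp]: "angle a 1 = 0"
  by (simp add: angle_def D_def[symmetric])

text \<open>The correction \<open>D a * b - a * D b\<close> built into \<open>angle\<close> absorbs
  the term \<open>- D a * b * c\<close> of the bracket axiom, because \<open>D\<close> is itself a
  derivation.\<close>

lemma angle_mult_right: "angle a (b * c) = angle a b * c + b * angle a c"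
proof -
  have "\<lbrace>a, b * c\<rbrace> = \<lbrace>a, b\<rbrace> * c + b * \<lbrace>a, c\<rbrace> - D a * b * c"
    unfolding D_def by (rule bracket_mult)
  then show ?thesis
    by (simp add: bracket_eq_angle D_mult algebra_simps)
qed

lemma angle_mult_left: "angle (b * c) a = angle b a * c + b * angle c a"
  using angle_mult_right[of a b c] angle_anticomm[of a] by (simp add: algebra_simps)

text \<open>The last axiom with third element 1: the two products of \<open>D a\<close> and
  \<open>D b\<close> cancel, and \<open>D 1 = 0\<close>.\<close>

lemma D_bracket: "D \<lbrace>a, b\<rbrace> = \<lbrace>D a, b\<rbrace> + \<lbrace>a, D b\<rbrace>"
proof -
  have "\<lbrace>a, D b\<rbrace> = D \<lbrace>a, b\<rbrace> + \<lbrace>b, D a\<rbrace> + D a * D b + D b * - D a + D 1 * \<lbrace>a, b\<rbrace>"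
    using bracket_bracket[of a b 1] unfolding bracket_one_left D_def[symmetric] .
  then show ?thesis
    using bracket_anticomm[of b "D a"] by (simp add: algebra_simps)
qed

lemma D_angle: "D (angle a b) = angle (D a) b + angle a (D b)"
  by (simp add: angle_def D_bracket D_add D_diff D_mult algebra_simps)

lemma angle_diff_right: "angle c (a - b) = angle c a - angle c b"
  using angle_add_right[of c "a - b" b] by (simp add: eq_diff_eq)

text \<open>One copy of the cyclic sum is the defect in the bracket axiom, where the parts of the
  form \<open>D b * c - b * D c\<close> cancel cyclically. A second copy appears when the nested
  brackets are written through \<open>angle\<close> and \<open>D\<close>; hence the factor
  2.\<close>

lemma angle_angle:
  "angle a (angle b c) = angle (angle a b) c + angle b (angle a c)
    + scale 2 (D a * angle b c + D b * angle c a + D c * angle a b)"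
proof -
  have two: "scale 2 x = x + x" for x
    using scale_left_distrib[of 1 1 x] by simp
  have expand: "\<lbrace>x, \<lbrace>y, z\<rbrace>\<rbrace> = angle x (angle y z) + (angle x (D y) * z + D y * angle x z)
      - (angle x y * D z + y * angle x (D z)) + D x * (angle y z + D y * z - y * D z)
      - x * (angle (D y) z + angle y (D z) + D (D y) * z - y * D (D z))" for x y z
    by (simp add: bracket_eq_angle angle_add_right angle_diff_right angle_mult_right D_add D_diff
        D_mult D_angle algebra_simps)
  have "0 = \<lbrace>a, \<lbrace>b, c\<rbrace>\<rbrace> - (- \<lbrace>c, \<lbrace>a, b\<rbrace>\<rbrace> + \<lbrace>b, \<lbrace>a, c\<rbrace>\<rbrace>
      + D a * \<lbrace>b, c\<rbrace> + D b * \<lbrace>c, a\<rbrace> + D c * \<lbrace>a, b\<rbrace>)"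
    using bracket_bracket[of a b c] bracket_anticomm[of "\<lbrace>a, b\<rbrace>" c] unfolding D_def by simp
  also have "\<dots> = angle a (angle b c) - (angle (angle a b) c + angle b (angle a c)
    + (D a * angle b c + D b * angle c a + D c * angle a b
    + (D a * angle b c + D b * angle c a + D c * angle a b)))"
    unfolding expand
    by (simp add: bracket_eq_angle angle_anticomm[of "D b" a] angle_anticomm[of "D c" a] angle_anticomm[of "D a" b]
      angle_anticomm[of "D c" b] angle_anticomm[of "D a" c] angle_anticomm[of "D b" c]
      angle_anticomm[of b a] angle_anticomm[of c a] angle_anticomm[of c b]
      angle_anticomm[of "angle a b" c] algebra_simps)
  finally show ?thesis
    unfolding two by (rule iffD1[OF right_minus_eq, OF HOL.sym])
qed

lemma triple_eq: "triple t1 t2 t3 = D t1 * t2 * t3"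
proof -
  have "\<lbrace>t1, t2 * t3\<rbrace> = \<lbrace>t1, t2\<rbrace> * t3 + t2 * \<lbrace>t1, t3\<rbrace> - D t1 * t2 * t3"
    unfolding D_def by (rule bracket_mult)
  then show ?thesis
    using bracket_anticomm[of _ t1] by (simp add: triple_def algebra_simps)
qed

lemma quad_eq: "quad u1 u2 w1 w2 = angle u1 u2 * w1 * w2"
proof -
  have perms: "{\<sigma>. \<sigma> permutes {1, 2::nat}} = {id, Transposition.transpose 1 2}"
    by (auto simp: permutes_doubleton_iff)
  have ne: "id \<noteq> Transposition.transpose 1 (2::nat)"
    by (metis id_apply numeral_One numeral_eq_iff semiring_norm(85) transpose_apply_first)
  have anti: "angle w u = - angle u w" for u w
    by (rule angle_anticomm)
  show ?thesis
    unfolding quad_def Let_def perms using ne by (simp add: sign_swap_id bracket_eq_angle D_mult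
       angle_mult_left angle_mult_right anti[of u2 u1] anti[of w1 u1] anti[of w1 u2] anti[of w2 u1]
       anti[of w2 u2] algebra_simps)
qed

end

global_interpretation free: jordan_bracket_algebra_char_0 free_scale free_bracket ..

context jordan_bracket_algebra
begin

lemma eval_D [simp]: "eval \<rho> (free.D f) = D (eval \<rho> f)"
  by (simp add: free.D_def D_def)

lemma eval_angle [simp]: "eval \<rho> (free.angle f g) = angle (eval \<rho> f) (eval \<rho> g)"
  by (simp add: free.angle_def angle_def)

lemma eval_sum [simp]: "eval \<rho> (sum f S) = (\<Sum>x\<in>S. eval \<rho> (f x))"
  by (induction S rule: infinite_finite_induct) simp_all

lemma eval_prod [simp]: "eval \<rho> (prod f S) = (\<Prod>x\<in>S. eval \<rho> (f x))"
  by (induction S rule: infinite_finite_induct) simp_all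

lemma eval_eval: "eval \<rho> (free.eval \<sigma> f) = eval (\<lambda>v. eval \<rho> (\<sigma> v)) f"
  by (rule eval_unique) simp_all

end

lemma eval_free_var [simp]: "free.eval free_var f = f"
  by (rule free.eval_unique[where h = "\<lambda>f. f", symmetric]) simp_all

lemma free_jb_induct [case_names var zero one add minus scale mult bracket]:
  assumes "\<And>v. P (free_var v)" "P 0" "P 1" "\<And>f g. P f \<Longrightarrow> P g \<Longrightarrow> P (f + g)"
    and "\<And>f. P f \<Longrightarrow> P (- f)" "\<And>r f. P f \<Longrightarrow> P (free_scale r f)"
    and "\<And>f g. P f \<Longrightarrow> P g \<Longrightarrow> P (f * g)" "\<And>f g. P f \<Longrightarrow> P g \<Longrightarrow> P (free_bracket f g)"
  shows "P f"
proof -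
  have "P (abs_free_jb t)" for t
    by (induction t) (simp_all add: assms free_var.abs_eq[symmetric]
        zero_free_jb.abs_eq[symmetric] one_free_jb.abs_eq[symmetric]
        plus_free_jb.abs_eq[symmetric] uminus_free_jb.abs_eq[symmetric]
        free_scale.abs_eq[symmetric] times_free_jb.abs_eq[symmetric]
        free_bracket.abs_eq[symmetric])
  then show ?thesis
    by (metis Quotient_abs_rep[OF Quotient_free_jb])
qed

section \<open>Weights and a model with one-dimensional weight spaces\<close>

lemma poly_mapping_single_induct [case_names single add]:
  fixes f :: "'a \<Rightarrow>\<^sub>0 'b::comm_monoid_add"
  assumes "\<And>k c. P (Poly_Mapping.single k c)" and "\<And>f g. P f \<Longrightarrow> P g \<Longrightarrow> P (f + g)"
  shows "P f"
proof -
  have "P (\<Sum>k\<in>A. Poly_Mapping.single k (Poly_Mapping.lookup f k))" if "finite A" for A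
    using that
  proof induction
    case empty
    show ?case using assms(1)[of undefined 0] by simp
  qed (simp add: assms)
  moreover have "f = (\<Sum>k\<in>Poly_Mapping.keys f. Poly_Mapping.single k (Poly_Mapping.lookup f k))"
    by (rule poly_mapping_eqI) (simp add: lookup_sum lookup_single when_def in_keys_iff)
  ultimately show ?thesis
    by (metis finite_keys)
qed

text \<open>Multidegree in the variables together with the number of brackets. This is the lattice
  of exponents: \<open>Poly_Mapping.single u 1\<close> is the exponential of \<open>u\<close>, and
  \<open>({#}, 1)\<close> is the weight \<open>e\<close>.\<close>

type_synonym 'v weight = "'v multiset \<times> nat"

text \<open>\<open>C v (Some w) - C w (Some v)\<close> is the value of the skew form on the weights of \<open>v\<close> and \<open>w\<close>,
  while \<open>C v None\<close> is its value on \<open>v\<close> and on the weight \<open>(0, 1)\<close> of one bracket.\<close>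

definition skew :: "('v \<Rightarrow> 'v option \<Rightarrow> 'k) \<Rightarrow> 'v \<Rightarrow> 'v \<Rightarrow> 'k::ab_group_add" where
  "skew C v w = C v (Some w) - C w (Some v)"

definition tau :: "('v \<Rightarrow> 'v option \<Rightarrow> 'k) \<Rightarrow> 'v multiset \<Rightarrow> 'k::comm_ring_1" where
  "tau C M = (\<Sum>v\<in>#M. C v None)"

text \<open>The skew bilinear extension from the variables and \<open>e\<close> to all weights;
  \<open>tau C M\<close> is its value on \<open>(M, 0)\<close> and \<open>e\<close>.\<close>

definition form :: "('v \<Rightarrow> 'v option \<Rightarrow> 'k) \<Rightarrow> 'v weight \<Rightarrow> 'v weight \<Rightarrow> 'k::comm_ring_1" where
  "form C a b = (\<Sum>v\<in>#fst a. \<Sum>w\<in>#fst b. skew C v w)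
     + of_nat (snd b) * tau C (fst a) - of_nat (snd a) * tau C (fst b)"

text \<open>The coefficient in the bracket of two exponentials: \<open>2 * form C a b\<close> is the
  part from \<open>angle\<close>, and the two values of \<open>tau\<close> stem from
  \<open>D a * b - a * D b\<close>.\<close>

definition theta :: "('v \<Rightarrow> 'v option \<Rightarrow> 'k) \<Rightarrow> 'v weight \<Rightarrow> 'v weight \<Rightarrow> 'k::comm_ring_1" where
  "theta C a b = 2 * form C a b + tau C (fst a) - tau C (fst b)"

lemma skew_anticomm: "skew C v w = - skew C w v"
  by (simp add: skew_def)

lemma skew_same [simp]: "skew C v v = 0"
  by (simp add: skew_def)

lemma tau_simps [simp]:
  "tau C {#} = 0" "tau C (add_mset v M) = C v None + tau C M" "tau C (M + N) = tau C M + tau C N"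
  by (simp_all add: tau_def)

lemma form_add_left: "form C (a + b) c = form C a c + form C b c"
  by (simp add: form_def algebra_simps)

lemma form_anticomm: "form C a b = - form C b a"
proof -
  have "(\<Sum>v\<in>#M. \<Sum>w\<in>#N. skew C v w) = - (\<Sum>w\<in>#N. \<Sum>v\<in>#M. skew C w v)" for M N
  proof (induction M)
    case (add x M)
    have "(\<Sum>w\<in>#N. skew C w x) = - (\<Sum>w\<in>#N. skew C x w)"
      by (induction N) (simp_all add: skew_def)
    then show ?case using add by (simp add: sum_mset.distrib)
  qed simp
  from this[of "fst a" "fst b"] show ?thesis
    by (simp add: form_def)
qed

lemma form_add_right: "form C c (a + b) = form C c a + form C c b"
  by (metis form_add_left form_anticomm minus_add_distrib)

lemma form_zero [simp]: "form C a ({#}, k) = of_nat k * tau C (fst a)"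
  by (simp add: form_def)

section \<open>The algebra spanned by exponentials\<close>

definition model_bracket ::
  "('v \<Rightarrow> 'v option \<Rightarrow> 'k) \<Rightarrow> ('v weight \<Rightarrow>\<^sub>0 'k) \<Rightarrow> ('v weight \<Rightarrow>\<^sub>0 'k) \<Rightarrow> ('v weight \<Rightarrow>\<^sub>0 'k::comm_ring_1)"
where
  "model_bracket C f g = (\<Sum>a\<in>Poly_Mapping.keys f. \<Sum>b\<in>Poly_Mapping.keys g.
     Poly_Mapping.single (a + b + ({#}, 1)) (theta C a b * (Poly_Mapping.lookup f a * Poly_Mapping.lookup g b)))"

abbreviation model_scale :: "'k \<Rightarrow> ('v weight \<Rightarrow>\<^sub>0 'k) \<Rightarrow> ('v weight \<Rightarrow>\<^sub>0 'k::comm_ring_1)" where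
  "model_scale c f \<equiv> Poly_Mapping.single 0 c * f"

lemma model_bracket_single:
  "model_bracket C (Poly_Mapping.single a r) (Poly_Mapping.single b s)
     = Poly_Mapping.single (a + b + ({#}, 1)) (theta C a b * (r * s))"
  by (simp add: model_bracket_def)

lemma model_bracket_add_left: "model_bracket C (f + g) h = model_bracket C f h + model_bracket C g h"
  unfolding model_bracket_def
  by (rule setsum_keys_plus_distrib) (simp_all add: algebra_simps single_add sum.distrib)

lemma model_bracket_add_right: "model_bracket C h (f + g) = model_bracket C h f + model_bracket C h g"
  unfolding model_bracket_def sum.distrib[symmetric]
  by (rule sum.cong[OF HOL.refl], rule setsum_keys_plus_distrib)
    (simp_all add: algebra_simps single_add sum.distrib)

lemma theta_add_right: "theta C a (b + c) = theta C a b + theta C a c - tau C (fst a)"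
  by (simp add: theta_def form_add_right algebra_simps)

lemma theta_anticomm: "theta C b a = - theta C a b"
  using form_anticomm[of C b a] by (simp add: theta_def)

lemma theta_one [simp]: "theta C a 0 = tau C (fst a)"
  by (simp add: theta_def zero_prod_def)

text \<open>This is the last axiom on three exponentials. All its terms lie in the weight
  \<open>a + b + c + e + e\<close>, so only coefficients remain to be compared, by bilinearity and
  skewness of the form.\<close>

lemma theta_jacobi:
  fixes C :: "'v \<Rightarrow> 'v option \<Rightarrow> 'k::comm_ring_1" and a b c :: "'v weight"
  defines "e \<equiv> ({#}, 1)"
  shows "theta C b c * theta C a (b + c + e) = theta C a b * theta C (a + b + e) c
     + theta C a c * theta C b (a + c + e) + tau C (fst a) * theta C b c
     + tau C (fst b) * theta C c a + tau C (fst c) * theta C a b"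
proof -
  have "form C e x = - tau C (fst x)" for x :: "'v weight"
    using form_anticomm[of C e x] by (simp add: e_def)
  then show ?thesis
    by (simp add: theta_def form_add_left form_add_right form_anticomm[of C c a]
        form_anticomm[of C b a] form_anticomm[of C c b] e_def algebra_simps)
qed

text \<open>Each axiom is additive in every argument, so it is enough to check it on multiples of
  exponentials.\<close>

lemma model_jordan_bracket_algebra:
  "jordan_bracket_algebra model_scale (model_bracket (C :: 'v \<Rightarrow> 'v option \<Rightarrow> 'k::field))"
proof
  fix r s :: 'k and f g h :: "'v weight \<Rightarrow>\<^sub>0 'k"
  show "model_scale r (f + g) = model_scale r f + model_scale r g"
    by (simp add: algebra_simps)
  show "model_scale (r + s) f = model_scale r f + model_scale s f"
    by (simp add: algebra_simps single_add)
  show "model_scale r (model_scale s f) = model_scale (r * s) f"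
    by (simp add: mult.assoc[symmetric] mult_single)
  show "model_scale 1 f = f"
    by simp
  show "model_scale r f * g = model_scale r (f * g)"
    by (simp add: mult.assoc)
  show "model_bracket C (f + g) h = model_bracket C f h + model_bracket C g h"
    by (rule model_bracket_add_left)
  show "model_bracket C (model_scale r f) g = model_scale r (model_bracket C f g)"
  proof (induction f rule: poly_mapping_single_induct)
    case (single k c)
    show ?case
      by (induction g rule: poly_mapping_single_induct)
        (simp_all add: mult_single model_bracket_single model_bracket_add_right distrib_left ac_simps)
  qed (simp add: model_bracket_add_left distrib_left)
  show "model_bracket C f g = - model_bracket C g f"
  proof (induction f rule: poly_mapping_single_induct)
    case (single k c)
    show ?case
      by (induction g rule: poly_mapping_single_induct)
        (simp_all add: model_bracket_single model_bracket_add_left model_bracket_add_right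
          theta_anticomm[of C k] single_uminus ac_simps)
  qed (simp add: model_bracket_add_left model_bracket_add_right)
  have one: "1 = Poly_Mapping.single 0 (1::'k)"
    by simp
  show "model_bracket C f (g * h)
      = model_bracket C f g * h + g * model_bracket C f h - model_bracket C f 1 * g * h"
  proof (induction f rule: poly_mapping_single_induct)
    case f: (single k c)
    show ?case
    proof (induction g rule: poly_mapping_single_induct)
      case g: (single l d)
      show ?case
      proof (induction h rule: poly_mapping_single_induct)
        case (single m e)
        have "k + (l + m) + ({#}, 1) = k + l + ({#}, 1) + m"
          "l + (k + m + ({#}, 1)) = k + l + ({#}, 1) + m"
          "k + 0 + ({#}, 1) + l + m = k + l + ({#}, 1) + m"
          by (simp_all add: ac_simps)
        then show ?case
          unfolding one model_bracket_single mult_single theta_add_right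
          by (simp add: single_add[symmetric] single_diff[symmetric] algebra_simps)
      qed (simp add: model_bracket_add_right algebra_simps)
    qed (simp add: model_bracket_add_right algebra_simps)
  qed (simp add: model_bracket_add_left algebra_simps)
  show "model_bracket C f (model_bracket C g h)
      = model_bracket C (model_bracket C f g) h + model_bracket C g (model_bracket C f h)
        + model_bracket C f 1 * model_bracket C g h + model_bracket C g 1 * model_bracket C h f
        + model_bracket C h 1 * model_bracket C f g"
  proof (induction f rule: poly_mapping_single_induct)
    case f: (single k c)
    show ?case
    proof (induction g rule: poly_mapping_single_induct)
      case g: (single l d)
      show ?case
      proof (induction h rule: poly_mapping_single_induct)
        case (single m e)
        let ?x = "({#}, 1) :: 'v weight"
        let ?w = "k + l + m + ?x + ?x"
        have w: "k + (l + m + ?x) + ?x = ?w" "k + l + ?x + m + ?x = ?w" "l + (k + m + ?x) + ?x = ?w"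
          "k + 0 + ?x + (l + m + ?x) = ?w" "l + 0 + ?x + (m + k + ?x) = ?w"
          "m + 0 + ?x + (k + l + ?x) = ?w"
          by (simp_all only: ac_simps add_0_left add_0_right)
        show ?case
          unfolding one model_bracket_single mult_single w single_add[symmetric]
          by (rule arg_cong[where f = "Poly_Mapping.single ?w"])
            (use theta_jacobi[of C l m k] in \<open>simp add: algebra_simps\<close>)
      qed (simp add: model_bracket_add_left model_bracket_add_right algebra_simps)
    qed (simp add: model_bracket_add_left model_bracket_add_right algebra_simps)
  qed (simp add: model_bracket_add_left model_bracket_add_right algebra_simps)
qed

global_interpretation model: jordan_bracket_algebra_char_0 model_scale "model_bracket C"
  for C :: "'v \<Rightarrow> 'v option \<Rightarrow> 'k::field_char_0"
  by (simp add: jordan_bracket_algebra_char_0_def model_jordan_bracket_algebra)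

section \<open>Homogeneous elements\<close>

text \<open>\<open>homog M K f\<close>: the element \<open>f\<close> is homogeneous of multidegree \<open>M\<close> in the variables and of degree
  \<open>K\<close> in the bracket.\<close>

inductive homog :: "'v multiset \<Rightarrow> nat \<Rightarrow> ('k::field_char_0, 'v) free_jb \<Rightarrow> bool" where
  one: "homog {#} 0 1"
| var: "homog {#v#} 0 (free_var v)"
| zero: "homog M K 0"
| add: "homog M K f \<Longrightarrow> homog M K g \<Longrightarrow> homog M K (f + g)"
| scale: "homog M K f \<Longrightarrow> homog M K (free_scale r f)"
| mult: "homog M K f \<Longrightarrow> homog N L g \<Longrightarrow> homog (M + N) (K + L) (f * g)"
| D: "homog M K f \<Longrightarrow> homog M (Suc K) (free.D f)"
| angle: "homog M K f \<Longrightarrow> homog N L g \<Longrightarrow> homog (M + N) (Suc (K + L)) (free.angle f g)"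

lemma free_scale_minus_one: "free_scale (- 1) f = - f"
  by (metis free.scale_minus_left free.scale_one)

lemma homog_minus: "homog M K f \<Longrightarrow> homog M K (- f)"
  by (metis free_scale_minus_one homog.scale)

lemma homog_diff: "homog M K f \<Longrightarrow> homog M K g \<Longrightarrow> homog M K (f - g)"
  using homog.add homog_minus by fastforce

lemma homog_sum: "(\<And>i. i \<in> A \<Longrightarrow> homog M K (f i)) \<Longrightarrow> homog M K (sum f A)"
  by (induction A rule: infinite_finite_induct) (auto intro: homog.zero homog.add)

lemma homog_var_mult: "homog M K f \<Longrightarrow> homog (add_mset v M) K (free_var v * f)"
  using homog.mult[OF homog.var] by fastforce

text \<open>Without variables, every \<open>D\<close> and every \<open>angle\<close> is applied to
  multiples of 1, and both annihilate these.\<close>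

lemma homog_empty_const:
  assumes "homog {#} K f"
  obtains c where "f = free_scale c 1"
proof -
  have "\<exists>c. f = free_scale c 1" if "homog M K f" "M = {#}" for M
    using that
  proof (induction rule: homog.induct)
    case one
    show ?case by (metis free.scale_one)
  next
    case zero
    show ?case by (metis free.scale_zero_left)
  next
    case add
    then show ?case by (metis free.scale_left_distrib)
  next
    case scale
    then show ?case by (metis free.scale_scale)
  next
    case (mult M K f N L g)
    then obtain c d where "f = free_scale c 1" "g = free_scale d 1"
      by auto
    then have "f * g = free_scale (c * d) 1"
      by (simp add: free.scale_mult_left)
    then show ?case by blast
  next
    case (D M K f)
    then show ?case by (metis free.D_one free.D_scale free.scale_zero_left free.scale_zero_right)
  next
    case (angle M K f N L g)
    then obtain d where "g = free_scale d 1"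
      by auto
    then have "free.angle f g = free_scale 0 1"
      by (simp add: free.angle_scale_right)
    then show ?case by blast
  qed simp
  then show ?thesis
    using assms that by blast
qed

section \<open>The coefficient of a homogeneous element\<close>

definition model_value :: "('v \<Rightarrow> 'v option \<Rightarrow> 'k) \<Rightarrow> ('k::field_char_0, 'v) free_jb \<Rightarrow> 'v weight \<Rightarrow>\<^sub>0 'k" where
  "model_value C = model.eval C (\<lambda>v. Poly_Mapping.single ({#v#}, 0) 1)"

lemma model_value_simps [simp]:
  "model_value C (free_var v) = Poly_Mapping.single ({#v#}, 0) 1"
  "model_value C 0 = 0" "model_value C 1 = 1"
  "model_value C (f + g) = model_value C f + model_value C g"
  "model_value C (free_scale r f) = model_scale r (model_value C f)"
  "model_value C (f * g) = model_value C f * model_value C g"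
  "model_value C (free.D f) = model.D C (model_value C f)"
  "model_value C (free.angle f g) = model.angle C (model_value C f) (model_value C g)"
  "model_value C (sum F A) = (\<Sum>i\<in>A. model_value C (F i))"
  by (simp_all add: model_value_def)

text \<open>Meant for homogeneous \<open>f\<close>, whose value in the model is supported in at most
  one weight; summing over the keys avoids naming that weight.\<close>

definition coef :: "('v \<Rightarrow> 'v option \<Rightarrow> 'k) \<Rightarrow> ('k::field_char_0, 'v) free_jb \<Rightarrow> 'k" where
  "coef C f = (\<Sum>a\<in>Poly_Mapping.keys (model_value C f). Poly_Mapping.lookup (model_value C f) a)"

lemma model_D_single:
  "model.D C (Poly_Mapping.single a r) = Poly_Mapping.single (a + ({#}, 1)) (tau C (fst a) * r)"
proof -
  have "model.D C (Poly_Mapping.single a r)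
      = model_bracket C (Poly_Mapping.single a r) (Poly_Mapping.single 0 1)"
    by (simp add: model.D_def)
  then show ?thesis
    unfolding model_bracket_single by simp
qed

lemma model_angle_single:
  "model.angle C (Poly_Mapping.single a r) (Poly_Mapping.single b s)
     = Poly_Mapping.single (a + b + ({#}, 1)) (2 * form C a b * (r * s))"
proof -
  have "b + ({#}, 1) = ({#}, 1) + b" "a + (({#}, 1) + b) = a + b + ({#}, 1)"
    by (simp_all add: ac_simps)
  then show ?thesis
    unfolding model.angle_def model_bracket_single model_D_single mult_single
    by (simp add: single_diff[symmetric] theta_def algebra_simps)
qed

lemma coef_single: "model_value C f = Poly_Mapping.single a c \<Longrightarrow> coef C f = c"
  by (simp add: coef_def)

lemma model_value_homog:
  assumes "homog M K f"
  shows "model_value C f = Poly_Mapping.single (M, K) (coef C f)"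
proof -
  have "\<exists>c. model_value C f = Poly_Mapping.single (M, K) c"
    using assms
  proof (induction rule: homog.induct)
    case one
    show ?case
      by (rule exI[of _ 1]) (simp add: zero_prod_def[symmetric])
  next
    case (zero M K)
    show ?case by (rule exI[of _ 0]) simp
  next
    case (add M K f g)
    then show ?case by (auto simp: single_add[symmetric])
  next
    case (scale M K f r)
    then show ?case by (auto simp: mult_single)
  next
    case (mult M K f N L g)
    then show ?case by (auto simp: mult_single)
  next
    case (D M K f)
    then show ?case by (auto simp: model_D_single)
  next
    case (angle M K f N L g)
    then show ?case by (auto simp: model_angle_single)
  qed auto
  then show ?thesis
    using coef_single by metis
qed

lemma coef_zero [simp]: "coef C 0 = 0"
  by (rule coef_single[of _ _ undefined]) simp

lemma coef_one [simp]: "coef C 1 = 1"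
  by (rule coef_single[of _ _ 0]) simp

lemma coef_var [simp]: "coef C (free_var v) = 1"
  by (rule coef_single) simp

lemma coef_scale: "homog M K f \<Longrightarrow> coef C (free_scale r f) = r * coef C f"
  by (rule coef_single)
    (simp add: model_value_homog mult_single)

lemma coef_add: "homog M K f \<Longrightarrow> homog M K g \<Longrightarrow> coef C (f + g) = coef C f + coef C g"
  by (rule coef_single)
    (simp add: model_value_homog single_add[symmetric])

lemma coef_minus: "homog M K f \<Longrightarrow> coef C (- f) = - coef C f"
  using coef_scale[of M K f C "- 1"] by (simp add: free_scale_minus_one)

lemma coef_diff: "homog M K f \<Longrightarrow> homog M K g \<Longrightarrow> coef C (f - g) = coef C f - coef C g"
  using coef_add[of M K f "- g" C] by (simp add: coef_minus homog_minus)

lemma coef_sum: "(\<And>i. i \<in> A \<Longrightarrow> homog M K (f i)) \<Longrightarrow> coef C (sum f A) = (\<Sum>i\<in>A. coef C (f i))"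
proof (induction A rule: infinite_finite_induct)
  case (insert x A)
  then show ?case
    using coef_add[of M K "f x" "sum f A" C] homog_sum[of A M K f] by simp
qed simp_all

lemma coef_mult: "homog M K f \<Longrightarrow> homog N L g \<Longrightarrow> coef C (f * g) = coef C f * coef C g"
  by (rule coef_single)
    (simp add: model_value_homog mult_single)

lemma coef_D: "homog M K f \<Longrightarrow> coef C (free.D f) = tau C M * coef C f"
  by (rule coef_single)
    (simp add: model_value_homog model_D_single)

lemma coef_angle:
  "homog M K f \<Longrightarrow> homog N L g \<Longrightarrow>
   coef C (free.angle f g) = 2 * form C (M, K) (N, L) * (coef C f * coef C g)"
  by (rule coef_single)
    (simp add: model_value_homog model_angle_single)

text \<open>Components with different numbers of brackets land in different weights of the model, so
  they cannot cancel.\<close>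

lemma sum_homog_nonzero:
  assumes "\<And>K. homog M K (fs K)" "K0 \<le> N" "coef C (fs K0) \<noteq> 0"
  shows "(\<Sum>K\<le>N. fs K) \<noteq> 0"
proof
  assume "(\<Sum>K\<le>N. fs K) = 0"
  then have "model_value C (\<Sum>K\<le>N. fs K) = 0"
    by simp
  then have "(\<Sum>K\<le>N. Poly_Mapping.single (M, K) (coef C (fs K))) = 0"
    by (simp add: model_value_homog[OF assms(1)])
  then have "Poly_Mapping.lookup (\<Sum>K\<le>N. Poly_Mapping.single (M, K) (coef C (fs K))) (M, K0) = 0"
    by simp
  then show False
    using assms(2,3) by (simp add: lookup_sum lookup_single when_def)
qed

text \<open>Only the skew form on the variables of \<open>M\<close> and its values against
  \<open>e\<close> enter the coefficient. Diagonal entries drop out because \<open>skew\<close>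
  vanishes there, and this freedom is used whenever forms are prescribed row by row.\<close>

lemma coef_cong:
  assumes "homog M K f" "\<And>v w. v \<in># M \<Longrightarrow> w \<in># M \<Longrightarrow> v \<noteq> w \<Longrightarrow> skew C v w = skew C' v w"
    and "\<And>v. v \<in># M \<Longrightarrow> C v None = C' v None"
  shows "coef C f = coef C' f"
  using assms
proof (induction rule: homog.induct)
  case (add M K f g)
  then show ?case by (simp add: coef_add[of M K])
next
  case (scale M K f r)
  then show ?case by (simp add: coef_scale[of M K])
next
  case (mult M K f N L g)
  then show ?case by (simp add: coef_mult[of M K _ N L])
next
  case (D M K f)
  moreover have "tau C M = tau C' M"
    using D.prems by (simp add: tau_def cong: image_mset_cong)
  ultimately show ?case by (simp add: coef_D[of M K])
next
  case (angle M K f N L g)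
  have "tau C M = tau C' M" "tau C N = tau C' N"
    unfolding tau_def using angle.prems by (auto intro!: arg_cong[where f = sum_mset] image_mset_cong)
  moreover have "skew C v w = skew C' v w" if "v \<in># M" "w \<in># N" for v w
    using angle.prems(1)[of v w] that by (cases "v = w") auto
  then have "(\<Sum>v\<in>#M. \<Sum>w\<in>#N. skew C v w) = (\<Sum>v\<in>#M. \<Sum>w\<in>#N. skew C' v w)"
    by (auto intro!: arg_cong[where f = sum_mset] image_mset_cong)
  ultimately have "form C (M, K) (N, L) = form C' (M, K) (N, L)"
    by (simp add: form_def)
  then show ?case using angle by (simp add: coef_angle[of M K _ N L])
qed simp_all


section \<open>Substitution for one variable\<close>

definition sub :: "'v \<Rightarrow> ('k::field_char_0, 'v) free_jb \<Rightarrow> ('k, 'v) free_jb \<Rightarrow> ('k, 'v) free_jb" where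
  "sub x h = free.eval (free_var(x := h))"

lemma sub_simps [simp]:
  "sub x h (free_var v) = (if v = x then h else free_var v)"
  "sub x h 0 = 0" "sub x h 1 = 1" "sub x h (f + g) = sub x h f + sub x h g"
  "sub x h (- f) = - sub x h f" "sub x h (f - g) = sub x h f - sub x h g"
  "sub x h (free_scale r f) = free_scale r (sub x h f)" "sub x h (f * g) = sub x h f * sub x h g"
  "sub x h (free.D f) = free.D (sub x h f)"
  "sub x h (free.angle f g) = free.angle (sub x h f) (sub x h g)"
  "sub x h (sum F A) = (\<Sum>i\<in>A. sub x h (F i))"
  by (simp_all add: sub_def)

lemma sub_id: "homog M K f \<Longrightarrow> x \<notin># M \<Longrightarrow> sub x h f = f"
  by (induction rule: homog.induct) auto

text \<open>The weight of \<open>sub x h f\<close>, for \<open>f\<close> of weight \<open>a\<close> and \<open>h\<close> of weight \<open>b\<close>.\<close>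

definition sub_weight :: "'v \<Rightarrow> 'v weight \<Rightarrow> 'v weight \<Rightarrow> 'v weight" where
  "sub_weight x b a =
     (filter_mset (\<lambda>v. v \<noteq> x) (fst a) + repeat_mset (count (fst a) x) (fst b),
      snd a + count (fst a) x * snd b)"

lemma sub_weight_add: "sub_weight x b (a + c) = sub_weight x b a + sub_weight x b c"
  by (simp add: sub_weight_def algebra_simps repeat_mset_distrib)

lemma sub_weight_snd: "sub_weight x b (M, K + L) = sub_weight x b (M, K) + ({#}, L)"
  by (simp add: sub_weight_def)

lemma homog_sub:
  assumes "homog M K f" "homog W k h"
  shows "homog (fst (sub_weight x (W, k) (M, K))) (snd (sub_weight x (W, k) (M, K))) (sub x h f)"
  using assms(1)
proof (induction rule: homog.induct)
  case (mult M K f N L g)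
  have "sub_weight x (W, k) (M + N, K + L) = sub_weight x (W, k) (M, K) + sub_weight x (W, k) (N, L)"
    by (simp add: sub_weight_add[symmetric])
  then show ?case using homog.mult[OF mult.IH] by simp
next
  case (angle M K f N L g)
  have "sub_weight x (W, k) (M + N, Suc (K + L))
      = sub_weight x (W, k) (M, K) + sub_weight x (W, k) (N, L) + ({#}, 1)"
    by (simp add: sub_weight_add[symmetric] sub_weight_snd[symmetric])
  then show ?case using homog.angle[OF angle.IH] by simp
next
  case (D M K f)
  have "sub_weight x (W, k) (M, Suc K) = sub_weight x (W, k) (M, K) + ({#}, 1)"
    by (simp add: sub_weight_snd[symmetric])
  then show ?case using homog.D[OF D.IH] by simp
next
  case (var v)
  then show ?case using assms(2) by (auto simp: sub_weight_def intro: homog.var)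
qed (auto simp: sub_weight_def intro: homog.intros)

text \<open>The pullback of the form along \<open>sub_weight x b\<close>.\<close>

definition pull :: "'v \<Rightarrow> 'v weight \<Rightarrow> ('v \<Rightarrow> 'v option \<Rightarrow> 'k) \<Rightarrow> 'v \<Rightarrow> 'v option \<Rightarrow> 'k::comm_ring_1" where
  "pull x b C v w =
     (case w of None \<Rightarrow> tau C (if v = x then fst b else {#v#})
      | Some w \<Rightarrow> if v = x then if w = x then 0 else form C b ({#w#}, 0)
                 else if w = x then 0 else C v (Some w))"

text \<open>\<open>pull\<close> stores the values against \<open>x\<close> in row \<open>x\<close>
  alone and leaves column \<open>x\<close> zero, which is enough since \<open>skew\<close>
  antisymmetrizes. The diagonal case amounts to \<open>form C b b = 0\<close>, obtained by
  cancelling 2.\<close>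

lemma skew_pull:
  fixes C :: "'v \<Rightarrow> 'v option \<Rightarrow> 'k::field_char_0"
  shows "skew (pull x b C) v w = form C (sub_weight x b ({#v#}, 0)) (sub_weight x b ({#w#}, 0))"
proof -
  have "2 * form C b b = 0"
    unfolding mult_2 using form_anticomm[of C b b] by (simp add: eq_neg_iff_add_eq_0)
  then show ?thesis
    using form_anticomm[of C b "({#v#}, 0)"]
    by (auto simp: skew_def pull_def sub_weight_def form_def)
qed

lemma tau_pull: "tau (pull x b C) M = tau C (fst (sub_weight x b (M, K)))"
proof (induction M)
  case (add v M)
  then show ?case by (auto simp: sub_weight_def pull_def algebra_simps)
qed (simp add: sub_weight_def)

lemma form_pull:
  fixes C :: "'v \<Rightarrow> 'v option \<Rightarrow> 'k::field_char_0"
  shows "form (pull x b C) a c = form C (sub_weight x b a) (sub_weight x b c)"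
proof -
  have one: "sub_weight x b ({#}, K) = ({#}, K)" for K
    by (simp add: sub_weight_def)
  have vars: "form (pull x b C) (M, 0) (N, 0) = form C (sub_weight x b (M, 0)) (sub_weight x b (N, 0))"
    for M N
  proof (induction M)
    case (add v M)
    have "form (pull x b C) ({#v#}, 0) (N, 0)
        = form C (sub_weight x b ({#v#}, 0)) (sub_weight x b (N, 0))"
    proof (induction N)
      case (add w N)
      then show ?case
        using form_add_right[of "pull x b C" "({#v#}, 0)" "({#w#}, 0)" "(N, 0)"]
          sub_weight_add[of x b "({#w#}, 0)" "(N, 0)"]
        by (simp add: form_add_right form_def[of "pull x b C" _ "({#w#}, 0)"] skew_pull)
    qed (simp add: one)
    then show ?case
      using add form_add_left[of "pull x b C" "({#v#}, 0)" "(M, 0)" "(N, 0)"]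
        sub_weight_add[of x b "({#v#}, 0)" "(M, 0)"]
      by (simp add: form_add_left)
  qed (simp add: one form_def)
  obtain M K N L where ac: "a = (M, 0) + ({#}, K)" "c = (N, 0) + ({#}, L)"
    by (metis add.left_neutral add.right_neutral add_Pair prod.collapse)
  have anti: "form C' ({#}, K) b = - of_nat K * tau C' (fst b)" for b K and C' :: "'v \<Rightarrow> 'v option \<Rightarrow> 'k"
    using form_anticomm[of C' "({#}, K)" b] by simp
  show ?thesis
    unfolding ac sub_weight_add one form_add_left form_add_right vars form_zero anti
    by (simp add: tau_pull[of x b C _ 0])
qed

text \<open>In the model \<open>h\<close> is a multiple of one exponential. Substituting it for
  \<open>x\<close> contributes one factor \<open>coef C h\<close> for each occurrence of
  \<open>x\<close> and moves the weight of \<open>x\<close> to that of \<open>h\<close>, that is,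
  pulls the form back.\<close>

lemma coef_sub:
  assumes "homog M K f" "homog W k h"
  shows "coef C (sub x h f) = coef C h ^ count M x * coef (pull x (W, k) C) f"
  using assms(1)
proof (induction rule: homog.induct)
  case (add M K f g)
  then show ?case
    using coef_add[OF homog_sub[OF add(1) assms(2), of x] homog_sub[OF add(2) assms(2), of x], of C]
      coef_add[OF add(1,2)] by (simp add: algebra_simps)
next
  case (scale M K f r)
  then show ?case
    using coef_scale[OF homog_sub[OF scale(1) assms(2), of x], of C] coef_scale[OF scale(1)] by simp
next
  case (mult M K f N L g)
  then show ?case
    using coef_mult[OF homog_sub[OF mult(1) assms(2), of x] homog_sub[OF mult(2) assms(2), of x], of C]
      coef_mult[OF mult(1,2)] by (simp add: power_add)
next
  case (D M K f)
  then show ?case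
    using coef_D[OF homog_sub[OF D(1) assms(2), of x], of C] coef_D[OF D(1)]
    by (simp add: tau_pull[of x _ C M K])
next
  case (angle M K f N L g)
  then show ?case
    using coef_angle[OF homog_sub[OF angle(1) assms(2), of x] homog_sub[OF angle(2) assms(2), of x], of C]
      coef_angle[OF angle(1,2)] by (simp add: form_pull power_add)
qed auto

section \<open>Elements that are linear in a variable\<close>

lemma homog_sub_linear:
  assumes "homog M K f" "count M x = 1" "homog W k h"
  shows "homog (M - {#x#} + W) (K + k) (sub x h f)"
proof -
  have "filter_mset (\<lambda>v. v \<noteq> x) M = M - {#x#}"
    using assms(2) by (auto intro!: multiset_eqI)
  then show ?thesis
    using homog_sub[OF assms(1,3), of x] assms(2) by (simp add: sub_weight_def)
qed

lemma coef_sub_linear: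
  assumes "homog M K f" "count M x = 1" "homog W k h"
  shows "coef C (sub x h f) = coef C h * coef (pull x (W, k) C) f"
  using coef_sub[OF assms(1,3), of C x] assms(2) by simp

text \<open>In the rules \<open>D\<close> and \<open>angle\<close> the variable \<open>x\<close> is
  a placeholder for the substituted element. As \<open>f\<close> is linear in the placeholder, an
  operation on the result can be carried out on \<open>f\<close> before the substitution, which
  gives the closure properties below.\<close>

inductive strip :: "'v \<Rightarrow> 'v multiset \<Rightarrow> nat \<Rightarrow> ('k::field_char_0, 'v) free_jb \<Rightarrow> bool" for x where
  base: "homog M K r \<Longrightarrow> x \<notin># M \<Longrightarrow> strip x (add_mset x M) K (free_var x * r)"
| D: "homog M K f \<Longrightarrow> count M x = 1 \<Longrightarrow> strip x M (Suc K) (sub x (free.D (free_var x)) f)"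
| angle: "homog M K f \<Longrightarrow> count M x = 1 \<Longrightarrow> a \<noteq> x \<Longrightarrow>
    strip x (add_mset a M) (Suc K) (sub x (free.angle (free_var x) (free_var a)) f)"
| add: "strip x M K f \<Longrightarrow> strip x M K g \<Longrightarrow> strip x M K (f + g)"

lemma strip_count: "strip x M K f \<Longrightarrow> count M x = 1"
  by (induction rule: strip.induct) (auto simp: not_in_iff)

lemma strip_zero:
  assumes "count M x = 1"
  shows "strip x M K 0"
proof -
  have "x \<in># M" "x \<notin># M - {#x#}"
    using assms by (auto simp: not_in_iff simp flip: count_greater_zero_iff)
  then show ?thesis
    using strip.base[OF homog.zero[of "M - {#x#}" K], of x] by simp
qed

lemma strip_scale: "strip x M K f \<Longrightarrow> strip x M K (free_scale r f)"
proof (induction rule: strip.induct)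
  case (base M K s)
  then show ?case
    using strip.base[OF homog.scale[OF base(1), of r]] by (simp add: free.scale_mult_right)
next
  case (D M K f)
  then show ?case using strip.D[OF homog.scale[OF D(1), of r]] by simp
next
  case (angle M K f a)
  then show ?case using strip.angle[OF homog.scale[OF angle(1), of r]] by simp
next
  case (add M K f g)
  then show ?case by (simp add: free.scale_right_distrib strip.add)
qed

lemma strip_minus: "strip x M K f \<Longrightarrow> strip x M K (- f)"
  by (metis free_scale_minus_one strip_scale)

lemma strip_mult:
  assumes "strip x M K f" "homog N L g" "x \<notin># N"
  shows "strip x (M + N) (K + L) (f * g)"
  using assms(1)
proof (induction rule: strip.induct)
  case (base M K r)
  then show ?case
    using strip.base[OF homog.mult[OF base(1) assms(2)], of x] assms(3) by (simp add: ac_simps)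
next
  case (D M K f)
  then show ?case
    using strip.D[OF homog.mult[OF D(1) assms(2)], of x] assms(2,3)
    by (simp add: sub_id not_in_iff)
next
  case (angle M K f a)
  then show ?case
    using strip.angle[OF homog.mult[OF angle(1) assms(2)], of x a] assms(2,3)
    by (simp add: sub_id not_in_iff)
next
  case (add M K f g)
  then show ?case by (simp add: distrib_right strip.add)
qed

lemma strip_D: "strip x M K f \<Longrightarrow> strip x M (Suc K) (free.D f)"
proof (induction rule: strip.induct)
  case (base M K r)
  \<comment> \<open>The product \<open>D x * r\<close> arises from \<open>x * r\<close> by
    substituting \<open>D x\<close> for \<open>x\<close>, as \<open>r\<close> does not contain
    \<open>x\<close>.\<close>
  have "strip x (add_mset x M) (Suc K) (free.D (free_var x) * r)"
    using strip.D[OF homog_var_mult[OF base(1)], of x x] base by (simp add: sub_id not_in_iff)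
  then show ?case
    using strip.base[OF homog.D[OF base(1)] base(2)] by (simp add: free.D_mult strip.add)
next
  case (D M K f)
  then show ?case using strip.D[OF homog.D[OF D(1)]] by simp
next
  case (angle M K f a)
  then show ?case using strip.angle[OF homog.D[OF angle(1)]] by simp
next
  case (add M K f g)
  then show ?case by (simp add: free.D_add strip.add)
qed

lemma strip_angle_var:
  assumes "strip x M K f" "b \<noteq> x"
  shows "strip x (add_mset b M) (Suc K) (free.angle f (free_var b))"
  using assms(1)
proof (induction rule: strip.induct)
  case (base M K r)
  have "strip x (add_mset b (add_mset x M)) (Suc K) (free.angle (free_var x) (free_var b) * r)"
    using strip.angle[OF homog_var_mult[OF base(1)], of x x b] base assms(2)
    by (simp add: sub_id not_in_iff)
  moreover have "strip x (add_mset x (add_mset b M)) (Suc K) (free_var x * free.angle r (free_var b))"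
    using strip.base[OF homog.angle[OF base(1) homog.var[of b]], of x] base(2) assms(2) by simp
  ultimately show ?case
    by (simp add: free.angle_mult_left strip.add add_mset_commute)
next
  case (D M K f)
  then show ?case
    using strip.D[OF homog.angle[OF D(1) homog.var[of b]], of x] assms(2) by simp
next
  case (angle M K f a)
  then show ?case
    using strip.angle[OF homog.angle[OF angle(1) homog.var[of b]], of x a] assms(2)
    by (simp add: add_mset_commute)
next
  case (add M K f g)
  then show ?case by (simp add: free.angle_add_left strip.add)
qed

text \<open>Induction on \<open>g\<close> for all \<open>f\<close> at once: \<open>D_angle\<close>
  moves a \<open>D\<close> from \<open>g\<close> over to \<open>f\<close>, and
  \<open>angle_angle\<close> trades \<open><f, <g, h>>\<close> for brackets with \<open>g\<close> or
  \<open>h\<close> alone, in which \<open><f, g>\<close> and \<open><f, h>\<close> take the place of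
  \<open>f\<close>. The process ends with \<open>g\<close> a variable.\<close>

lemma strip_angle:
  assumes "homog N L g" "x \<notin># N" "strip x M K f"
  shows "strip x (M + N) (Suc (K + L)) (free.angle f g)"
  using assms
proof (induction arbitrary: f M K rule: homog.induct)
  case one
  then show ?case using strip_zero[OF strip_count] by simp
next
  case (var v)
  then show ?case using strip_angle_var by force
next
  case (zero N L)
  then show ?case using strip_count[of x M K f] strip_zero[of "M + N" x] by (simp add: not_in_iff)
next
  case (add N L g h)
  then show ?case by (simp add: free.angle_add_right strip.add)
next
  case (scale N L g r)
  then show ?case by (simp add: free.angle_scale_right strip_scale)
next
  case (mult N L g N' L' h)
  then have "strip x (M + N + N') (Suc (K + L) + L') (free.angle f g * h)"
    "strip x (M + N' + N) (Suc (K + L') + L) (free.angle f h * g)"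
    using strip_mult[OF mult.IH(1) mult.hyps(2)] strip_mult[OF mult.IH(2) mult.hyps(1)] by auto
  then have "strip x (M + (N + N')) (Suc (K + (L + L'))) (free.angle f g * h + free.angle f h * g)"
    by (auto intro!: strip.add simp: ac_simps)
  then show ?case by (simp add: free.angle_mult_right mult.commute)
next
  case (D N L g)
  then have "strip x (M + N) (Suc (Suc (K + L))) (free.D (free.angle f g))"
    by (intro strip_D) auto
  moreover have "strip x (M + N) (Suc (Suc K + L)) (- free.angle (free.D f) g)"
    using D by (intro strip_minus D.IH strip_D) auto
  ultimately have "strip x (M + N) (Suc (K + Suc L)) (free.D (free.angle f g) + - free.angle (free.D f) g)"
    using strip.add by fastforce
  then show ?case by (simp add: free.D_angle)
next
  case (angle N L g N' L' h)
  let ?S = "strip x (M + (N + N')) (Suc (K + Suc (L + L')))"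
  have fg: "strip x (M + N) (Suc (K + L)) (free.angle f g)"
    and fh: "strip x (M + N') (Suc (K + L')) (free.angle f h)"
    using angle by auto
  have "?S (free.angle (free.angle f g) h)"
    using angle.IH(2)[OF _ fg] angle.prems by (simp add: ac_simps)
  moreover have "?S (- free.angle (free.angle f h) g)"
    using strip_minus[OF angle.IH(1)[OF _ fh]] angle.prems by (simp add: ac_simps)
  moreover have "?S (free.D f * free.angle g h)"
    using strip_mult[OF strip_D[OF angle.prems(2)] homog.angle[OF angle.hyps]] angle.prems(1) by simp
  moreover have "?S (- (free.angle f h * free.D g))"
    using strip_minus[OF strip_mult[OF fh homog.D[OF angle.hyps(1)]]] angle.prems(1)
    by (simp add: ac_simps)
  moreover have "?S (free.angle f g * free.D h)"
    using strip_mult[OF fg homog.D[OF angle.hyps(2)]] angle.prems(1) by (simp add: ac_simps)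
  ultimately have "?S (free.angle (free.angle f g) h + - free.angle (free.angle f h) g
     + free_scale 2 (free.D f * free.angle g h + - (free.angle f h * free.D g)
       + free.angle f g * free.D h))"
    by (intro strip.add strip_scale)
  moreover have "free.angle f (free.angle g h)
      = free.angle (free.angle f g) h + - free.angle (free.angle f h) g
     + free_scale 2 (free.D f * free.angle g h + - (free.angle f h * free.D g)
       + free.angle f g * free.D h)"
    unfolding free.angle_angle[of f g h] using free.angle_anticomm[of g "free.angle f h"]
      free.angle_anticomm[of h f] by (simp add: mult.commute)
  ultimately show ?case by simp
qed

lemma strip_homog:
  assumes "homog M K f" "count M x = 1"
  shows "strip x M K f"
  using assms
proof (induction rule: homog.induct)
  case (var v)
  then show ?case
    using strip.base[OF homog.one, of x] by (auto split: if_splits)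
next
  case (mult M K f N L g)
  then consider "count M x = 1" "x \<notin># N" | "count N x = 1" "x \<notin># M"
    by (auto simp: not_in_iff add_is_1)
  then show ?case
  proof cases
    case 1
    then show ?thesis using mult.IH(1) mult.hyps(2) by (simp add: strip_mult)
  next
    case 2
    then show ?thesis
      using strip_mult[OF mult.IH(2) mult.hyps(1)] by (simp add: ac_simps)
  qed
next
  case (angle M K f N L g)
  then consider "count M x = 1" "x \<notin># N" | "count N x = 1" "x \<notin># M"
    by (auto simp: not_in_iff add_is_1)
  then show ?case
  proof cases
    case 1
    then show ?thesis using angle.IH(1) angle.hyps(2) by (simp add: strip_angle)
  next
    case 2
    then have "strip x (N + M) (Suc (L + K)) (- free.angle g f)"
      using angle.IH(2) angle.hyps(1) by (intro strip_minus strip_angle)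
    then show ?thesis by (simp add: ac_simps free.angle_anticomm[of f g])
  qed
qed (auto intro: strip_zero strip_scale strip_D strip.add)

text \<open>\<open>fA a\<close> lacks one \<open>a\<close>, which the substituted
  \<open><x, a>\<close> brings back. Since \<open>K - 1\<close> is truncated, the vanishing of
  \<open>fD\<close> and \<open>fA\<close> in bracket degree 0 is recorded separately.\<close>

lemma linear_decomposition:
  assumes "homog M K f" "count M x = 1"
  obtains r fD fA where "f = free_var x * r + sub x (free.D (free_var x)) fD
      + (\<Sum>a\<in>set_mset M - {x}. sub x (free.angle (free_var x) (free_var a)) (fA a))"
    and "homog (M - {#x#}) K r" and "homog M (K - 1) fD"
    and "\<And>a. a \<in># M \<Longrightarrow> a \<noteq> x \<Longrightarrow> homog (M - {#a#}) (K - 1) (fA a)"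
    and "K = 0 \<Longrightarrow> fD = 0" and "\<And>a. K = 0 \<Longrightarrow> fA a = 0"
proof -
  have "strip x M K f"
    using assms by (rule strip_homog)
  then have "\<exists>r fD fA. f = free_var x * r + sub x (free.D (free_var x)) fD
      + (\<Sum>a\<in>set_mset M - {x}. sub x (free.angle (free_var x) (free_var a)) (fA a))
    \<and> homog (M - {#x#}) K r \<and> homog M (K - 1) fD
    \<and> (\<forall>a. a \<in># M \<longrightarrow> a \<noteq> x \<longrightarrow> homog (M - {#a#}) (K - 1) (fA a))
    \<and> (K = 0 \<longrightarrow> fD = 0 \<and> (\<forall>a. fA a = 0))"
  proof induction
    case (base M K r)
    then show ?case
      by (intro exI[of _ r] exI[of _ 0] exI[of _ "\<lambda>_. 0"]) (auto intro: homog.zero)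
  next
    case (D M K f)
    then show ?case
      by (intro exI[of _ 0] exI[of _ f] exI[of _ "\<lambda>_. 0"]) (auto intro: homog.zero)
  next
    case (angle M K f a)
    have "(\<Sum>b\<in>insert a (set_mset M) - {x}. sub x (free.angle (free_var x) (free_var b)) (if b = a then f else 0))
        = (\<Sum>b\<in>insert a (set_mset M) - {x}. if b = a then sub x (free.angle (free_var x) (free_var a)) f else 0)"
      by (rule sum.cong) auto
    also have "\<dots> = sub x (free.angle (free_var x) (free_var a)) f"
      using angle by simp
    finally show ?case
      using angle
      by (intro exI[of _ 0] exI[of _ "\<lambda>b. if b = a then f else 0"]) (auto intro: homog.zero)
  next
    case (add M K f g)
    from add.IH(1) obtain r fD fA where
      f: "f = free_var x * r + sub x (free.D (free_var x)) fD
        + (\<Sum>a\<in>set_mset M - {x}. sub x (free.angle (free_var x) (free_var a)) (fA a))"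
        "homog (M - {#x#}) K r" "homog M (K - 1) fD"
        "\<forall>a. a \<in># M \<longrightarrow> a \<noteq> x \<longrightarrow> homog (M - {#a#}) (K - 1) (fA a)"
        "K = 0 \<longrightarrow> fD = 0 \<and> (\<forall>a. fA a = 0)"
      by (elim exE conjE)
    from add.IH(2) obtain r' fD' fA' where
      g: "g = free_var x * r' + sub x (free.D (free_var x)) fD'
        + (\<Sum>a\<in>set_mset M - {x}. sub x (free.angle (free_var x) (free_var a)) (fA' a))"
        "homog (M - {#x#}) K r'" "homog M (K - 1) fD'"
        "\<forall>a. a \<in># M \<longrightarrow> a \<noteq> x \<longrightarrow> homog (M - {#a#}) (K - 1) (fA' a)"
        "K = 0 \<longrightarrow> fD' = 0 \<and> (\<forall>a. fA' a = 0)"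
      by (elim exE conjE)
    have "f + g = free_var x * (r + r') + sub x (free.D (free_var x)) (fD + fD')
        + (\<Sum>a\<in>set_mset M - {x}. sub x (free.angle (free_var x) (free_var a)) (fA a + fA' a))"
      unfolding f(1) g(1) by (simp add: sum.distrib distrib_left)
    moreover have "homog (M - {#x#}) K (r + r')" "homog M (K - 1) (fD + fD')"
      "\<forall>a. a \<in># M \<longrightarrow> a \<noteq> x \<longrightarrow> homog (M - {#a#}) (K - 1) (fA a + fA' a)"
      "K = 0 \<longrightarrow> fD + fD' = 0 \<and> (\<forall>a. fA a + fA' a = 0)"
      using f(2-) g(2-) by (auto intro: homog.add)
    ultimately show ?case
      by (intro exI[of _ "r + r'"] exI[of _ "fD + fD'"] exI[of _ "\<lambda>a. fA a + fA' a"] conjI)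
  qed
  then show ?thesis
    using that by blast
qed

section \<open>Multilinear elements are determined by their coefficients\<close>

definition multilinear :: "'v multiset \<Rightarrow> bool" where
  "multilinear M \<longleftrightarrow> (\<forall>v. count M v \<le> 1)"

lemma multilinear_count: "multilinear M \<Longrightarrow> v \<in># M \<Longrightarrow> count M v = 1"
  by (rule antisym) (auto simp: multilinear_def Suc_le_eq)

lemma multilinear_diff: "multilinear M \<Longrightarrow> multilinear (M - N)"
  by (auto simp: multilinear_def intro: le_trans[OF diff_le_self])

lemma multilinear_notin: "multilinear M \<Longrightarrow> v \<notin># M - {#v#}"
  by (auto simp: multilinear_def not_in_iff)

text \<open>Column \<open>x\<close> is cleared along with row \<open>x\<close>, so that
  \<open>skew\<close> returns exactly \<rho> as the values of the form on \<open>x\<close>, off the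
  diagonal. The argument \<open>t\<close> is the value on \<open>x\<close> and
  \<open>e\<close>.\<close>

definition row :: "'v \<Rightarrow> ('v \<Rightarrow> 'k) \<Rightarrow> 'k \<Rightarrow> ('v \<Rightarrow> 'v option \<Rightarrow> 'k) \<Rightarrow> 'v \<Rightarrow> 'v option \<Rightarrow> 'k::zero" where
  "row x \<rho> t C v w = (if v = x then (case w of None \<Rightarrow> t | Some j \<Rightarrow> \<rho> j)
     else if w = Some x then 0 else C v w)"

lemma row_None [simp]: "row x \<rho> t C v None = (if v = x then t else C v None)"
  by (simp add: row_def)

lemma skew_row:
  "skew (row x \<rho> t C) v w = (if v = w then 0 else if v = x then \<rho> w else if w = x then - \<rho> v
     else skew C v w)"
  by (auto simp: skew_def row_def)

lemma row_row [simp]: "row x \<rho> t (row x \<rho>' t' C) = row x \<rho> t C"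
  by (auto simp: row_def fun_eq_iff)

lemma pull_None: "pull x (W, k) C v None = (if v = x then tau C W else C v None)"
  by (simp add: pull_def)

lemma skew_pull_other: "v \<noteq> x \<Longrightarrow> w \<noteq> x \<Longrightarrow> skew (pull x b C) v w = skew C v w"
  by (simp add: skew_def pull_def)

lemma skew_pull_left:
  "w \<noteq> x \<Longrightarrow> skew (pull x (W, k) C) x w = (\<Sum>u\<in>#W. skew C u w) - of_nat k * C w None"
  by (simp add: skew_def[of "pull x (W, k) C"] pull_def form_def)

lemma coef_cong_row:
  assumes "homog M K f" "\<And>w. w \<in># M \<Longrightarrow> w \<noteq> x \<Longrightarrow> skew C x w = skew C' x w"
    and "\<And>v w. v \<in># M \<Longrightarrow> w \<in># M \<Longrightarrow> v \<noteq> w \<Longrightarrow> v \<noteq> x \<Longrightarrow> w \<noteq> x \<Longrightarrow> skew C v w = skew C' v w"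
    and "\<And>v. v \<in># M \<Longrightarrow> C v None = C' v None"
  shows "coef C f = coef C' f"
  using assms(1)
proof (rule coef_cong)
  fix v w
  assume "v \<in># M" "w \<in># M" "v \<noteq> w"
  then show "skew C v w = skew C' v w"
    using assms(2)[of v] assms(2)[of w] assms(3)[of v w] skew_anticomm[of C v w]
      skew_anticomm[of C' v w] by (cases "v = x"; cases "w = x") auto
qed (fact assms(4))

lemma coef_row_same: "homog M K f \<Longrightarrow> coef (row x (skew C x) (C x None) C) f = coef C f"
  by (rule coef_cong_row[where x = x]) (auto simp: skew_row)

lemma coef_row_notin: "homog M K f \<Longrightarrow> x \<notin># M \<Longrightarrow> coef (row x \<rho> t C) f = coef C f"
  by (rule coef_cong) (auto simp: skew_row)

lemma coef_row_cong:
  "homog M K f \<Longrightarrow> (\<And>w. w \<in># M \<Longrightarrow> w \<noteq> x \<Longrightarrow> \<rho> w = \<rho>' w) \<Longrightarrow>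
   coef (row x \<rho> t C) f = coef (row x \<rho>' t C) f"
  by (rule coef_cong_row[where x = x]) (auto simp: skew_row)

text \<open>Polynomial dependence on the value against \<open>e\<close>, with the rest of the row
  fixed, makes it possible to cancel that value: what holds for nonzero \<open>s\<close> extends to
  \<open>s = 0\<close>.\<close>

lemma coef_row_poly:
  fixes f :: "('k::field_char_0, 'v) free_jb"
  assumes "homog M K f"
  shows "\<exists>p. \<forall>s. coef (row x \<rho> s C) f = poly p s"
  using assms
proof (induction rule: homog.induct)
  have tau: "\<exists>p. \<forall>s. tau (row x \<rho> s C) M = poly p s" for M
  proof (induction M)
    case empty
    show ?case by (rule exI[of _ 0]) simp
  next
    case (add v M)
    then obtain p where "\<forall>s. tau (row x \<rho> s C) M = poly p s" ..
    then show ?case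
      by (intro exI[of _ "(if v = x then [:0, 1:] else [:C v None:]) + p"]) auto
  qed
  {
    case one
    show ?case by (rule exI[of _ 1]) simp
  next
    case (var v)
    show ?case by (rule exI[of _ 1]) simp
  next
    case (zero M K)
    show ?case by (rule exI[of _ 0]) simp
  next
    case (add M K f g)
    then show ?case by (metis coef_add poly_add)
  next
    case (scale M K f r)
    then show ?case by (metis coef_scale poly_smult)
  next
    case (mult M K f N L g)
    then show ?case by (metis coef_mult poly_mult)
  next
    case (D M K f)
    then show ?case by (metis coef_D poly_mult tau)
  next
    case (angle M K f N L g)
    obtain p q where pq: "\<And>s. tau (row x \<rho> s C) M = poly p s" "\<And>s. tau (row x \<rho> s C) N = poly q s"
      using tau by metis
    define c where "c = (\<Sum>v\<in>#M. \<Sum>w\<in>#N. skew (row x \<rho> 0 C) v w)"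
    have "form (row x \<rho> s C) (M, K) (N, L) = poly ([:c:] + smult (of_nat L) p - smult (of_nat K) q) s" for s
      by (simp add: form_def pq c_def skew_row)
    moreover obtain p' q' where "\<And>s. coef (row x \<rho> s C) f = poly p' s"
      "\<And>s. coef (row x \<rho> s C) g = poly q' s"
      using angle by metis
    ultimately show ?case
      using angle(1,2)
      by (intro exI[of _ "smult 2 ([:c:] + smult (of_nat L) p - smult (of_nat K) q) * (p' * q')"])
        (simp add: coef_angle)
  }
qed

lemma poly_eqI_infinite:
  fixes p q :: "'k::field_char_0 poly"
  assumes "\<And>s. s \<in> S \<Longrightarrow> poly p s = poly q s" "infinite S"
  shows "p = q"
proof (rule ccontr)
  assume "p \<noteq> q"
  then have "finite {s. poly (p - q) s = 0}"
    by (intro poly_roots_finite) simp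
  moreover have "S \<subseteq> {s. poly (p - q) s = 0}"
    using assms(1) by auto
  ultimately show False
    using assms(2) finite_subset by blast
qed

lemma coef_var_mult: "homog M K f \<Longrightarrow> coef C (free_var x * f) = coef C f"
  using coef_mult[OF homog.var] by fastforce

lemma homog_sub_D:
  assumes "homog M (K - 1) f" "count M x = 1" "K = 0 \<Longrightarrow> f = 0"
  shows "homog M K (sub x (free.D (free_var x)) f)"
proof (cases K)
  case 0
  then show ?thesis using assms(3) by (simp add: homog.zero)
next
  case (Suc k)
  have "x \<in># M"
    using assms(2) by (simp flip: count_greater_zero_iff)
  then show ?thesis
    using homog_sub_linear[OF assms(1,2) homog.D[OF homog.var[of x]]] Suc by simp
qed

lemma homog_sub_angle:
  assumes "homog (M - {#a#}) (K - 1) f" "count M x = 1" "a \<noteq> x" "a \<in># M" "K = 0 \<Longrightarrow> f = 0"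
  shows "homog M K (sub x (free.angle (free_var x) (free_var a)) f)"
proof (cases K)
  case 0
  then show ?thesis using assms(5) by (simp add: homog.zero)
next
  case (Suc k)
  have "x \<in># M - {#a#}"
    using assms(2,3) by (simp flip: count_greater_zero_iff)
  have "M - {#a#} - {#x#} + ({#x#} + {#a#}) = add_mset a (add_mset x (M - {#a#} - {#x#}))"
    by simp
  also have "\<dots> = M"
    by (simp only: insert_DiffM[OF \<open>x \<in># M - {#a#}\<close>] insert_DiffM[OF assms(4)])
  finally have M: "M - {#a#} - {#x#} + ({#x#} + {#a#}) = M" .
  have "count (M - {#a#}) x = 1"
    using assms(2,3) by simp
  from homog_sub_linear[OF assms(1) this homog.angle[OF homog.var[of x] homog.var[of a]]] Suc show ?thesis
    unfolding M by simp
qed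

lemma coef_linear_decomposition:
  assumes f: "f = free_var x * r + sub x (free.D (free_var x)) fD
      + (\<Sum>a\<in>set_mset M - {x}. sub x (free.angle (free_var x) (free_var a)) (fA a))"
    and h: "homog (M - {#x#}) K r" "homog M (K - 1) fD"
      "\<And>a. a \<in># M \<Longrightarrow> a \<noteq> x \<Longrightarrow> homog (M - {#a#}) (K - 1) (fA a)"
      "K = 0 \<Longrightarrow> fD = 0" "\<And>a. K = 0 \<Longrightarrow> fA a = 0"
    and x: "count M x = 1"
  shows "coef C f = coef C r + C x None * coef (pull x ({#x#}, 1) C) fD
    + (\<Sum>a\<in>set_mset M - {x}. 2 * skew C x a * coef (pull x ({#x, a#}, 1) C) (fA a))"
proof -
  have "x \<in># M"
    using x by (simp flip: count_greater_zero_iff)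
  then have 1: "homog M K (free_var x * r)"
    using homog_var_mult[OF h(1), of x] by simp
  have 2: "homog M K (sub x (free.D (free_var x)) fD)"
    using h(2,4) x by (intro homog_sub_D)
  have 3: "homog M K (sub x (free.angle (free_var x) (free_var a)) (fA a))"
    if "a \<in> set_mset M - {x}" for a
    using that h(3,5) x by (intro homog_sub_angle) auto
  have "coef C (sub x (free.D (free_var x)) fD) = C x None * coef (pull x ({#x#}, 1) C) fD"
    using coef_sub_linear[OF h(2) x homog.D[OF homog.var[of x]], of C]
    by (simp add: coef_D[OF homog.var])
  moreover have "coef C (sub x (free.angle (free_var x) (free_var a)) (fA a))
      = 2 * skew C x a * coef (pull x ({#x, a#}, 1) C) (fA a)" if "a \<in> set_mset M - {x}" for a
    using coef_sub_linear[where C = C, OF h(3) _ homog.angle[OF homog.var[of x] homog.var[of a]]] that x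
    by (simp add: coef_angle[OF homog.var homog.var] form_def add_mset_commute)
  moreover have "homog M K (\<Sum>a\<in>set_mset M - {x}. sub x (free.angle (free_var x) (free_var a)) (fA a))"
    by (rule homog_sum) (rule 3)
  then have "coef C f = coef C (free_var x * r) + coef C (sub x (free.D (free_var x)) fD)
      + coef C (\<Sum>a\<in>set_mset M - {x}. sub x (free.angle (free_var x) (free_var a)) (fA a))"
    unfolding f by (simp only: coef_add[OF homog.add[OF 1 2]] coef_add[OF 1 2])
  moreover have "coef C (\<Sum>a\<in>set_mset M - {x}. sub x (free.angle (free_var x) (free_var a)) (fA a))
      = (\<Sum>a\<in>set_mset M - {x}. coef C (sub x (free.angle (free_var x) (free_var a)) (fA a)))"
    by (rule coef_sum) (rule 3)
  ultimately show ?thesis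
    by (simp add: coef_var_mult[OF h(1)])
qed

text \<open>The three kinds of summands of \<open>linear_decomposition\<close> are separated by the forms that vanish on
  \<open>x\<close>, those whose only nonzero value on \<open>x\<close> is at \<open>a\<close>, and the others.\<close>

lemma multilinear_eq_zero:
  fixes f :: "('k::field_char_0, 'v) free_jb"
  assumes "homog M K f" "multilinear M" "\<And>C. coef C f = 0"
  shows "f = 0"
  using assms
\<comment> \<open>\<open>r\<close> and \<open>fA a\<close> have fewer variables, whereas
  \<open>fD\<close> has the same variables and one bracket less; hence the sum as measure.\<close>
proof (induction "size M + K" arbitrary: M K f rule: less_induct)
  case less
  show ?case
  proof (cases "M = {#}")
    case True
    then obtain c where "f = free_scale c 1"
      using homog_empty_const less.prems(1) by metis
    then show ?thesis
      using less.prems(3) by (simp add: coef_scale[OF homog.one])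
  next
    case False
    then obtain x where xM: "x \<in># M"
      by auto
    then have x: "count M x = 1"
      using less.prems(2) multilinear_count by metis
    obtain r fD fA where dec: "f = free_var x * r + sub x (free.D (free_var x)) fD
      + (\<Sum>a\<in>set_mset M - {x}. sub x (free.angle (free_var x) (free_var a)) (fA a))"
      "homog (M - {#x#}) K r" "homog M (K - 1) fD"
      "\<And>a. a \<in># M \<Longrightarrow> a \<noteq> x \<Longrightarrow> homog (M - {#a#}) (K - 1) (fA a)"
      "K = 0 \<Longrightarrow> fD = 0" "\<And>a. K = 0 \<Longrightarrow> fA a = 0"
      by (rule linear_decomposition[OF less.prems(1) x], rule that)
    note coef_f = coef_linear_decomposition[OF dec x]
    have size: "size (M - {#x#}) < size M"
      using xM by (simp add: size_Diff1_less)
    have r: "r = 0"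
    proof (rule less.hyps[OF _ dec(2)])
      fix C :: "'v \<Rightarrow> 'v option \<Rightarrow> 'k"
      have "(\<Sum>a\<in>set_mset M - {x}. 2 * skew (row x (\<lambda>_. 0) 0 C) x a
          * coef (pull x ({#x, a#}, 1) (row x (\<lambda>_. 0) 0 C)) (fA a)) = 0"
        by (rule sum.neutral) (auto simp: skew_row)
      then show "coef C r = 0"
        using coef_f[of "row x (\<lambda>_. 0) 0 C"] less.prems(2,3)
        by (simp add: coef_row_notin[OF dec(2)] multilinear_notin)
    qed (use size less.prems(2) multilinear_diff in auto)
    have fA: "fA a = 0" if a: "a \<in># M" "a \<noteq> x" for a
    proof (cases K)
      case (Suc k)
      show ?thesis
      proof (rule less.hyps[OF _ dec(4)[OF a]])
        fix C :: "'v \<Rightarrow> 'v option \<Rightarrow> 'k"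
        \<comment> \<open>Pulling \<open>C'\<close> back to the weight of \<open><x, a>\<close> must
          reproduce \<open>C\<close>. The bracket in that weight subtracts \<open>C j None\<close>,
          so row \<open>a\<close> adds it in advance; row \<open>x\<close> contributes nothing away
          from \<open>a\<close>, and its value 0 against \<open>e\<close> removes the summand with
          \<open>fD\<close>.\<close>
        define C' where "C' = row x (\<lambda>j. if j = a then 1 else 0) 0
          (row a (\<lambda>j. skew C x j + C j None) (C x None) C)"
        have "(\<Sum>b\<in>set_mset M - {x}. 2 * skew C' x b * coef (pull x ({#x, b#}, 1) C') (fA b))
            = (\<Sum>b\<in>set_mset M - {x}. if b = a then 2 * coef (pull x ({#x, b#}, 1) C') (fA b) else 0)"
          by (rule sum.cong) (auto simp: C'_def skew_row)
        then have "2 * coef (pull x ({#x, a#}, 1) C') (fA a) = 0"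
          using coef_f[of C'] less.prems(3) a by (simp add: r C'_def)
        moreover have "coef (pull x ({#x, a#}, 1) C') (fA a) = coef C (fA a)"
          by (rule coef_cong_row[OF dec(4)[OF a], where x = x])
            (use a multilinear_notin[OF less.prems(2), of a] in
              \<open>auto simp: skew_pull_left skew_pull_other pull_None C'_def skew_row\<close>)
        ultimately show "coef C (fA a) = 0"
          by simp
      qed (use Suc a less.prems(2) multilinear_diff in \<open>auto simp: size_Diff1_less less_SucI\<close>)
    qed (use dec(6) in auto)
    have fD: "fD = 0"
    proof (cases K)
      case (Suc k)
      show ?thesis
      proof (rule less.hyps[OF _ dec(3)])
        fix C :: "'v \<Rightarrow> 'v option \<Rightarrow> 'k"
        obtain p where p: "\<And>s. coef (row x (skew C x) s C) fD = poly p s"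
          using coef_row_poly[OF dec(3)] by metis
        \<comment> \<open>\<open>s\<close> is the coefficient of \<open>D x\<close> and can be
          cancelled only when nonzero; \<open>p\<close> then vanishes as a polynomial. Since
          \<open>fA\<close> is already known to vanish, the row at \<open>x\<close> may now be
          arbitrary.\<close>
        have "poly p s = poly 0 s" if "s \<in> UNIV - {0}" for s
        proof -
          define C' where "C' = row x (\<lambda>j. skew C x j + C j None) s C"
          have "s * coef (pull x ({#x#}, 1) C') fD = 0"
            using coef_f[of C'] less.prems(3) fA by (simp add: r C'_def)
          moreover have "coef (pull x ({#x#}, 1) C') fD = coef (row x (skew C x) s C) fD"
            by (rule coef_cong_row[OF dec(3), where x = x])
              (auto simp: skew_pull_left skew_pull_other pull_None C'_def skew_row)
          ultimately show ?thesis
            using that p by simp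
        qed
        then have "p = 0" 
          by (rule poly_eqI_infinite[of "UNIV - {0}"]) (simp_all add: infinite_UNIV_char_0)
        then show "coef C fD = 0"
          using p coef_row_same[OF dec(3), of x C] by (metis poly_0)
      qed (use Suc less.prems(2) in auto)
    qed (use dec(5) in auto)
    show ?thesis
      using dec(1) fA by (simp add: r fD)
  qed
qed

text \<open>Setting x := 1 evaluates the coefficient at the zero row, since 1 has weight zero. If
  the row does not matter, \<open>f\<close> and \<open>x\<close> times this specialization have the
  same coefficients.\<close>

lemma factor_var:
  assumes f: "homog M K f" "multilinear M" "x \<in># M"
    and indep: "\<And>C \<rho> t. coef (row x \<rho> t C) f = coef (row x (\<lambda>_. 0) 0 C) f"
  shows "f = free_var x * sub x 1 f"
proof -
  have x: "count M x = 1"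
    using f(2,3) multilinear_count by metis
  have 1: "homog (M - {#x#}) K (sub x 1 f)"
    using homog_sub_linear[OF f(1) x homog.one] by simp
  then have 2: "homog M K (free_var x * sub x 1 f)"
    using homog_var_mult[OF 1, of x] f(3) by simp
  have "f - free_var x * sub x 1 f = 0"
  proof (rule multilinear_eq_zero[OF homog_diff[OF f(1) 2] f(2)])
    fix C
    have "coef (pull x ({#}, 0) C) f = coef (row x (\<lambda>_. 0) 0 C) f"
      by (rule coef_cong_row[OF f(1), where x = x])
        (auto simp: skew_pull_left skew_pull_other pull_None skew_row)
    then show "coef C (f - free_var x * sub x 1 f) = 0"
      using indep[of "skew C x" "C x None" C] coef_row_same[OF f(1), of x C]
      by (simp add: coef_diff[OF f(1) 2] coef_var_mult[OF 1] coef_sub_linear[OF f(1) x homog.one])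
  qed
  then show ?thesis
    by simp
qed

section \<open>Multilinear elements with additive coefficients\<close>

lemma coef_pull_notin:
  assumes "homog M K f" "x \<notin># M"
  shows "coef (pull x b C) f = coef C f"
proof (rule coef_cong[OF assms(1)])
  fix v w
  assume "v \<in># M" "w \<in># M"
  then have "v \<noteq> x" "w \<noteq> x"
    using assms(2) by auto
  then show "skew (pull x b C) v w = skew C v w" "pull x b C v None = C v None"
    by (simp_all add: skew_pull_other pull_def)
qed

inductive angle_D :: "'v multiset \<Rightarrow> ('k::field_char_0, 'v) free_jb \<Rightarrow> bool" where
  const: "angle_D {#} (free_scale c 1)"
| D: "angle_D M f \<Longrightarrow> angle_D (add_mset x M) (free.D (free_var x) * f)"
| angle: "angle_D M f \<Longrightarrow>
    angle_D (add_mset x (add_mset a M)) (free.angle (free_var x) (free_var a) * f)"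
| add: "angle_D M f \<Longrightarrow> angle_D M g \<Longrightarrow> angle_D M (f + g)"

lemma angle_D_zero: "angle_D M 0"
proof (induction M)
  case empty
  show ?case using angle_D.const[of 0] by simp
next
  case (add x M)
  then show ?case using angle_D.D[OF add, of x] by simp
qed

lemma angle_D_sum: "(\<And>i. i \<in> A \<Longrightarrow> angle_D M (f i)) \<Longrightarrow> angle_D M (sum f A)"
  by (induction A rule: infinite_finite_induct) (auto intro: angle_D_zero angle_D.add)

definition row_additive :: "'v multiset \<Rightarrow> ('k::field_char_0, 'v) free_jb \<Rightarrow> bool" where
  "row_additive M f \<longleftrightarrow> (\<forall>x C \<rho>1 \<rho>2 t1 t2. x \<in># M \<longrightarrow>
     coef (row x (\<lambda>j. \<rho>1 j + \<rho>2 j) (t1 + t2) C) f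
       = coef (row x \<rho>1 t1 C) f + coef (row x \<rho>2 t2 C) f)"

lemma row_additiveD:
  "row_additive M f \<Longrightarrow> x \<in># M \<Longrightarrow> \<rho> = (\<lambda>j. \<rho>1 j + \<rho>2 j) \<Longrightarrow> t = t1 + t2 \<Longrightarrow>
   coef (row x \<rho> t C) f = coef (row x \<rho>1 t1 C) f + coef (row x \<rho>2 t2 C) f"
  by (simp add: row_additive_def)

lemma row_additive_zero: "row_additive M f \<Longrightarrow> x \<in># M \<Longrightarrow> coef (row x (\<lambda>_. 0) 0 C) f = 0"
  using row_additiveD[of M f x "\<lambda>_. 0" "\<lambda>_. 0" "\<lambda>_. 0" 0 0 0 C] by simp

text \<open>Additivity in row \<open>x\<close> kills the multiple of \<open>x\<close> in the
  decomposition and, combined with additivity in the other rows, makes the coefficients of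
  \<open>fD\<close> and \<open>fA a\<close> independent of row \<open>x\<close>. By
  \<open>factor_var\<close> both are then multiples of \<open>x\<close>, so that the substitutions
  become products.\<close>

lemma row_additive_expand:
  assumes f: "homog M K f" "multilinear M" "row_additive M f" "x \<in># M"
  obtains r R where "f = free.D (free_var x) * r
      + (\<Sum>a\<in>set_mset M - {x}. free.angle (free_var x) (free_var a) * R a)"
    and "homog (M - {#x#}) (K - 1) r"
    and "\<And>a. a \<in># M \<Longrightarrow> a \<noteq> x \<Longrightarrow> homog (M - {#a#} - {#x#}) (K - 1) (R a)"
    and "\<And>C. coef C f = C x None * coef C r + (\<Sum>a\<in>set_mset M - {x}. 2 * skew C x a * coef C (R a))"
proof -
  have x: "count M x = 1"
    using f multilinear_count by metis
  obtain r0 fD fA where dec: "f = free_var x * r0 + sub x (free.D (free_var x)) fD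
      + (\<Sum>a\<in>set_mset M - {x}. sub x (free.angle (free_var x) (free_var a)) (fA a))"
    "homog (M - {#x#}) K r0" "homog M (K - 1) fD"
    "\<And>a. a \<in># M \<Longrightarrow> a \<noteq> x \<Longrightarrow> homog (M - {#a#}) (K - 1) (fA a)"
    "K = 0 \<Longrightarrow> fD = 0" "\<And>a. K = 0 \<Longrightarrow> fA a = 0"
    by (rule linear_decomposition[OF f(1) x], rule that)
  note coef_f = coef_linear_decomposition[OF dec x]
  have coef_r0: "coef (row x (\<lambda>_. 0) 0 C) f = coef C r0" for C :: "'a \<Rightarrow> 'a option \<Rightarrow> 'b"
  proof -
    have "(\<Sum>a\<in>set_mset M - {x}. 2 * skew (row x (\<lambda>_. 0) 0 C) x a
        * coef (pull x ({#x, a#}, 1) (row x (\<lambda>_. 0) 0 C)) (fA a)) = 0"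
      by (rule sum.neutral) (auto simp: skew_row)
    then show ?thesis
      using coef_f[of "row x (\<lambda>_. 0) 0 C"]
      by (simp add: coef_row_notin[OF dec(2)] multilinear_notin[OF f(2)])
  qed
  have r0: "r0 = 0"
    by (rule multilinear_eq_zero[OF dec(2) multilinear_diff[OF f(2)]])
      (use coef_r0 row_additive_zero[OF f(3,4)] in simp)
  define R where "R a = sub x 1 (fA a)" for a
  have fA: "fA a = free_var x * R a" if a: "a \<in># M" "a \<noteq> x" for a
  proof -
    have ax: "x \<in># M - {#a#}" "a \<notin># M - {#a#}"
      using a f(4) multilinear_notin[OF f(2)] by (simp_all add: in_diff_count)
    have key: "coef C (fA a) = coef (row x (\<lambda>j. - C j None) 0 C) (fA a)"
      for C :: "'a \<Rightarrow> 'a option \<Rightarrow> 'b"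
    proof -
      define \<delta> where "\<delta> = (\<lambda>j. if j = a then 1 else 0 :: 'b)"
      \<comment> \<open>With the unit vector at \<open>a\<close> as row \<open>x\<close>, only the
        summand with \<open><x, a>\<close> survives, and row \<open>a\<close> of the form becomes
        row \<open>x\<close> of the pullback seen by \<open>fA a\<close>, shifted by the values
        against \<open>e\<close>.\<close>
      define E where "E \<rho> t = coef (row x \<delta> 0 (row a \<rho> t C)) f" for \<rho> t
      have E1: "E \<rho> t = 2 * coef (row x (\<lambda>j. \<rho> j - C j None) t C) (fA a)" for \<rho> t
      proof -
        let ?C = "row x \<delta> 0 (row a \<rho> t C)"
        have "(\<Sum>b\<in>set_mset M - {x}. 2 * skew ?C x b * coef (pull x ({#x, b#}, 1) ?C) (fA b))
            = (\<Sum>b\<in>set_mset M - {x}. if b = a then 2 * coef (pull x ({#x, b#}, 1) ?C) (fA b) else 0)"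
          by (rule sum.cong) (auto simp: \<delta>_def skew_row)
        also have "\<dots> = 2 * coef (pull x ({#x, a#}, 1) ?C) (fA a)"
          using a by simp
        also have "coef (pull x ({#x, a#}, 1) ?C) (fA a) = coef (row x (\<lambda>j. \<rho> j - C j None) t C) (fA a)"
          by (rule coef_cong_row[OF dec(4)[OF a], where x = x])
            (use a ax in \<open>auto simp: skew_pull_left skew_pull_other pull_None \<delta>_def skew_row\<close>)
        finally show ?thesis
          using coef_f[of ?C] by (simp add: E_def r0)
      qed
      \<comment> \<open>Additivity in row \<open>a\<close> splits off its entry at \<open>x\<close>,
        which is -1 by skewness and gives \<open>E\<close> at the zero row. The remaining form has
        zero row at \<open>x\<close>, and there the coefficient vanishes by additivity in row
        \<open>x\<close>.\<close>
      have E2: "E \<rho> t = E (\<lambda>_. 0) 0" for \<rho> t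
      proof -
        have swap: "coef (row x \<rho>' 0 (row a \<rho> t C)) f
            = coef (row a (\<rho>(x := - \<rho>' a)) t (row x \<rho>' 0 C)) f" for \<rho> \<rho>' t
          by (rule coef_cong[OF f(1)]) (use a in \<open>auto simp: skew_row\<close>)
        have "E \<rho> t = coef (row a (\<rho>(x := - 1)) t (row x \<delta> 0 C)) f"
          unfolding E_def swap by (simp add: \<delta>_def)
        also have "\<dots> = coef (row a ((\<lambda>_. 0)(x := - 1)) 0 (row x \<delta> 0 C)) f
            + coef (row a (\<rho>(x := 0)) t (row x \<delta> 0 C)) f"
          by (rule row_additiveD[OF f(3) a(1)]) (auto simp: fun_eq_iff)
        also have "coef (row a ((\<lambda>_. 0)(x := - 1)) 0 (row x \<delta> 0 C)) f = E (\<lambda>_. 0) 0"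
          unfolding E_def swap by (simp add: \<delta>_def)
        also have "coef (row a (\<rho>(x := 0)) t (row x \<delta> 0 C)) f
            = coef (row x (\<lambda>_. 0) 0 (row a \<rho> t C)) f"
          by (rule coef_cong[OF f(1)]) (use a in \<open>auto simp: skew_row \<delta>_def\<close>)
        finally show ?thesis
          using row_additive_zero[OF f(3,4)] by simp
      qed
      have "2 * coef (row x (skew C x) (C x None) C) (fA a)
          = 2 * coef (row x (\<lambda>j. - C j None) 0 C) (fA a)"
        using E1[of "\<lambda>j. skew C x j + C j None" "C x None"] E1[of "\<lambda>_. 0" 0] E2 by simp
      then show ?thesis
        by (simp add: coef_row_same[OF dec(4)[OF a]])
    qed
    show ?thesis
      unfolding R_def
    proof (rule factor_var[OF dec(4)[OF a] multilinear_diff[OF f(2)] ax(1)])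
      fix C :: "'a \<Rightarrow> 'a option \<Rightarrow> 'b" and \<rho> t
      have "coef (row x \<rho> t C) (fA a) = coef (row x (\<lambda>j. - C j None) 0 C) (fA a)" for \<rho> t
        unfolding key[of "row x \<rho> t C"] row_row
        by (rule coef_row_cong[OF dec(4)[OF a]]) auto
      then show "coef (row x \<rho> t C) (fA a) = coef (row x (\<lambda>_. 0) 0 C) (fA a)"
        by metis
    qed
  qed
  have R: "homog (M - {#a#} - {#x#}) (K - 1) (R a)" if "a \<in># M" "a \<noteq> x" for a
    using homog_sub_linear[OF dec(4)[OF that] _ homog.one, of x] that x by (simp add: R_def)
  have R_notin: "x \<notin># M - {#a#} - {#x#}" for a
    using f(2) multilinear_notin[of "M - {#a#}"] multilinear_diff by blast
  have coef_fA: "coef C (fA a) = coef C (R a)" if "a \<in># M" "a \<noteq> x" for a C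
    unfolding fA[OF that] by (rule coef_var_mult[OF R[OF that]])
  have coef_R: "coef (pull x b C) (fA a) = coef C (R a)" if "a \<in># M" "a \<noteq> x" for a b C
    unfolding coef_fA[OF that] by (rule coef_pull_notin[OF R[OF that] R_notin])
  have coef_row_R: "coef (row x \<rho> t C) (R a) = coef C (R a)" if "a \<in># M" "a \<noteq> x" for a \<rho> t C
    by (rule coef_row_notin[OF R[OF that] R_notin])
  define r where "r = sub x 1 fD"
  have fD: "fD = free_var x * r"
    unfolding r_def
  proof (rule factor_var[OF dec(3) f(2,4)])
    fix C :: "'a \<Rightarrow> 'a option \<Rightarrow> 'b" and \<rho> t
    \<comment> \<open>In row \<open>x\<close> the coefficient of \<open>f\<close> is
      \<open>s * Q \<sigma> s + L \<sigma>\<close> with \<open>L\<close> linear. Additivity makes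
      \<open>s * Q \<sigma> s\<close> independent of \<sigma> and additive in \<open>s\<close>, so
      \<open>Q\<close> is constant on the positive integers, and a polynomial constant on this
      infinite set is constant.\<close>
    define Q where "Q \<sigma> s = coef (row x (\<lambda>j. \<sigma> j - C j None) s C) fD" for \<sigma> s
    define L where "L \<sigma> = (\<Sum>a\<in>set_mset M - {x}. 2 * \<sigma> a * coef C (R a))" for \<sigma>
    have H: "coef (row x \<sigma> s C) f = s * Q \<sigma> s + L \<sigma>" for \<sigma> s
    proof -
      have "coef (pull x ({#x#}, 1) (row x \<sigma> s C)) fD = Q \<sigma> s"
        unfolding Q_def by (rule coef_cong_row[OF dec(3), where x = x])
          (auto simp: skew_pull_left skew_pull_other pull_None skew_row)
      moreover have "(\<Sum>a\<in>set_mset M - {x}. 2 * skew (row x \<sigma> s C) x a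
          * coef (pull x ({#x, a#}, 1) (row x \<sigma> s C)) (fA a)) = L \<sigma>"
        unfolding L_def by (rule sum.cong)
          (auto simp: skew_row coef_R coef_row_R)
      ultimately show ?thesis
        using coef_f[of "row x \<sigma> s C"] by (simp add: r0)
    qed
    have L_zero: "L (\<lambda>_. 0) = 0"
      by (simp add: L_def)
    have Q_add: "s * Q \<sigma> s = s * Q (\<lambda>_. 0) s" for \<sigma> s
      using row_additiveD[OF f(3,4), of \<sigma> "\<lambda>_. 0" \<sigma> s s 0 C] H[of \<sigma> 0] H[of "\<lambda>_. 0" s] H[of \<sigma> s]
        L_zero by simp
    have Q_nat: "of_nat n * Q (\<lambda>_. 0) (of_nat n) = of_nat n * Q (\<lambda>_. 0) 1" for n
    proof (induction n)
      case (Suc n)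
      have "(of_nat n + 1) * Q (\<lambda>_. 0) (of_nat n + 1)
          = of_nat n * Q (\<lambda>_. 0) (of_nat n) + 1 * Q (\<lambda>_. 0) 1"
        using row_additiveD[OF f(3,4), of "\<lambda>_. 0" "\<lambda>_. 0" "\<lambda>_. 0" "of_nat n + 1" "of_nat n" 1 C]
          H[of "\<lambda>_. 0"] L_zero by simp
      then show ?case
        using Suc by (simp add: algebra_simps)
    qed simp
    have "\<exists>p. \<forall>s. Q \<sigma> s = poly p s" for \<sigma>
      unfolding Q_def by (rule coef_row_poly[OF dec(3)])
    then obtain p where p: "\<And>\<sigma> s. Q \<sigma> s = poly (p \<sigma>) s"
      by metis
    have "p \<sigma> = p (\<lambda>_. 0)" for \<sigma>
    proof (rule poly_eqI_infinite[of "UNIV - {0}"])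
      show "poly (p \<sigma>) s = poly (p (\<lambda>_. 0)) s" if "s \<in> UNIV - {0}" for s
        using Q_add[of s \<sigma>] that by (simp add: p)
    qed (simp add: infinite_UNIV_char_0)
    moreover have "p (\<lambda>_. 0) = [:Q (\<lambda>_. 0) 1:]"
    proof (rule poly_eqI_infinite[of "range (\<lambda>n. of_nat (Suc n))"])
      show "poly (p (\<lambda>_. 0)) s = poly [:Q (\<lambda>_. 0) 1:] s" if "s \<in> range (\<lambda>n. of_nat (Suc n))" for s
      proof -
        obtain n where "s = of_nat (Suc n)"
          using \<open>s \<in> range _\<close> by blast
        then show ?thesis
          using Q_nat[of "Suc n"] of_nat_neq_0[of n, where 'a = 'b] by (simp add: p del: of_nat_Suc)
      qed
      show "infinite (range (\<lambda>n. of_nat (Suc n)) :: 'b set)"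
        by (rule range_inj_infinite) (simp add: inj_def del: of_nat_Suc)
    qed
    ultimately have Q_const: "Q \<sigma> s = Q (\<lambda>_. 0) 1" for \<sigma> s
      unfolding p by (metis poly_0 mult_zero_right add_0_right poly_pCons)
    have "coef (row x \<rho> t C) fD = Q (\<lambda>_. 0) 1" for \<rho> t
      unfolding Q_const[of "\<lambda>j. \<rho> j + C j None" t, symmetric] by (simp add: Q_def)
    then show "coef (row x \<rho> t C) fD = coef (row x (\<lambda>_. 0) 0 C) fD"
      by simp
  qed
  have r: "homog (M - {#x#}) (K - 1) r"
    using homog_sub_linear[OF dec(3) x homog.one] by (simp add: r_def)
  have r_notin: "x \<notin># M - {#x#}"
    using f(2) by (rule multilinear_notin)
  have coef_fD: "coef (pull x b C) fD = coef C r" for b C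
    unfolding fD coef_var_mult[OF r] by (rule coef_pull_notin[OF r r_notin])
  have "sub x h fD = h * r" for h
    unfolding fD using sub_id[OF r r_notin] by simp
  moreover have "sub x h (fA a) = h * R a" if "a \<in># M" "a \<noteq> x" for h a
    unfolding fA[OF that] using sub_id[OF R[OF that] R_notin] by simp
  ultimately have "f = free.D (free_var x) * r
      + (\<Sum>a\<in>set_mset M - {x}. free.angle (free_var x) (free_var a) * R a)"
    using dec(1) by (simp add: r0)
  moreover have "coef C f = C x None * coef C r + (\<Sum>a\<in>set_mset M - {x}. 2 * skew C x a * coef C (R a))"
    for C
    using coef_f[of C] by (simp add: r0 coef_fD coef_R)
  ultimately show ?thesis
    using that r R by blast
qed

text \<open>Expansion along \<open>x\<close>, as for a Pfaffian. The cofactors \<open>r\<close> and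
  \<open>R a\<close> are again additive: for row \<open>x\<close> a unit vector, the coefficient of
  \<open>f\<close> is a nonzero constant times that of a single cofactor.\<close>

theorem row_additive_imp_angle_D:
  fixes f :: "('k::field_char_0, 'v) free_jb"
  assumes "homog M K f" "multilinear M" "row_additive M f"
  shows "angle_D M f"
  using assms
proof (induction "size M" arbitrary: M K f rule: less_induct)
  case less
  show ?case
  proof (cases "M = {#}")
    case True
    then show ?thesis
      using homog_empty_const less.prems(1) angle_D.const by metis
  next
    case False
    then obtain x where x: "x \<in># M"
      by auto
    obtain r R where f: "f = free.D (free_var x) * r
        + (\<Sum>a\<in>set_mset M - {x}. free.angle (free_var x) (free_var a) * R a)"
      and r: "homog (M - {#x#}) (K - 1) r"
      and R: "\<And>a. a \<in># M \<Longrightarrow> a \<noteq> x \<Longrightarrow> homog (M - {#a#} - {#x#}) (K - 1) (R a)"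
      and coef_f: "\<And>C. coef C f = C x None * coef C r
        + (\<Sum>a\<in>set_mset M - {x}. 2 * skew C x a * coef C (R a))"
      by (rule row_additive_expand[OF less.prems x], rule that)
    have "angle_D (M - {#x#}) r"
    proof (rule less.hyps[OF _ r multilinear_diff[OF less.prems(2)]])
      show "size (M - {#x#}) < size M"
        using x by (rule size_Diff1_less)
      have xr: "x \<notin># M - {#x#}"
        using less.prems(2) by (rule multilinear_notin)
      \<comment> \<open>Row \<open>x\<close> has the value 1 against \<open>e\<close> and zeros
        elsewhere, which isolates \<open>r\<close>. Resetting \<rho> at \<open>x\<close> to 0
        prevents row \<open>y\<close> from changing row \<open>x\<close>.\<close>
      have "coef (row y \<rho> t C) r = coef (row y (\<rho>(x := 0)) t (row x (\<lambda>_. 0) 1 C)) f"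
        if "y \<in># M - {#x#}" for y \<rho> t and C :: "'v \<Rightarrow> 'v option \<Rightarrow> 'k"
      proof -
        have yx: "y \<noteq> x"
          using that xr by auto
        have "coef (row y (\<rho>(x := 0)) t (row x (\<lambda>_. 0) 1 C)) f = coef (row y (\<rho>(x := 0)) t (row x (\<lambda>_. 0) 1 C)) r"
          unfolding coef_f using yx
          by (simp, intro sum.neutral) (auto simp: skew_row)
        also have "\<dots> = coef (row y \<rho> t C) r"
          by (rule coef_cong[OF r]) (use yx xr in \<open>auto simp: skew_row\<close>)
        finally show ?thesis ..
      qed
      note eq = this
      show "row_additive (M - {#x#}) r"
        unfolding row_additive_def
      proof (intro allI impI)
        fix y \<rho>1 \<rho>2 t1 t2 and C :: "'v \<Rightarrow> 'v option \<Rightarrow> 'k"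
        assume y: "y \<in># M - {#x#}"
        show "coef (row y (\<lambda>j. \<rho>1 j + \<rho>2 j) (t1 + t2) C) r
            = coef (row y \<rho>1 t1 C) r + coef (row y \<rho>2 t2 C) r"
          unfolding eq[OF y] using y
          by (intro row_additiveD[OF less.prems(3)]) (auto dest: in_diffD)
      qed
    qed
    then have "angle_D M (free.D (free_var x) * r)"
      using angle_D.D[of "M - {#x#}" r x] x by simp
    moreover have "angle_D M (free.angle (free_var x) (free_var a) * R a)" if "a \<in> set_mset M - {x}" for a
    proof -
      from that have a: "a \<in># M" "a \<noteq> x"
        by auto
      have xa: "x \<in># M - {#a#}"
        using a x by (simp add: in_diff_count)
      have notin: "x \<notin># M - {#a#} - {#x#}" "a \<notin># M - {#a#} - {#x#}"
        using multilinear_notin[OF multilinear_diff[OF less.prems(2)], of x "{#a#}"]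
          in_diffD[of a "M - {#a#}" "{#x#}"] multilinear_notin[OF less.prems(2), of a] by argo+
      have "angle_D (M - {#a#} - {#x#}) (R a)"
      proof (rule less.hyps[OF _ R[OF a] multilinear_diff[OF multilinear_diff[OF less.prems(2)]]])
        show "size (M - {#a#} - {#x#}) < size M"
          using xa a(1) size_Diff1_less less_trans by metis
        define \<delta> where "\<delta> = (\<lambda>j. if j = a then 1 else 0 :: 'k)"
        have eq: "2 * coef (row y \<rho> t C) (R a) = coef (row y (\<rho>(x := 0)) t (row x \<delta> 0 C)) f"
          if "y \<in># M - {#a#} - {#x#}" for y \<rho> t and C :: "'v \<Rightarrow> 'v option \<Rightarrow> 'k"
        proof -
          have yx: "y \<noteq> x" "y \<noteq> a"
            using that notin by auto
          let ?C = "row y (\<rho>(x := 0)) t (row x \<delta> 0 C)"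
          have "(\<Sum>b\<in>set_mset M - {x}. 2 * skew ?C x b * coef ?C (R b))
              = (\<Sum>b\<in>set_mset M - {x}. if b = a then 2 * coef ?C (R b) else 0)"
            by (rule sum.cong) (use yx in \<open>auto simp: \<delta>_def skew_row\<close>)
          also have "\<dots> = 2 * coef ?C (R a)"
            using a by simp
          also have "coef ?C (R a) = coef (row y \<rho> t C) (R a)"
            by (rule coef_cong[OF R[OF a]]) (use yx notin in \<open>auto simp: skew_row\<close>)
          finally have sum: "(\<Sum>b\<in>set_mset M - {x}. 2 * skew ?C x b * coef ?C (R b))
              = 2 * coef (row y \<rho> t C) (R a)" .
          show ?thesis
            unfolding coef_f[of ?C] sum using yx by simp
        qed
        have half: "c = d + e" if "2 * c = 2 * d + 2 * e" for c d e :: 'k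
        proof -
          have "2 * c = 2 * (d + e)"
            unfolding that by (rule distrib_left[symmetric])
          then show ?thesis
            by (simp del: distrib_left_numeral)
        qed
        show "row_additive (M - {#a#} - {#x#}) (R a)"
          unfolding row_additive_def
        proof (intro allI impI)
          fix y \<rho>1 \<rho>2 t1 t2 and C :: "'v \<Rightarrow> 'v option \<Rightarrow> 'k"
          assume y: "y \<in># M - {#a#} - {#x#}"
          have "2 * coef (row y (\<lambda>j. \<rho>1 j + \<rho>2 j) (t1 + t2) C) (R a)
              = 2 * coef (row y \<rho>1 t1 C) (R a) + 2 * coef (row y \<rho>2 t2 C) (R a)"
            unfolding eq[OF y] using y
            by (intro row_additiveD[OF less.prems(3)]) (auto dest: in_diffD)
          then show "coef (row y (\<lambda>j. \<rho>1 j + \<rho>2 j) (t1 + t2) C) (R a)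
              = coef (row y \<rho>1 t1 C) (R a) + coef (row y \<rho>2 t2 C) (R a)"
            by (rule half)
        qed
      qed
      from angle_D.angle[OF this, of x a] show ?thesis
        by (simp only: insert_DiffM[OF xa] insert_DiffM[OF a(1)] add_mset_commute[of x a])
    qed
    ultimately show ?thesis
      unfolding f by (intro angle_D.add angle_D_sum)
  qed
qed

section \<open>Linearization\<close>

lemma (in vector_space) span_UN_subspaces:
  assumes "x \<in> span (\<Union>i\<in>J. S i)" "\<And>i. subspace (S i)"
  obtains A g where "finite A" "A \<subseteq> J" "\<And>i. g i \<in> S i" "x = (\<Sum>i\<in>A. g i)"
proof -
  have "\<exists>A g. finite A \<and> A \<subseteq> J \<and> (\<forall>i. g i \<in> S i) \<and> x = (\<Sum>i\<in>A. g i)"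
    using assms(1)
  proof (induction rule: span_induct_alt)
    case base
    show ?case
      using subspace_0[OF assms(2)] by (intro exI[of _ "{}"] exI[of _ "\<lambda>_. 0"]) simp
  next
    case (step c y z)
    then obtain A g i where A: "finite A" "A \<subseteq> J" "\<forall>i. g i \<in> S i" "z = (\<Sum>i\<in>A. g i)"
      and i: "i \<in> J" "y \<in> S i"
      by blast
    define h where "h j = (if j \<in> A then g j else 0) + (if j = i then scale c y else 0)" for j
    have "h j \<in> S j" for j
      unfolding h_def using A(3) i(2) subspace_0[OF assms(2)]
      by (intro subspace_add[OF assms(2)]) (auto intro: subspace_scale[OF assms(2)])
    moreover have "(\<Sum>j\<in>insert i A. h j) = scale c y + z"
      using A(1) by (auto simp: h_def sum.distrib A(4) add.commute intro!: sum.mono_neutral_cong_right)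
    ultimately show ?case
      using A(1,2) i(1) by (intro exI[of _ "insert i A"] exI[of _ h]) auto
  qed
  then show ?thesis
    using that by blast
qed

lemma (in vector_space) span_bilinear:
  assumes "\<And>x y. x \<in> A \<Longrightarrow> y \<in> B \<Longrightarrow> b x y \<in> span C"
    and "\<And>x y z. b (x + y) z = b x z + b y z" "\<And>c x z. b (scale c x) z = scale c (b x z)"
    and "\<And>x y z. b z (x + y) = b z x + b z y" "\<And>c x z. b z (scale c x) = scale c (b z x)"
    and "x \<in> span A" "y \<in> span B"
  shows "b x y \<in> span C"
proof -
  have zero: "b 0 z = 0" "b z 0 = 0" for z
    using assms(3)[of 0 0 z] assms(5)[of z 0 0] by simp_all
  have base: "b x z \<in> span C" if "x \<in> A" "z \<in> span B" for x z
    using that(2)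
    by (induction rule: span_induct_alt)
      (use that(1) assms(1) in \<open>auto simp: zero assms(4,5) intro: span_zero span_add span_scale\<close>)
  show ?thesis
    using assms(6)
    by (induction rule: span_induct_alt)
      (use assms(7) base in \<open>auto simp: zero assms(2,3) intro: span_zero span_add span_scale\<close>)
qed

section \<open>Spans of homogeneous elements of given degree or multidegree\<close>

definition degree_span :: "nat set \<Rightarrow> ('k::field_char_0, 'v) free_jb set" where
  "degree_span S = free.span {f. \<exists>M K. size M \<in> S \<and> homog M K f}"

text \<open>All numbers of brackets are taken together, because scaling the variables distinguishes
  multidegrees only.\<close>

definition multidegree_span :: "'v multiset \<Rightarrow> ('k::field_char_0, 'v) free_jb set" where
  "multidegree_span M = free.span (\<Union>K. {f. homog M K f})"

lemma homog_imp_degree_span: "homog M K f \<Longrightarrow> size M \<in> S \<Longrightarrow> f \<in> degree_span S"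
  unfolding degree_span_def by (rule free.span_base) blast

lemma degree_span_D: "f \<in> degree_span S \<Longrightarrow> free.D f \<in> degree_span S"
  unfolding degree_span_def
proof (induction rule: free.span_induct_alt)
  case (step c f g)
  then have "free.D f \<in> free.span {f. \<exists>M K. size M \<in> S \<and> homog M K f}"
    by (intro free.span_base) (blast intro: homog.D)
  then show ?case
    using step.IH by (simp add: free.D_add free.D_scale free.span_add free.span_scale)
qed (simp add: free.span_zero)

lemma degree_span_mult:
  assumes "f \<in> degree_span S" "g \<in> degree_span T" "\<And>d e. d \<in> S \<Longrightarrow> e \<in> T \<Longrightarrow> d + e \<in> U"
  shows "f * g \<in> degree_span U"
  unfolding degree_span_def
proof (rule free.span_bilinear[OF _ _ _ _ _ assms(1,2)[unfolded degree_span_def]])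
  fix f g :: "('a, 'b) free_jb"
  assume "f \<in> {f. \<exists>M K. size M \<in> S \<and> homog M K f}" "g \<in> {f. \<exists>M K. size M \<in> T \<and> homog M K f}"
  then obtain M K N L where "size M \<in> S" "homog M K f" "size N \<in> T" "homog N L g"
    by blast
  then show "f * g \<in> free.span {f. \<exists>M K. size M \<in> U \<and> homog M K f}"
    using homog.mult[of M K f N L g] assms(3)[of "size M" "size N"]
    by (intro free.span_base) (metis (mono_tags, lifting) mem_Collect_eq size_union)
qed (simp_all add: algebra_simps free.scale_mult_left free.scale_mult_right)

lemma degree_span_angle:
  assumes "f \<in> degree_span S" "g \<in> degree_span T" "\<And>d e. d \<in> S \<Longrightarrow> e \<in> T \<Longrightarrow> d + e \<in> U"
  shows "free.angle f g \<in> degree_span U"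
  unfolding degree_span_def
proof (rule free.span_bilinear[OF _ _ _ _ _ assms(1,2)[unfolded degree_span_def]])
  fix f g :: "('a, 'b) free_jb"
  assume "f \<in> {f. \<exists>M K. size M \<in> S \<and> homog M K f}" "g \<in> {f. \<exists>M K. size M \<in> T \<and> homog M K f}"
  then obtain M K N L where "size M \<in> S" "homog M K f" "size N \<in> T" "homog N L g"
    by blast
  then show "free.angle f g \<in> free.span {f. \<exists>M K. size M \<in> U \<and> homog M K f}"
    using homog.angle[of M K f N L g] assms(3)[of "size M" "size N"]
    by (intro free.span_base) (metis (mono_tags, lifting) mem_Collect_eq size_union)
qed (simp_all add: free.angle_add_left free.angle_add_right free.angle_scale_left
    free.angle_scale_right)

lemmas degree_span_add = free.span_add[of _ "{f. \<exists>M K. size M \<in> S \<and> homog M K f}" for S,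
    folded degree_span_def]
lemmas degree_span_diff = free.span_diff[of _ "{f. \<exists>M K. size M \<in> S \<and> homog M K f}" for S,
    folded degree_span_def]
lemmas degree_span_scale = free.span_scale[of _ "{f. \<exists>M K. size M \<in> S \<and> homog M K f}" for S,
    folded degree_span_def]
lemmas degree_span_zero = free.span_zero[of "{f. \<exists>M K. size M \<in> S \<and> homog M K f}" for S,
    folded degree_span_def]

lemma degree_span_UNIV: "f \<in> degree_span UNIV"
proof (induction f rule: free_jb_induct)
  case (var v)
  show ?case by (rule homog_imp_degree_span[OF homog.var]) simp
next
  case one
  show ?case by (rule homog_imp_degree_span[OF homog.one]) simp
next
  case (minus f)
  then show ?case using degree_span_scale[of f UNIV "- 1"] by (simp add: free_scale_minus_one)
next
  case (mult f g)
  then show ?case by (rule degree_span_mult) simp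
next
  case (bracket f g)
  have "free.angle f g \<in> degree_span UNIV" "free.D f * g \<in> degree_span UNIV"
    "f * free.D g \<in> degree_span UNIV"
    using bracket by (auto intro: degree_span_angle degree_span_mult degree_span_D)
  then have "free.angle f g + (free.D f * g - f * free.D g) \<in> degree_span UNIV"
    by (intro degree_span_add degree_span_diff)
  then show ?case
    by (simp add: free.bracket_eq_angle[of f g])
qed (auto intro: degree_span_add degree_span_scale degree_span_zero)

lemma degree_span_eq:
  "(degree_span S :: ('k::field_char_0, 'v) free_jb set)
     = free.span (\<Union>M\<in>{M. size M \<in> S}. multidegree_span M)" (is "?D = free.span ?U")
proof (rule antisym)
  have "{f :: ('k, 'v) free_jb. \<exists>M K. size M \<in> S \<and> homog M K f} \<subseteq> ?U"
  proof
    fix f :: "('k, 'v) free_jb"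
    assume "f \<in> {f. \<exists>M K. size M \<in> S \<and> homog M K f}"
    then obtain M K where M: "size M \<in> S" "homog M K f"
      by blast
    then have "f \<in> multidegree_span M"
      unfolding multidegree_span_def by (intro free.span_base) blast
    then show "f \<in> ?U"
      using M(1) by blast
  qed
  then show "?D \<subseteq> free.span ?U"
    unfolding degree_span_def by (rule free.span_mono)
  have "multidegree_span M \<subseteq> ?D" if "size M \<in> S" for M
    unfolding degree_span_def multidegree_span_def
    by (rule free.span_mono) (use that in blast)
  then have "?U \<subseteq> ?D"
    by blast
  then show "free.span ?U \<subseteq> ?D"
    by (rule free.span_minimal) (simp add: degree_span_def)
qed

lemma eval_degree_span:
  assumes "f \<in> multidegree_span M" "\<And>v. \<sigma> v \<in> degree_span {1}"
  shows "free.eval \<sigma> f \<in> degree_span {size M}"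
proof -
  have hom: "free.eval \<sigma> f \<in> degree_span {size M}" if "homog M K f" for K f
    using that
  proof (induction rule: homog.induct)
    case one
    show ?case using homog_imp_degree_span[OF homog.one, of "{0}"] by simp
  next
    case (mult M K f N L g)
    then show ?case using degree_span_mult by (simp, blast)
  next
    case (angle M K f N L g)
    then show ?case using degree_span_angle by (simp, blast)
  qed (use assms(2) in \<open>auto intro: degree_span_add degree_span_scale degree_span_zero degree_span_D\<close>)
  show ?thesis
    using assms(1) unfolding multidegree_span_def
    by (induction rule: free.span_induct_alt)
      (auto intro: hom degree_span_add degree_span_scale degree_span_zero)
qed

section \<open>Substitution in multihomogeneous elements\<close>

lemma eval_cong_homog:
  "homog M K f \<Longrightarrow> (\<And>v. v \<in># M \<Longrightarrow> \<sigma> v = \<sigma>' v) \<Longrightarrow> free.eval \<sigma> f = free.eval \<sigma>' f"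
  by (induction rule: homog.induct) auto

lemma eval_cong_multidegree:
  assumes "f \<in> multidegree_span M" "\<And>v. v \<in># M \<Longrightarrow> \<sigma> v = \<sigma>' v"
  shows "free.eval \<sigma> f = free.eval \<sigma>' f"
  using assms(1) unfolding multidegree_span_def
  by (induction rule: free.span_induct_alt) (auto intro: eval_cong_homog[OF _ assms(2)])

lemma sub_multidegree_cong:
  assumes "f \<in> multidegree_span M" "\<And>v. v \<in># M \<Longrightarrow> \<sigma> v = free_var v"
  shows "free.eval \<sigma> f = f"
  using eval_cong_multidegree[OF assms] by simp

lemma sub_zero_multidegree:
  assumes "f \<in> multidegree_span M" "x \<in># M"
  shows "sub x 0 f = 0"
proof -
  have hom: "sub x 0 f = 0" if "homog M K f" "x \<in># M" for M K f
    using that by (induction rule: homog.induct) auto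
  show ?thesis
    using assms(1) unfolding multidegree_span_def
    by (induction rule: free.span_induct_alt) (auto simp: hom assms(2))
qed

lemma sub_scale_multidegree:
  assumes "f \<in> multidegree_span M"
  shows "sub x (free_scale r (free_var x)) f = free_scale (r ^ count M x) f"
proof -
  have hom: "sub x (free_scale r (free_var x)) f = free_scale (r ^ count M x) f" if "homog M K f" for M K f
    using that
    by (induction rule: homog.induct)
      (auto simp: free.scale_right_distrib free.scale_mult_left free.scale_mult_right power_add
        free.D_scale free.angle_scale_left free.angle_scale_right mult.commute)
  show ?thesis
    using assms unfolding multidegree_span_def
    by (induction rule: free.span_induct_alt)
      (auto simp: hom free.scale_right_distrib mult.commute)
qed

lemma sub_sub: "sub y g (sub x h f) = free.eval (\<lambda>v. sub y g ((free_var(x := h)) v)) f"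
  by (simp add: sub_def free.eval_eval)

lemma sub_commute:
  assumes "x \<noteq> y" "sub y g h = h" "sub x h g = g"
  shows "sub y g (sub x h f) = sub x h (sub y g f)"
  unfolding sub_sub by (rule arg_cong[where f = "\<lambda>\<sigma>. free.eval \<sigma> f"]) (use assms in auto)

text \<open>Choose \<open>x\<close> whose degree differs in \<open>N\<close> and \<open>M\<close>.
  Substituting \<open>2 x\<close> for \<open>x\<close> and subtracting \<open>2 ^ count N x\<close>
  times the element removes the component \<open>N\<close> and multiplies the component
  \<open>M\<close> by a nonzero scalar. Asking \<open>J\<close> only to be closed under doubling
  admits sets of elements that vanish at y := 0.\<close>

lemma multidegree_components:
  fixes g :: "'v multiset \<Rightarrow> ('k::field_char_0, 'v) free_jb"
  assumes J: "free.subspace J" "\<And>f x. f \<in> J \<Longrightarrow> sub x (free_scale 2 (free_var x)) f \<in> J"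
    and "finite A" "\<And>M. M \<in> A \<Longrightarrow> g M \<in> multidegree_span M" "(\<Sum>M\<in>A. g M) \<in> J" "M \<in> A"
  shows "g M \<in> J"
  using assms(3-)
proof (induction "card A" arbitrary: A g rule: less_induct)
  case less
  show ?case
  proof (cases "A = {M}")
    case True
    then show ?thesis using less.prems(3) by simp
  next
    case False
    then obtain N where N: "N \<in> A" "N \<noteq> M"
      using less.prems(4) by blast
    then obtain x where x: "count N x \<noteq> count M x"
      by (metis multiset_eqI)
    define h where "h L = free_scale (2 ^ count L x - 2 ^ count N x) (g L)" for L
    have "(\<Sum>L\<in>A. h L) = sub x (free_scale 2 (free_var x)) (\<Sum>L\<in>A. g L)
        - free_scale (2 ^ count N x) (\<Sum>L\<in>A. g L)"
      using sub_scale_multidegree[OF less.prems(2)]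
      by (simp add: h_def free.scale_left_diff_distrib sum_subtractf free.scale_sum_right)
    also have "\<dots> \<in> J"
      by (intro free.subspace_diff free.subspace_scale J less.prems)
    also have "(\<Sum>L\<in>A. h L) = (\<Sum>L\<in>A - {N}. h L)"
      using less.prems(1) by (intro sum.mono_neutral_right) (auto simp: h_def)
    finally have sum: "(\<Sum>L\<in>A - {N}. h L) \<in> J" .
    have "h M \<in> J"
    proof (rule less.hyps[OF _ _ _ sum])
      show "card (A - {N}) < card A"
        using less.prems(1) N(1) by (rule card_Diff1_less)
      show "h L \<in> multidegree_span L" if "L \<in> A - {N}" for L
        using less.prems(2)[of L] that unfolding h_def multidegree_span_def
        by (intro free.span_scale) blast
    qed (use less.prems N in auto)
    moreover have "2 ^ count M x - 2 ^ count N x \<noteq> (0::'k)"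
    proof -
      have "(2::nat) ^ count M x \<noteq> 2 ^ count N x"
        using x by simp
      then have "of_nat (2 ^ count M x) \<noteq> (of_nat (2 ^ count N x) :: 'k)"
        by (simp only: of_nat_eq_iff not_False_eq_True)
      then show ?thesis
        by (simp only: of_nat_power of_nat_numeral right_minus_eq not_False_eq_True)
    qed
    moreover have "g M = free_scale (inverse (2 ^ count M x - 2 ^ count N x)) (h M)"
      using calculation(2) by (simp add: h_def)
    ultimately show ?thesis
      by (metis J(1) free.subspace_scale)
  qed
qed

text \<open>The closure properties of the identities of an algebra on which the reduction relies:
  linear combinations, multiples and substitutions.\<close>

definition t_ideal :: "('k::field_char_0, 'v) free_jb set \<Rightarrow> bool" where
  "t_ideal I \<longleftrightarrow> free.subspace I \<and> (\<forall>f g. f \<in> I \<longrightarrow> g * f \<in> I)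
     \<and> (\<forall>f \<sigma>. f \<in> I \<longrightarrow> free.eval \<sigma> f \<in> I)"

lemma t_idealD:
  assumes "t_ideal I"
  shows "free.subspace I" "f \<in> I \<Longrightarrow> g * f \<in> I" "f \<in> I \<Longrightarrow> free.eval \<sigma> f \<in> I"
    "f \<in> I \<Longrightarrow> sub x h f \<in> I"
  using assms by (auto simp: t_ideal_def sub_def)

text \<open>Extremal form of linearization: among nonzero multihomogeneous elements of fixed degree,
  take one with the most distinct variables, a number bounded by the degree. If \<open>x\<close>
  occurred twice, f(x + z) - f(x) - f(z) would have a nonzero component that contains all variables
  of \<open>f\<close> and also \<open>z\<close>.\<close>

lemma t_ideal_multilinear:
  fixes I :: "('k::field_char_0, nat) free_jb set"
  assumes I: "t_ideal I" and f0: "f0 \<in> I" "f0 \<noteq> 0"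
  obtains M f where "multilinear M" "f \<in> I" "f \<noteq> 0" "f \<in> multidegree_span M"
proof -
  note subspace = t_idealD(1)[OF I] and sub_I = t_idealD(4)[OF I]
  have msubspace: "free.subspace (multidegree_span M)" for M :: "nat multiset"
    unfolding multidegree_span_def by (rule free.subspace_span)
  have "f0 \<in> free.span (\<Union>M\<in>{M. size M \<in> UNIV}. multidegree_span M)"
    using degree_span_UNIV degree_span_eq by blast
  then obtain A g where A: "finite A" "\<And>M. g M \<in> multidegree_span M" "f0 = (\<Sum>M\<in>A. g M)"
    by (rule free.span_UN_subspaces[OF _ msubspace]) (rule that)
  then obtain M0 where M0: "M0 \<in> A" "g M0 \<noteq> 0"
    using f0(2) by (metis sum.neutral)
  have "g M0 \<in> I"
    using multidegree_components[OF subspace sub_I A(1,2) _ M0(1)] f0(1) A(3) by blast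
  define P where "P M \<longleftrightarrow> size M = size M0 \<and> (\<exists>f\<in>I. f \<noteq> 0 \<and> f \<in> multidegree_span M)" for M
  have "P M0"
    unfolding P_def using \<open>g M0 \<in> I\<close> M0(2) A(2) by blast
  moreover have "card (set_mset M) < Suc (size M0)" if "P M" for M
  proof -
    have "card (set_mset M) = (\<Sum>x\<in>set_mset M. 1)"
      by simp
    also have "\<dots> \<le> (\<Sum>x\<in>set_mset M. count M x)"
      by (rule sum_mono) (simp add: Suc_le_eq)
    finally show ?thesis
      using that by (simp add: P_def size_multiset_overloaded_eq)
  qed
  ultimately obtain M where "P M" and max: "\<And>N. P N \<Longrightarrow> card (set_mset N) \<le> card (set_mset M)"
    using ex_has_greatest_nat[of P M0 "\<lambda>M. card (set_mset M)" "Suc (size M0)"] by metis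
  then obtain f where f: "f \<in> I" "f \<noteq> 0" "f \<in> multidegree_span M" and size: "size M = size M0"
    unfolding P_def by blast
  have "multilinear M"
    unfolding multilinear_def
  proof (rule ccontr)
    assume "\<not> (\<forall>v. count M v \<le> 1)"
    then obtain x where x: "count M x \<ge> 2"
      by (metis Suc_1 not_less_eq_eq)
    then have xM: "x \<in># M"
      by (simp flip: count_greater_zero_iff)
    obtain z where z: "z \<notin># M"
      using ex_new_if_finite[OF infinite_UNIV_nat finite_set_mset] by blast
    with xM have xz: "x \<noteq> z"
      by auto
    let ?x = "free_var x :: ('k, nat) free_jb" and ?z = "free_var z :: ('k, nat) free_jb"
    define \<Delta> where "\<Delta> = sub x (?x + ?z) f - f - sub x ?z f"
    have cong: "free.eval \<sigma> f = free.eval \<sigma>' f" if "\<And>v. v \<noteq> z \<Longrightarrow> \<sigma> v = \<sigma>' v"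
      for \<sigma> \<sigma>' :: "nat \<Rightarrow> ('k, nat) free_jb"
      by (rule eval_cong_multidegree[OF f(3)], rule that) (use z in auto)
    have sub_f: "sub x ?x f = f"
      by (simp add: sub_def)
    have sub_z: "sub z h (sub x g f) = sub x (sub z h g) f" for g h
      unfolding sub_sub sub_def[of x "sub z h g"] by (rule cong) simp
    have sub_z': "sub z h f = f" for h
      using sub_z[of h ?x] xz by (simp add: sub_f)
    \<comment> \<open>Vanishing under y := 0 passes to the multihomogeneous components, and a
      nonzero component with this property must contain \<open>y\<close>.\<close>
    define J where "J = {g \<in> I. \<forall>y\<in>insert z (set_mset M). sub y 0 g = 0}"
    have "free.subspace J"
      using subspace unfolding J_def free.subspace_def by auto
    moreover have "sub w (free_scale 2 (free_var w)) g \<in> J" if "g \<in> J" for g w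
    proof -
      have "sub y 0 (sub w (free_scale 2 (free_var w)) g) = 0" if "sub y 0 g = 0" for y
      proof (cases "w = y")
        case True
        have "sub y 0 (sub y (free_scale 2 (free_var y)) g) = free.eval (free_var(y := 0)) g"
          unfolding sub_sub by (rule arg_cong[where f = "\<lambda>\<sigma>. free.eval \<sigma> g"]) auto
        then show ?thesis using True that by (simp add: sub_def)
      next
        case False
        then show ?thesis using that by (subst sub_commute) auto
      qed
      then show ?thesis
        using that sub_I by (auto simp: J_def)
    qed
    moreover have "\<Delta> \<in> J"
    proof -
      have "\<Delta> \<in> I"
        unfolding \<Delta>_def using f(1) subspace sub_I by (intro free.subspace_diff) auto
      moreover have "sub z 0 \<Delta> = 0"
        unfolding \<Delta>_def using xz by (simp add: sub_z sub_z' sub_f sub_zero_multidegree[OF f(3) xM])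
      moreover have "sub x 0 \<Delta> = 0"
      proof -
        have "sub x 0 (sub x (?x + ?z) f) = free.eval (free_var(x := ?z)) f"
          "sub x 0 (sub x ?z f) = free.eval (free_var(x := ?z)) f"
          unfolding sub_sub using xz by (auto intro!: arg_cong[where f = "\<lambda>\<sigma>. free.eval \<sigma> f"])
        then show ?thesis
          by (simp add: \<Delta>_def sub_zero_multidegree[OF f(3) xM])
      qed
      moreover have "sub y 0 \<Delta> = 0" if "y \<in># M" "y \<noteq> x" for y
      proof -
        have "sub y 0 (sub x h f) = 0" if "sub y 0 h = h" for h
          using \<open>y \<noteq> x\<close> that sub_zero_multidegree[OF f(3) \<open>y \<in># M\<close>] by (subst sub_commute) auto
        moreover have "y \<noteq> z" "x \<noteq> y" "z \<noteq> y"
          using that z by auto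
        ultimately show ?thesis
          using sub_zero_multidegree[OF f(3) that(1)] by (simp add: \<Delta>_def)
      qed
      ultimately show ?thesis
        unfolding J_def by auto
    qed
    moreover have "\<Delta> \<noteq> 0"
    proof
      \<comment> \<open>At z := x the linearization becomes \<open>2 ^ count M x - 2\<close> times
        \<open>f\<close>, and \<open>count M x\<close> is at least 2.\<close>
      assume "\<Delta> = 0"
      have "?x + ?x = free_scale 2 ?x"
        using free.scale_left_distrib[of 1 1 ?x] by simp
      then have "sub z ?x \<Delta> = free_scale (2 ^ count M x) f - f - f"
        unfolding \<Delta>_def using xz sub_scale_multidegree[OF f(3), of x 2]
        by (simp add: sub_z sub_z' sub_f)
      also have "\<dots> = free_scale (2 ^ count M x - 1 - 1) f"
        by (simp only: free.scale_left_diff_distrib free.scale_one)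
      finally have "(2::'k) ^ count M x - 1 - 1 = 0"
        using \<open>\<Delta> = 0\<close> f(2) by simp
      then have "of_nat (2 ^ count M x) = (of_nat 2 :: 'k)"
        by simp
      then have "(2::nat) ^ count M x = 2 ^ 1"
        by (simp only: of_nat_eq_iff power_one_right)
      then show False
        using x by (simp only: power_inject_exp)
    qed
    moreover have "\<Delta> \<in> degree_span {size M}"
    proof -
      have var: "free_var v \<in> degree_span {1}" for v :: nat
        by (rule homog_imp_degree_span[OF homog.var]) simp
      have "sub x h f \<in> degree_span {size M}" if "h \<in> degree_span {1}" for h
        unfolding sub_def by (rule eval_degree_span[OF f(3)]) (use that var in auto)
      from this[OF degree_span_add[OF var var]] this[OF var] this[OF var, of x] show ?thesis
        unfolding \<Delta>_def sub_f by (intro degree_span_diff)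
    qed
    then obtain B h where B: "finite B" "B \<subseteq> {N. size N \<in> {size M}}"
      "\<And>N. h N \<in> multidegree_span N" "\<Delta> = (\<Sum>N\<in>B. h N)"
      unfolding degree_span_eq by (rule free.span_UN_subspaces[OF _ msubspace]) (rule that)
    ultimately obtain N where N: "N \<in> B" "h N \<noteq> 0" "h N \<in> J"
      using multidegree_components[of J B h] by (metis sum.neutral)
    have "insert z (set_mset M) \<subseteq> set_mset N"
    proof
      fix y
      assume y: "y \<in> insert z (set_mset M)"
      show "y \<in># N"
      proof (rule ccontr)
        assume "y \<notin># N"
        then have "sub y 0 (h N) = h N"
          unfolding sub_def by (intro sub_multidegree_cong[OF B(3)]) auto
        then show False
          using N y by (auto simp: J_def)
      qed
    qed
    then have "card (insert z (set_mset M)) \<le> card (set_mset N)"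
      by (rule card_mono[OF finite_set_mset])
    moreover have "P N"
      unfolding P_def using N B(2,3) size by (auto simp: J_def)
    ultimately show False
      using max[of N] z by simp
  qed
  then show ?thesis
    using that f by blast
qed

section \<open>Coefficients depend on few rows at a time\<close>

abbreviation zero_row :: "'v \<Rightarrow> ('v \<Rightarrow> 'v option \<Rightarrow> 'k) \<Rightarrow> 'v \<Rightarrow> 'v option \<Rightarrow> 'k::zero" where
  "zero_row x \<equiv> row x (\<lambda>_. 0) 0"

lemma zero_row_commute: "zero_row x (zero_row y C) = zero_row y (zero_row x C)"
  by (auto simp: row_def fun_eq_iff split: option.splits)

text \<open>Expresses that every monomial involves at most \<open>n\<close> variables, without a
  ring of polynomials: the function is a sum of functions, each of which ignores all rows outside a
  set of at most \<open>n\<close>.\<close>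

inductive few_rows :: "nat \<Rightarrow> (('v \<Rightarrow> 'v option \<Rightarrow> 'k::field_char_0) \<Rightarrow> 'k) \<Rightarrow> bool" where
  base: "finite U \<Longrightarrow> card U \<le> n \<Longrightarrow> (\<And>x C. x \<notin> U \<Longrightarrow> \<phi> (zero_row x C) = \<phi> C) \<Longrightarrow> few_rows n \<phi>"
| add: "few_rows n \<phi> \<Longrightarrow> few_rows n \<psi> \<Longrightarrow> few_rows n (\<lambda>C. \<phi> C + \<psi> C)"

lemma few_rows_const: "few_rows n (\<lambda>_. c)"
  by (rule few_rows.base[of "{}"]) simp_all

lemma few_rows_mono: "few_rows n \<phi> \<Longrightarrow> n \<le> m \<Longrightarrow> few_rows m \<phi>"
proof (induction rule: few_rows.induct)
  case (base U n \<phi>)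
  then show ?case by (intro few_rows.base[of U]) auto
qed (auto intro: few_rows.add)

lemma few_rows_mult:
  assumes "few_rows n \<phi>" "few_rows m \<psi>"
  shows "few_rows (n + m) (\<lambda>C. \<phi> C * \<psi> C)"
  using assms(1)
proof (induction rule: few_rows.induct)
  case phi: (base U n \<phi>)
  from assms(2) show ?case
  proof (induction rule: few_rows.induct)
    case (base W m \<psi>)
    show ?case
      by (rule few_rows.base[of "U \<union> W"])
        (use phi base in \<open>auto intro: order_trans[OF card_Un_le]\<close>)
  next
    case (add m \<psi> \<psi>')
    then show ?case by (simp add: distrib_left few_rows.add)
  qed
next
  case (add n \<phi> \<phi>')
  then show ?case by (simp add: distrib_right few_rows.add)
qed

lemma few_rows_cmult: "few_rows n \<phi> \<Longrightarrow> few_rows n (\<lambda>C. c * \<phi> C)"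
  using few_rows_mult[OF few_rows_const[of 0 c]] by fastforce

lemma few_rows_tau: "few_rows 1 (\<lambda>C. tau C M)"
proof (induction M)
  case empty
  show ?case by (simp add: few_rows_const)
next
  case (add v M)
  have "few_rows 1 (\<lambda>C. C v None)"
    by (rule few_rows.base[of "{v}"]) auto
  from few_rows.add[OF this add] show ?case by simp
qed

lemma few_rows_form: "few_rows 2 (\<lambda>C. form C a b)"
proof -
  have skew: "few_rows 2 (\<lambda>C. skew C v w)" for v w :: 'a
    by (rule few_rows.base[of "{v, w}"]) (auto simp: skew_row card_insert_if)
  have inner: "few_rows 2 (\<lambda>C. \<Sum>w\<in>#N. skew C v w)" for v :: 'a and N
  proof (induction N)
    case (add w N)
    from few_rows.add[OF skew add] show ?case by simp
  qed (simp add: few_rows_const)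
  have "few_rows 2 (\<lambda>C. \<Sum>v\<in>#M. \<Sum>w\<in>#N. skew C v w)" for M N :: "'a multiset"
  proof (induction M)
    case (add v M)
    from few_rows.add[OF inner add] show ?case by simp
  qed (simp add: few_rows_const)
  then have "few_rows 2 (\<lambda>C. (\<Sum>v\<in>#fst a. \<Sum>w\<in>#fst b. skew C v w)
      + of_nat (snd b) * tau C (fst a) + (- of_nat (snd a)) * tau C (fst b))"
    by (intro few_rows.add few_rows_cmult few_rows_mono[OF few_rows_tau]) auto
  then show ?thesis
    by (simp add: form_def)
qed

text \<open>Each summand of the factor contributed by a \<open>D\<close> involves one row, and by an
  \<open>angle\<close> at most two; hence two rows for each bracket.\<close>

lemma few_rows_coef: "homog M K f \<Longrightarrow> few_rows (2 * K) (\<lambda>C. coef C f)"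
proof (induction rule: homog.induct)
  case (add M K f g)
  then show ?case by (simp add: coef_add[OF add(1,2)] few_rows.add)
next
  case (scale M K f r)
  then show ?case by (simp add: coef_scale[OF scale(1)] few_rows_cmult)
next
  case (mult M K f N L g)
  then show ?case using few_rows_mult by (fastforce simp: coef_mult[OF mult(1,2)])
next
  case (D M K f)
  have "few_rows (1 + 2 * K) (\<lambda>C. tau C M * coef C f)"
    by (rule few_rows_mult[OF few_rows_tau D.IH])
  then show ?case
    unfolding coef_D[OF D(1)] by (rule few_rows_mono) simp
next
  case (angle M K f N L g)
  have "few_rows (2 + (2 * K + 2 * L)) (\<lambda>C. 2 * form C (M, K) (N, L) * (coef C f * coef C g))"
    by (intro few_rows_mult few_rows_cmult few_rows_form angle.IH)
  then show ?case
    unfolding coef_angle[OF angle(1,2)] by (rule few_rows_mono) simp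
qed (simp_all add: few_rows_const)

text \<open>Iterated differences. Expanded, this is the alternating sum, over the sublists of the
  given list, of the function with the rows in the sublist cleared.\<close>

primrec alternate :: "'v list \<Rightarrow> (('v \<Rightarrow> 'v option \<Rightarrow> 'k) \<Rightarrow> 'k) \<Rightarrow> ('v \<Rightarrow> 'v option \<Rightarrow> 'k) \<Rightarrow> 'k::field_char_0" where
  "alternate [] \<phi> = \<phi>"
| "alternate (x # xs) \<phi> = alternate xs (\<lambda>C. \<phi> C - \<phi> (zero_row x C))"

lemma alternate_id:
  "(\<And>x C. x \<in> set xs \<Longrightarrow> \<phi> (zero_row x C) = 0) \<Longrightarrow> alternate xs \<phi> = \<phi>"
proof (induction xs arbitrary: \<phi>)
  case (Cons x xs)
  then have "(\<lambda>C. \<phi> C - \<phi> (zero_row x C)) = \<phi>"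
    by simp
  then show ?case using Cons by simp
qed simp

lemma alternate_zero: "alternate xs (\<lambda>_. 0) = (\<lambda>_. 0)"
  by (induction xs) simp_all

lemma alternate_eq_zero:
  "x \<in> set xs \<Longrightarrow> (\<And>C. \<phi> (zero_row x C) = \<phi> C) \<Longrightarrow> alternate xs \<phi> = (\<lambda>_. 0)"
proof (induction xs arbitrary: \<phi>)
  case (Cons y xs)
  show ?case
  proof (cases "x = y")
    case True
    then show ?thesis using Cons.prems(2) by (simp add: alternate_zero)
  next
    case False
    then show ?thesis
      using Cons.prems by (simp add: Cons.IH zero_row_commute[of y x])
  qed
qed simp

lemma alternate_add: "alternate xs (\<lambda>C. \<phi> C + \<psi> C) = (\<lambda>C. alternate xs \<phi> C + alternate xs \<psi> C)"
proof (induction xs arbitrary: \<phi> \<psi>)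
  case (Cons x xs)
  have "(\<lambda>C. \<phi> C + \<psi> C - (\<phi> (zero_row x C) + \<psi> (zero_row x C)))
      = (\<lambda>C. (\<phi> C - \<phi> (zero_row x C)) + (\<psi> C - \<psi> (zero_row x C)))"
    by (simp add: algebra_simps)
  then show ?case using Cons by simp
qed simp

text \<open>Inclusion-exclusion: the alternating sum over all sets of rows kills each summand that misses
  one of the rows, but fixes a function that vanishes as soon as one row does.\<close>

lemma few_rows_eq_zero:
  assumes "few_rows n \<phi>" "finite V" "n < card V" "\<And>x C. x \<in> V \<Longrightarrow> \<phi> (zero_row x C) = 0"
  shows "\<phi> C = 0"
proof -
  obtain xs where xs: "set xs = V"
    using assms(2) finite_list by blast
  have "alternate xs \<phi> = (\<lambda>_. 0)"
    using assms(1,3)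
  proof (induction rule: few_rows.induct)
    case (base U n \<phi>)
    then obtain x where "x \<in> V" "x \<notin> U"
      by (metis card_mono le_trans not_le subsetI)
    then show ?case
      using base(3) by (intro alternate_eq_zero[of x]) (auto simp: xs)
  next
    case (add n \<phi> \<psi>)
    then show ?case by (simp add: alternate_add)
  qed
  moreover have "alternate xs \<phi> = \<phi>"
    using assms(4) by (intro alternate_id) (simp add: xs)
  ultimately show ?thesis
    by simp
qed


section \<open>Reduction to additive coefficients\<close>

text \<open>1 has weight zero, on which the form vanishes; this turns clearing a row into a
  substitution.\<close>

lemma coef_sub_one:
  assumes "homog M K f" "count M x = 1"
  shows "coef C (sub x 1 f) = coef (zero_row x C) f"
proof -
  have "coef (pull x ({#}, 0) C) f = coef (zero_row x C) f"
    by (rule coef_cong_row[OF assms(1), where x = x])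
      (auto simp: skew_pull_left skew_pull_other pull_None skew_row)
  then show ?thesis
    using coef_sub_linear[OF assms homog.one, of C] by simp
qed

definition leibniz_defect :: "'v \<Rightarrow> 'v \<Rightarrow> ('k::field_char_0, 'v) free_jb \<Rightarrow> ('k, 'v) free_jb" where
  "leibniz_defect x z f = sub x (free_var x * free_var z) f - free_var z * f
     - free_var x * sub x (free_var z) f"

lemma homog_sub_var:
  assumes "homog M K f" "count M x = 1"
  shows "homog (add_mset z (M - {#x#})) K (sub x (free_var z) f)"
  using homog_sub_linear[OF assms homog.var[of z]] by simp

lemma homog_sub_mult_var:
  assumes "homog M K f" "count M x = 1"
  shows "homog (add_mset z M) K (sub x (free_var x * free_var z) f)"
proof -
  have "x \<in># M"
    using assms(2) by (simp flip: count_greater_zero_iff)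
  then have "M - {#x#} + ({#x#} + {#z#}) = add_mset z M"
    by simp
  then show ?thesis
    using homog_sub_linear[OF assms homog.mult[OF homog.var[of x] homog.var[of z]]] by simp
qed

lemma homog_mult_sub_var:
  assumes "homog M K f" "count M x = 1"
  shows "homog (add_mset z M) K (free_var x * sub x (free_var z) f)"
proof -
  have "x \<in># M"
    using assms(2) by (simp flip: count_greater_zero_iff)
  then have eq: "add_mset x (add_mset z (M - {#x#})) = add_mset z M"
    by (simp add: add_mset_commute[of x])
  show ?thesis
    using homog_var_mult[OF homog_sub_var[OF assms, of z], of x] unfolding eq .
qed

lemma homog_leibniz_defect:
  assumes "homog M K f" "count M x = 1"
  shows "homog (add_mset z M) K (leibniz_defect x z f)"
  unfolding leibniz_defect_def
  by (intro homog_diff homog_sub_mult_var homog_mult_sub_var homog_var_mult assms)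

lemma leibniz_defect_sum: "leibniz_defect x z (sum f A) = (\<Sum>i\<in>A. leibniz_defect x z (f i))"
  by (simp add: leibniz_defect_def sum_subtractf sum_distrib_left)

text \<open>At z := 1 and at x := 1 two of the three terms cancel and the third contains
  \<open>f\<close> at x := 1. For any other \<open>y\<close> the substitution commutes with forming
  the defect.\<close>

lemma sub_one_leibniz_defect:
  assumes "homog M K f" "\<And>y. y \<in># M \<Longrightarrow> sub y 1 f = 0" "x \<in># M" "z \<notin># M" "y \<in># add_mset z M"
  shows "sub y 1 (leibniz_defect x z f) = 0"
proof -
  have xz: "x \<noteq> z"
    using assms(3,4) by auto
  have cong: "free.eval \<sigma> f = free.eval \<sigma>' f" if "\<And>v. v \<noteq> z \<Longrightarrow> \<sigma> v = \<sigma>' v" for \<sigma> \<sigma>'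
    by (rule eval_cong_homog[OF assms(1)], rule that) (use assms(4) in auto)
  consider "y = z" | "y = x" | "y \<noteq> x" "y \<noteq> z"
    by blast
  then show ?thesis
  proof cases
    case 1
    have "sub z 1 (sub x (free_var x * free_var z) f) = free.eval free_var f"
      "sub z 1 (sub x (free_var z) f) = free.eval (free_var(x := 1)) f"
      unfolding sub_sub by (rule cong; use xz in simp)+
    moreover have "free.eval (free_var(x := 1)) f = 0"
      using assms(2,3) by (simp add: sub_def)
    ultimately show ?thesis
      using 1 xz sub_id[OF assms(1,4)] by (simp add: leibniz_defect_def)
  next
    case 2
    have "sub x 1 (sub x (free_var x * free_var z) f) = free.eval (free_var(x := free_var z)) f"
      "sub x 1 (sub x (free_var z) f) = free.eval (free_var(x := free_var z)) f"
      unfolding sub_sub by (rule cong; use xz in simp)+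
    then show ?thesis
      using 2 xz assms(2)[OF assms(3)] by (simp add: leibniz_defect_def)
  next
    case 3
    then have "sub y 1 (sub x h f) = 0" if "sub y 1 h = h" for h
      using that assms(2)[of y] assms(5) by (subst sub_commute) auto
    moreover have "x \<noteq> y" "z \<noteq> y"
      using 3 by auto
    ultimately show ?thesis
      using 3 assms(2)[of y] assms(5) by (simp add: leibniz_defect_def)
  qed
qed

text \<open>The weight of \<open>x * z\<close> is the sum of the two weights. With rows \<rho>1 at
  \<open>x\<close> and \<rho>2 at the fresh \<open>z\<close>, the three terms of the defect are the
  coefficients of \<open>f\<close> for the sum of the rows, for \<rho>1 and for \<rho>2.\<close>

lemma leibniz_imp_row_additive:
  fixes f :: "('k::field_char_0, 'v) free_jb"
  assumes f: "homog M K f" "multilinear M" and z: "z \<notin># M"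
    and defect: "\<And>x. x \<in># M \<Longrightarrow> leibniz_defect x z f = 0"
  shows "row_additive M f"
  unfolding row_additive_def
proof (intro allI impI)
  fix x \<rho>1 \<rho>2 t1 t2 and C :: "'v \<Rightarrow> 'v option \<Rightarrow> 'k"
  assume x: "x \<in># M"
  then have count: "count M x = 1"
    using f(2) multilinear_count by metis
  have xz: "x \<noteq> z"
    using x z by auto
  define C' where "C' = row x \<rho>1 t1 (row z \<rho>2 t2 C)"
  have eq: "coef C' (sub x (free_var x * free_var z) f)
      = coef C' (free_var z * f) + coef C' (free_var x * sub x (free_var z) f)"
  proof -
    have "sub x (free_var x * free_var z) f = free_var z * f + free_var x * sub x (free_var z) f"
      using defect[OF x] by (simp add: leibniz_defect_def algebra_simps)
    then show ?thesis
      using coef_add[OF homog_var_mult[OF f(1), of z] homog_mult_sub_var[OF f(1) count, of z], of C']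
      by simp
  qed
  have "coef C' (sub x (free_var x * free_var z) f) = coef (pull x ({#x, z#}, 0) C') f"
    using coef_sub_linear[OF f(1) count homog.mult[OF homog.var[of x] homog.var[of z]], of C']
    by (simp add: coef_mult[OF homog.var homog.var] add_mset_commute)
  also have "\<dots> = coef (row x (\<lambda>j. \<rho>1 j + \<rho>2 j) (t1 + t2) C) f"
    by (rule coef_cong_row[OF f(1), where x = x])
      (use xz z in \<open>auto simp: skew_pull_left skew_pull_other pull_None skew_row C'_def\<close>)
  finally have 1: "coef C' (sub x (free_var x * free_var z) f)
    = coef (row x (\<lambda>j. \<rho>1 j + \<rho>2 j) (t1 + t2) C) f" .
  have 2: "coef C' (free_var z * f) = coef (row x \<rho>1 t1 C) f"
    unfolding coef_var_mult[OF f(1)]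
    by (rule coef_cong_row[OF f(1), where x = x]) (use xz z in \<open>auto simp: skew_row C'_def\<close>)
  have "coef C' (free_var x * sub x (free_var z) f) = coef (pull x ({#z#}, 0) C') f"
    unfolding coef_var_mult[OF homog_sub_var[OF f(1) count]]
    using coef_sub_linear[OF f(1) count homog.var[of z], of C'] by simp
  also have "\<dots> = coef (row x \<rho>2 t2 C) f"
    by (rule coef_cong_row[OF f(1), where x = x])
      (use xz z in \<open>auto simp: skew_pull_left skew_pull_other pull_None skew_row C'_def\<close>)
  finally show "coef (row x (\<lambda>j. \<rho>1 j + \<rho>2 j) (t1 + t2) C) f
      = coef (row x \<rho>1 t1 C) f + coef (row x \<rho>2 t2 C) f"
    using eq 1 2 by simp
qed

lemma t_ideal_angle_D:
  fixes I :: "('k::field_char_0, nat) free_jb set"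
  assumes I: "t_ideal I" and f0: "f0 \<in> I" "f0 \<noteq> 0"
  obtains M f where "multilinear M" "M \<noteq> {#}" "angle_D M f" "f \<in> I" "f \<noteq> 0" "f \<in> multidegree_span M"
proof -
  note subspace = t_idealD(1)[OF I]
  obtain M0 f1 where f1: "multilinear M0" "f1 \<in> I" "f1 \<noteq> 0" "f1 \<in> multidegree_span M0"
    by (rule t_ideal_multilinear[OF assms], rule that)
  have "free.subspace {f. homog M0 K f}" for K
    by (auto simp: free.subspace_def intro: homog.zero homog.add homog.scale)
  then obtain A g where A: "finite A" "A \<subseteq> UNIV" "\<And>K. g K \<in> {f. homog M0 K f}" "f1 = (\<Sum>K\<in>A. g K)"
    by (rule free.span_UN_subspaces[OF f1(4)[unfolded multidegree_span_def]]) (rule that)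
  obtain N where N: "A \<subseteq> {..N}"
    using A(1) finite_nat_iff_bounded_le by blast
  \<comment> \<open>Substitutions do not separate the numbers of brackets, so the components
    \<open>fs K\<close> travel together: their sum lies in \<open>I\<close>, and at least one of
    them is nonzero. \<open>N\<close> stays fixed because 1, \<open>z\<close> and
    \<open>x * z\<close>, the elements substituted in the reduction, contain no brackets.\<close>
  define good where "good M fs \<longleftrightarrow> multilinear M \<and> (\<forall>K. homog M K (fs K))
     \<and> (\<Sum>K\<le>N. fs K) \<in> I \<and> (\<exists>K\<le>N. fs K \<noteq> 0)" for M and fs :: "nat \<Rightarrow> ('k, nat) free_jb"
  have "good M0 (\<lambda>K. if K \<in> A then g K else 0)"
  proof -
    have sum: "(\<Sum>K\<le>N. if K \<in> A then g K else 0) = f1"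
      unfolding A(4) using N by (intro sum.mono_neutral_cong_right) auto
    moreover have "\<exists>K\<le>N. (if K \<in> A then g K else 0) \<noteq> 0"
    proof (rule ccontr)
      assume "\<not> ?thesis"
      then have "(\<Sum>K\<le>N. if K \<in> A then g K else 0) = 0"
        by (intro sum.neutral) auto
      with sum f1(3) show False
        by simp
    qed
    ultimately show ?thesis
      using f1(1,2) A(3) by (auto simp: good_def intro: homog.zero)
  qed
  \<comment> \<open>In a good family with the fewest variables, x := 1 must kill every component up
    to \<open>N\<close>, as it would otherwise leave a good family with one variable less.\<close>
  then obtain M1 fs1 where good1: "good M1 fs1"
    and min: "\<And>M fs. good M fs \<Longrightarrow> size M1 \<le> size M"
    using ex_has_least_nat[of "\<lambda>M. \<exists>fs. good M fs" M0 size] by metis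
  define reduced where "reduced M fs \<longleftrightarrow> good M fs \<and> (\<forall>K\<le>N. \<forall>x\<in>#M. sub x 1 (fs K) = 0)"
    for M and fs :: "nat \<Rightarrow> ('k, nat) free_jb"
  have "reduced M1 fs1"
    unfolding reduced_def
  proof (intro conjI allI impI ballI)
    fix K x
    assume K: "K \<le> N" and x: "x \<in># M1"
    then have count: "count M1 x = 1"
      using good1 multilinear_count unfolding good_def by metis
    have "\<not> good (M1 - {#x#}) (\<lambda>K. sub x 1 (fs1 K))"
      using min[of "M1 - {#x#}"] size_Diff1_less[OF x] by fastforce
    moreover have "homog (M1 - {#x#}) K (sub x 1 (fs1 K))" for K
      using homog_sub_linear[of M1 K "fs1 K" x, OF _ count homog.one] good1 by (simp add: good_def)
    moreover have "(\<Sum>K\<le>N. sub x 1 (fs1 K)) \<in> I"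
      using t_idealD(4)[OF I, of "\<Sum>K\<le>N. fs1 K" x 1] good1 by (simp add: good_def)
    ultimately show "sub x 1 (fs1 K) = 0"
      using K good1 multilinear_diff unfolding good_def by blast
  qed (fact good1)
  moreover have bound: "size M < Suc (2 * N)" if "reduced M fs" for M fs
  proof (rule ccontr)
    assume large: "\<not> size M < Suc (2 * N)"
    have M: "multilinear M" "\<And>K. homog M K (fs K)"
      using \<open>reduced M fs\<close> by (simp_all add: reduced_def good_def)
    obtain K where K: "K \<le> N" "fs K \<noteq> 0"
      using \<open>reduced M fs\<close> by (auto simp: reduced_def good_def)
    have card: "card (set_mset M) = size M"
      unfolding size_multiset_overloaded_eq using multilinear_count[OF M(1)] by simp
    have "coef C (fs K) = 0" for C
    proof (rule few_rows_eq_zero[OF few_rows_coef[OF M(2)] finite_set_mset])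
      show "2 * K < card (set_mset M)"
        using large K(1) card by simp
      fix x C
      assume x: "x \<in># M"
      then have "count M x = 1"
        using M(1) multilinear_count by metis
      moreover have "sub x 1 (fs K) = 0"
        using \<open>reduced M fs\<close> K(1) x by (simp add: reduced_def)
      ultimately show "coef (zero_row x C) (fs K) = 0"
        using coef_sub_one[OF M(2)[of K], of x C] by simp
    qed
    then have "fs K = 0"
      using multilinear_eq_zero[OF M(2,1)] by blast
    with K(2) show False ..
  qed
  ultimately obtain M fs where red: "reduced M fs"
    and max: "\<And>M' fs'. reduced M' fs' \<Longrightarrow> size M' \<le> size M"
    using ex_has_greatest_nat[of "\<lambda>M. \<exists>fs. reduced M fs" M1 size "Suc (2 * N)"] by metis
  have M: "multilinear M" "\<And>K. homog M K (fs K)" "(\<Sum>K\<le>N. fs K) \<in> I" "\<exists>K\<le>N. fs K \<noteq> 0"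
    and sub1: "\<And>K x. K \<le> N \<Longrightarrow> x \<in># M \<Longrightarrow> sub x 1 (fs K) = 0"
    using red by (simp_all add: reduced_def good_def)
  obtain z where z: "z \<notin># M"
    using ex_new_if_finite[OF infinite_UNIV_nat finite_set_mset] by blast
  \<comment> \<open>If one component had a nonzero defect, the defects of all components would form
    a reduced family with one more variable, against maximality.\<close>
  have "leibniz_defect x z (fs K) = 0" if "x \<in># M" "K \<le> N" for x K
  proof (rule ccontr)
    assume "leibniz_defect x z (fs K) \<noteq> 0"
    moreover have count: "count M x = 1"
      using M(1) that(1) multilinear_count by metis
    moreover have "multilinear (add_mset z M)"
      using M(1) z by (auto simp: multilinear_def not_in_iff)
    moreover have "leibniz_defect x z (\<Sum>K\<le>N. fs K) \<in> I"
      unfolding leibniz_defect_def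
      by (intro free.subspace_diff subspace t_idealD(2-)[OF I] M(3))
    ultimately have "reduced (add_mset z M) (\<lambda>K. leibniz_defect x z (fs K))"
      unfolding reduced_def good_def
      using homog_leibniz_defect[OF M(2) count] sub_one_leibniz_defect[OF M(2) sub1 that(1) z] that(2)
      by (auto simp: leibniz_defect_sum)
    then show False
      using max[of "add_mset z M"] by fastforce
  qed
  then have "angle_D M (fs K)" if "K \<le> N" for K
    using that z by (intro row_additive_imp_angle_D[OF M(2,1)] leibniz_imp_row_additive[OF M(2,1) z]) auto
  then have "angle_D M (\<Sum>K\<le>N. fs K)"
    by (intro angle_D_sum) auto
  \<comment> \<open>\<open>M\<close> may be empty, with a nonzero scalar as the element found so
    far. The factor \<open>D z\<close> ensures that a variable occurs and raises every bracket
    degree by one.\<close>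
  then have 1: "angle_D (add_mset z M) (free.D (free_var z) * (\<Sum>K\<le>N. fs K))"
    by (rule angle_D.D)
  have hom: "homog (add_mset z M) K (if K = 0 then 0 else free.D (free_var z) * fs (K - 1))" for K
  proof (cases K)
    case (Suc k)
    then show ?thesis
      using homog.mult[OF homog.D[OF homog.var[of z]] M(2)[of k]] by simp
  qed (simp add: homog.zero)
  have shift: "free.D (free_var z) * (\<Sum>K\<le>N. fs K)
      = (\<Sum>K\<le>Suc N. if K = 0 then 0 else free.D (free_var z) * fs (K - 1))"
    by (simp add: sum.atMost_Suc_shift sum_distrib_left del: sum.atMost_Suc)
  obtain K where K: "K \<le> N" "fs K \<noteq> 0"
    using M(4) by blast
  then obtain C where C: "coef C (fs K) \<noteq> 0"
    using multilinear_eq_zero[OF M(2,1)] by blast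
  \<comment> \<open>The value 1 of \<open>z\<close> against \<open>e\<close> makes the coefficient
    of \<open>D z\<close> equal to 1, without affecting \<open>fs K\<close>, which does not contain
    \<open>z\<close>.\<close>
  have "coef (row z (\<lambda>_. 0) 1 C) (free.D (free_var z) * fs K) \<noteq> 0"
    using C coef_row_notin[OF M(2) z]
    by (simp add: coef_mult[OF homog.D[OF homog.var] M(2)] coef_D[OF homog.var])
  then have 2: "free.D (free_var z) * (\<Sum>K\<le>N. fs K) \<noteq> 0"
    unfolding shift using K(1) by (intro sum_homog_nonzero[OF hom, of "Suc K"]) auto
  have "free.D (free_var z) * (\<Sum>K\<le>N. fs K) \<in> multidegree_span (add_mset z M)"
    unfolding shift multidegree_span_def
    by (intro free.span_sum free.span_base) (use hom in blast)
  with 1 2 show ?thesis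
    using t_idealD(2)[OF I M(3)] M(1) z
    by (intro that[of "add_mset z M"]) (auto simp: multilinear_def not_in_iff)
qed

section \<open>The two families of identities\<close>

lemma angle_D_rename:
  "angle_D M f \<Longrightarrow> angle_D (image_mset h M) (free.eval (\<lambda>v. free_var (h v)) f)"
  by (induction rule: angle_D.induct) (auto intro: angle_D.intros)

text \<open>The monomials of the first family, counted from 0 and with a list in place of the
  permutation. Multiplication by some \<open>D x\<close> then appends \<open>x\<close>, and
  multiplication by some \<open><x, a>\<close> puts \<open>x\<close> and \<open>a\<close> in
  front.\<close>

definition angle_D_monomial :: "nat \<Rightarrow> 'v list \<Rightarrow> ('k::field_char_0, 'v) free_jb" where
  "angle_D_monomial i xs =
     (\<Prod>k<i. free.angle (free_var (xs ! (2 * k))) (free_var (xs ! Suc (2 * k))))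
     * (\<Prod>k = 2 * i..<length xs. free.D (free_var (xs ! k)))"

lemma angle_D_span:
  fixes f :: "('k::field_char_0, 'v) free_jb"
  shows "angle_D M f \<Longrightarrow> f \<in> free.span {angle_D_monomial i xs |i xs. mset xs = M \<and> 2 * i \<le> length xs}"
proof (induction rule: angle_D.induct)
  case (const c)
  have "1 = (angle_D_monomial 0 [] :: ('k, 'v) free_jb)"
    by (simp add: angle_D_monomial_def)
  then show ?case
    by (intro free.span_scale free.span_base) force
next
  case (D M f x)
  show ?case
    using D.IH
  proof (induction rule: free.span_induct_alt)
    case (step c g h)
    then obtain i xs where g: "g = angle_D_monomial i xs" "mset xs = M" "2 * i \<le> length xs"
      by blast
    have "(\<Prod>k<i. free.angle (free_var ((xs @ [x]) ! (2 * k))) (free_var ((xs @ [x]) ! Suc (2 * k))))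
        = (\<Prod>k<i. free.angle (free_var (xs ! (2 * k))) (free_var (xs ! Suc (2 * k))) :: ('k, 'v) free_jb)"
      using g(3) by (intro prod.cong HOL.refl) (simp add: nth_append)
    moreover have "(\<Prod>k = 2 * i..<length (xs @ [x]). free.D (free_var ((xs @ [x]) ! k)))
        = (\<Prod>k = 2 * i..<length xs. free.D (free_var (xs ! k))) * (free.D (free_var x) :: ('k, 'v) free_jb)"
      using g(3) by (simp add: nth_append)
    ultimately have "free.D (free_var x) * g = angle_D_monomial i (xs @ [x])"
      unfolding g(1) angle_D_monomial_def by (simp only: ac_simps)
    moreover have "mset (xs @ [x]) = add_mset x M" "2 * i \<le> length (xs @ [x])"
      using g by simp_all
    ultimately have "free.D (free_var x) * g
        \<in> free.span {angle_D_monomial i xs |i xs. mset xs = add_mset x M \<and> 2 * i \<le> length xs}"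
      by (intro free.span_base) blast
    then show ?case
      using step.IH by (simp add: distrib_left free.scale_mult_right free.span_add free.span_scale)
  qed (simp add: free.span_zero)
next
  case (angle M f x a)
  show ?case
    using angle.IH
  proof (induction rule: free.span_induct_alt)
    case (step c g h)
    then obtain i xs where g: "g = angle_D_monomial i xs" "mset xs = M" "2 * i \<le> length xs"
      by blast
    have "(\<Prod>k<Suc i. free.angle (free_var ((x # a # xs) ! (2 * k))) (free_var ((x # a # xs) ! Suc (2 * k))))
        = free.angle (free_var x) (free_var a)
          * (\<Prod>k<i. free.angle (free_var (xs ! (2 * k))) (free_var (xs ! Suc (2 * k))) :: ('k, 'v) free_jb)"
      by (simp add: prod.lessThan_Suc_shift del: prod.lessThan_Suc)
    moreover have "(\<Prod>k = 2 * Suc i..<length (x # a # xs). free.D (free_var ((x # a # xs) ! k)))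
        = (\<Prod>k = 2 * i..<length xs. free.D (free_var (xs ! k)) :: ('k, 'v) free_jb)"
      by (rule prod.reindex_bij_witness[of _ "\<lambda>k. Suc (Suc k)" "\<lambda>k. k - 2"])
        (auto simp: nth_Cons' numeral_2_eq_2)
    ultimately have "free.angle (free_var x) (free_var a) * g = angle_D_monomial (Suc i) (x # a # xs)"
      unfolding g(1) angle_D_monomial_def by (simp only: ac_simps)
    moreover have "mset (x # a # xs) = add_mset x (add_mset a M)" "2 * Suc i \<le> length (x # a # xs)"
      using g by simp_all
    ultimately have "free.angle (free_var x) (free_var a) * g
        \<in> free.span {angle_D_monomial i xs |i xs. mset xs = add_mset x (add_mset a M) \<and> 2 * i \<le> length xs}"
      by (intro free.span_base) blast
    then show ?case
      using step.IH by (simp add: distrib_left free.scale_mult_right free.span_add free.span_scale)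
  qed (simp add: free.span_zero)
qed (rule free.span_add)

lemma angle_D_poly_linear:
  "angle_D_poly m (\<lambda>\<sigma> i. r * c \<sigma> i + d \<sigma> i) = free_scale r (angle_D_poly m c) + angle_D_poly m d"
  by (simp add: angle_D_poly_def sum.distrib free.scale_left_distrib free.scale_sum_right)

lemma angle_D_monomial_eq_poly:
  assumes "mset xs = mset_set {1..m}" "2 * i \<le> length xs"
  shows "\<exists>c. (angle_D_monomial i xs :: ('k::field_char_0, nat) free_jb) = angle_D_poly m c"
proof -
  have set: "set xs = {1..m}"
    using assms(1) by (metis finite_atLeastAtMost finite_set_mset_mset_set set_mset_mset)
  have length: "length xs = m"
    using arg_cong[OF assms(1), of size] by simp
  have xs: "distinct xs" "set xs = {1..m}" "length xs = m"
    using set length by (auto intro: card_distinct)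
  \<comment> \<open>Lists start at 0 and permutations act on \<open>{1..m}\<close>, hence the shift;
    outside this set a permutation has to be the identity.\<close>
  define \<tau> where "\<tau> k = (if k \<in> {1..m} then xs ! (k - 1) else k)" for k
  have \<tau>: "\<tau> permutes {1..m}"
  proof (rule bij_imp_permutes)
    have "bij_betw (\<lambda>k. k - 1) {1..m} {..<m}"
      by (rule bij_betwI[of _ _ _ Suc]) auto
    moreover have "bij_betw ((!) xs) {..<m} {1..m}"
      using bij_betw_nth[OF xs(1)] xs(2,3) by simp
    ultimately have "bij_betw (\<lambda>k. xs ! (k - 1)) {1..m} {1..m}"
      using bij_betw_trans[of "\<lambda>k. k - 1" "{1..m}" "{..<m}" "(!) xs"] by (simp add: comp_def)
    then show "bij_betw \<tau> {1..m} {1..m}"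
      by (rule bij_betw_cong[THEN iffD1, rotated]) (simp add: \<tau>_def)
  qed (auto simp: \<tau>_def)
  define c where "c \<sigma> j = (if j = i \<and> \<sigma> = \<tau> then 1 else 0 :: 'k)" for \<sigma> j
  define F where "F \<sigma> j = (\<Prod>k = 1..j. free.angle (free_var (\<sigma> (2 * k - 1))) (free_var (\<sigma> (2 * k))))
           * (\<Prod>k = 2 * j + 1..m. free.D (free_var (\<sigma> k)) :: ('k, nat) free_jb)"
    for \<sigma> :: "nat \<Rightarrow> nat" and j :: nat
  have fin: "finite {\<sigma>. \<sigma> permutes {1..m}}"
    by (rule finite_permutations) simp
  have "angle_D_poly m c = (\<Sum>j = 0..m div 2. \<Sum>\<sigma> | \<sigma> permutes {1..m}. if \<sigma> = \<tau> then (if j = i then F \<tau> i else 0) else 0)"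
    unfolding angle_D_poly_def F_def[symmetric]
    by (intro sum.cong HOL.refl) (auto simp: c_def)
  also have "\<dots> = (\<Sum>j = 0..m div 2. if j = i then F \<tau> i else 0)"
    using fin \<tau> by (intro sum.cong HOL.refl) simp
  also have "\<dots> = F \<tau> i"
    using assms(2) xs(3) by simp
  finally have "angle_D_poly m c = F \<tau> i" .
  moreover have "(\<Prod>k = 1..i. free.angle (free_var (\<tau> (2 * k - 1))) (free_var (\<tau> (2 * k))))
      = (\<Prod>k<i. free.angle (free_var (xs ! (2 * k))) (free_var (xs ! Suc (2 * k))) :: ('k, nat) free_jb)"
    by (rule prod.reindex_bij_witness[of _ Suc "\<lambda>k. k - 1"])
      (use assms(2) xs(3) in \<open>auto simp: \<tau>_def Suc_diff_Suc numeral_2_eq_2\<close>)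
  moreover have "(\<Prod>k = 2 * i + 1..m. free.D (free_var (\<tau> k)))
      = (\<Prod>k = 2 * i..<length xs. free.D (free_var (xs ! k)) :: ('k, nat) free_jb)"
    by (rule prod.reindex_bij_witness[of _ Suc "\<lambda>k. k - 1"])
      (use assms(2) xs(3) in \<open>auto simp: \<tau>_def\<close>)
  ultimately have "angle_D_poly m c = angle_D_monomial i xs"
    by (simp add: F_def angle_D_monomial_def)
  then show ?thesis
    by metis
qed

lemma angle_D_imp_poly:
  fixes f :: "('k::field_char_0, nat) free_jb"
  assumes "angle_D (mset_set {1..m}) f"
  shows "\<exists>c. f = angle_D_poly m c"
  using angle_D_span[OF assms]
proof (induction rule: free.span_induct_alt)
  case base
  show ?case by (rule exI[of _ "\<lambda>_ _. 0"]) (simp add: angle_D_poly_def)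
next
  case (step r g h)
  then obtain c d where "g = angle_D_poly m c" "h = angle_D_poly m d"
    using angle_D_monomial_eq_poly by blast
  then have "free_scale r g + h = angle_D_poly m (\<lambda>\<sigma> i. r * c \<sigma> i + d \<sigma> i)"
    by (simp add: angle_D_poly_linear)
  then show ?case by blast
qed

section \<open>The common factor of the second family\<close>

lemma prod_append_interval:
  fixes w :: "nat \<Rightarrow> 'a::comm_monoid_mult"
  shows "(\<Prod>k = 1..a. w k) * (\<Prod>k = 1..b. w (a + k)) = (\<Prod>k = 1..a + b. w k)"
  by (induction b) (simp_all add: mult.assoc[symmetric])

lemma prod_pairs:
  fixes w :: "nat \<Rightarrow> 'a::comm_monoid_mult"
  shows "(\<Prod>k = 1..n. w (2 * k - 1) * w (2 * k)) = (\<Prod>k = 1..2 * n. w k)"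
  by (induction n) (simp_all add: mult.assoc)

text \<open>In each summand every one of the \<open>2 * m\<close> variables \<open>Z k\<close>
  occurs exactly once: the first \<open>2 * i\<close> in the factors \<open>quad\<close>, the next
  \<open>2 * (m - 2 * i)\<close> in the factors \<open>triple\<close>, and the last
  \<open>2 * i\<close> on their own. Their product thus splits off from the whole sum.\<close>

lemma quad_triple_poly_eq:
  fixes c :: "(nat \<Rightarrow> nat) \<Rightarrow> nat \<Rightarrow> 'k::field_char_0"
  shows "quad_triple_poly m c
    = (\<Prod>k = 1..2 * m. free_var (Z k)) * free.eval (\<lambda>v. free_var (X v)) (angle_D_poly m c)"
proof -
  define z :: "nat \<Rightarrow> ('k, xz_var) free_jb" where "z k = free_var (Z k)" for k
  define x :: "nat \<Rightarrow> ('k, xz_var) free_jb" where "x k = free_var (X k)" for k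
  have summand: "(\<Prod>k = 1..i. free.quad (x (\<sigma> (2 * k - 1))) (x (\<sigma> (2 * k))) (z (2 * k - 1)) (z (2 * k)))
        * (\<Prod>k = 1..m - 2 * i. free.triple (x (\<sigma> (2 * i + k))) (z (2 * i + 2 * k - 1)) (z (2 * i + 2 * k)))
        * (\<Prod>k = 1..2 * i. z (2 * m - 2 * i + k))
      = (\<Prod>k = 1..2 * m. z k)
        * ((\<Prod>k = 1..i. free.angle (x (\<sigma> (2 * k - 1))) (x (\<sigma> (2 * k)))) * (\<Prod>k = 2 * i + 1..m. free.D (x (\<sigma> k))))"
    if i: "2 * i \<le> m" for i and \<sigma> :: "nat \<Rightarrow> nat"
  proof -
    let ?A = "\<Prod>k = 1..i. free.angle (x (\<sigma> (2 * k - 1))) (x (\<sigma> (2 * k)))"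
    have quad: "(\<Prod>k = 1..i. free.quad (x (\<sigma> (2 * k - 1))) (x (\<sigma> (2 * k))) (z (2 * k - 1)) (z (2 * k)))
        = ?A * (\<Prod>k = 1..2 * i. z k)"
      unfolding prod_pairs[symmetric] prod.distrib[symmetric]
      by (simp add: free.quad_eq mult.assoc)
    have "(\<Prod>k = 1..m - 2 * i. free.triple (x (\<sigma> (2 * i + k))) (z (2 * i + 2 * k - 1)) (z (2 * i + 2 * k)))
        = (\<Prod>k = 1..m - 2 * i. free.D (x (\<sigma> (2 * i + k))) * (z (2 * i + (2 * k - 1)) * z (2 * i + 2 * k)))"
      by (rule prod.cong) (auto simp: free.triple_eq mult.assoc)
    also have "\<dots> = (\<Prod>k = 1..m - 2 * i. free.D (x (\<sigma> (2 * i + k)))) * (\<Prod>k = 1..2 * (m - 2 * i). z (2 * i + k))"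
      unfolding prod_pairs[of "\<lambda>k. z (2 * i + k)", symmetric] prod.distrib ..
    also have "(\<Prod>k = 1..m - 2 * i. free.D (x (\<sigma> (2 * i + k)))) = (\<Prod>k = 2 * i + 1..m. free.D (x (\<sigma> k)))"
      by (rule prod.reindex_bij_witness[of _ "\<lambda>k. k - 2 * i" "\<lambda>k. 2 * i + k"]) (use i in auto)
    finally have triple: "(\<Prod>k = 1..m - 2 * i. free.triple (x (\<sigma> (2 * i + k))) (z (2 * i + 2 * k - 1)) (z (2 * i + 2 * k)))
        = (\<Prod>k = 2 * i + 1..m. free.D (x (\<sigma> k))) * (\<Prod>k = 1..2 * (m - 2 * i). z (2 * i + k))" .
    have "(\<Prod>k = 1..2 * i. z k) * (\<Prod>k = 1..2 * (m - 2 * i). z (2 * i + k)) * (\<Prod>k = 1..2 * i. z (2 * m - 2 * i + k))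
        = (\<Prod>k = 1..2 * i + 2 * (m - 2 * i) + 2 * i. z k)"
      unfolding prod_append_interval[symmetric] using i by (simp add: algebra_simps)
    also have "2 * i + 2 * (m - 2 * i) + 2 * i = 2 * m"
      using i by simp
    finally have z: "(\<Prod>k = 1..2 * i. z k) * (\<Prod>k = 1..2 * (m - 2 * i). z (2 * i + k))
        * (\<Prod>k = 1..2 * i. z (2 * m - 2 * i + k)) = (\<Prod>k = 1..2 * m. z k)" .
    show ?thesis
      unfolding quad triple z[symmetric] by (simp only: ac_simps)
  qed
  have "free.eval (\<lambda>v. free_var (X v)) (angle_D_poly m c)
      = (\<Sum>i = 0..m div 2. \<Sum>\<sigma> | \<sigma> permutes {1..m}. free_scale (c \<sigma> i)
          ((\<Prod>k = 1..i. free.angle (x (\<sigma> (2 * k - 1))) (x (\<sigma> (2 * k))))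
            * (\<Prod>k = 2 * i + 1..m. free.D (x (\<sigma> k)))))"
    by (simp add: angle_D_poly_def x_def)
  then show ?thesis
    unfolding quad_triple_poly_def Let_def x_def[symmetric] z_def[symmetric]
    by (simp only: sum_distrib_left free.scale_mult_right)
      (intro sum.cong HOL.refl arg_cong[where f = "free_scale _"] summand, simp)
qed

theorem theorem15:
  fixes scale :: "'k::field_char_0 \<Rightarrow> 'a::{comm_ring, comm_monoid_mult} \<Rightarrow> 'a"
    and bracket :: "'a \<Rightarrow> 'a \<Rightarrow> 'a"
    and g0 :: "('k, nat) free_jb"
  assumes "jordan_bracket_algebra scale bracket"
    and "jordan_bracket_algebra.polynomial_identity scale bracket g0"
    and "g0 \<noteq> 0"
  shows "(\<exists>m\<ge>1. \<exists>c. angle_D_poly m c \<noteq> 0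
            \<and> jordan_bracket_algebra.polynomial_identity scale bracket (angle_D_poly m c))
       \<and> (\<exists>m\<ge>1. \<exists>c. quad_triple_poly m c \<noteq> 0
            \<and> jordan_bracket_algebra.polynomial_identity scale bracket (quad_triple_poly m c))"
proof -
  interpret jordan_bracket_algebra scale bracket
    by (rule assms(1))
  have "t_ideal {f :: ('k, nat) free_jb. polynomial_identity f}"
    by (auto simp: t_ideal_def free.subspace_def polynomial_identity_def eval_eval)
  then obtain M and f :: "('k, nat) free_jb" where f: "multilinear M" "M \<noteq> {#}" "angle_D M f" "polynomial_identity f"
    "f \<noteq> 0" "f \<in> multidegree_span M"
    using assms(2,3) by (auto elim!: t_ideal_angle_D)
  define m where "m = card (set_mset M)"
  have m: "m \<ge> 1"
    using f(2) by (simp add: m_def Suc_le_eq card_gt_0_iff)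
  obtain h0 where "bij_betw h0 (set_mset M) {0..<m}"
    using ex_bij_betw_finite_nat[OF finite_set_mset] unfolding m_def by blast
  moreover have "bij_betw Suc {0..<m} {1..m}"
    by (rule bij_betwI[of _ _ _ "\<lambda>k. k - 1"]) auto
  ultimately obtain h where h: "bij_betw h (set_mset M) {1..m}"
    using bij_betw_trans by blast
  have "M = mset_set (set_mset M)"
    using multilinear_count[OF f(1)] by (auto intro!: multiset_eqI simp: count_mset_set' not_in_iff)
  then have "image_mset h M = mset_set {1..m}"
    using h image_mset_mset_set[of h "set_mset M"] by (metis bij_betw_def)
  then obtain c where c: "free.eval (\<lambda>v. free_var (h v)) f = angle_D_poly m c"
    using angle_D_imp_poly angle_D_rename[OF f(3), of h] by metis
  \<comment> \<open>Only variables of \<open>M\<close> occur in \<open>f\<close>, so an inverse of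
    \<open>h\<close> on these undoes the renaming.\<close>
  have "free.eval (\<lambda>v. free_var (inv_into (set_mset M) h v)) (angle_D_poly m c) = f"
    unfolding c[symmetric] free.eval_eval
    by (rule sub_multidegree_cong[OF f(6)]) (use h in \<open>simp add: bij_betw_def\<close>)
  then have nonzero: "angle_D_poly m c \<noteq> 0"
    using f(5) by auto
  have identity: "polynomial_identity (angle_D_poly m c)"
    using f(4) unfolding c[symmetric] polynomial_identity_def eval_eval by blast
  \<comment> \<open>Setting each \<open>Z k\<close> to 1 removes the common factor and so carries
    nonvanishing over from the first family to the second.\<close>
  have "free.eval (case_xz_var free_var (\<lambda>_. 1)) (quad_triple_poly m c) = angle_D_poly m c"
    by (simp add: quad_triple_poly_eq free.eval_eval)
  then have "quad_triple_poly m c \<noteq> 0"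
    using nonzero by auto
  moreover have "polynomial_identity (quad_triple_poly m c)"
    using identity by (simp add: polynomial_identity_def quad_triple_poly_eq eval_eval)
  ultimately show ?thesis
    using m nonzero identity by blast
qed

end
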